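(* Let $r\ge2$ be an integer, let $k>1+1/r$ be real, and let $\epsilon>0$. Then for integers $N\ge1$ one has $$\int_{\mathbb T}\Big|\sum_{\substack{f\in\mathcal M\\ |f|\le q^N}}a_r(f)e(f\alpha)\Big|^k\,d\alpha = Cq^{N(k-1)}+O\big(q^{N(k-1-\theta)}\big),$$ where the implicit constant may depend on $k,q,r,\epsilon$ but not on $N$, and the constants may be taken to be $$C=\Big(\frac1{\zeta_q(r)}\Big)^k\,\mathfrak S_r(k)\,B(k)$$ and $$\theta=\begin{cases}1-1/r & \text{if } k>3+1/r,\\ \tfrac12(1-1/r)(k-1-1/r)-\epsilon & \text{if } 2+1/r<k\le 3+1/r,\\ \dfrac{(1-1/r)^2(k-1-1/r)}{(1-1/r)(k-1-1/r)+(3-k)}-\epsilon & \text{if } k\le 2+1/r.\end{cases}$$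
   Context: Let $q=p^h$ with $p$ prime and $h\ge 1$ an integer. $\mathbb F_q((1/t))$ is the field of formal Laurent series $\alpha=\sum_{i\le M}\alpha_i t^i$ ($M\in\mathbb Z$, $\alpha_i\in\mathbb F_q$); $\operatorname{ord}(\alpha)$ is the largest $i$ with $\alpha_i\ne0$, with $\operatorname{ord}(0)=-\infty$, and $|\alpha|=q^{\operatorname{ord}(\alpha)}$, $|0|=0$. The torus is $\mathbb T=\{\alpha\in\mathbb F_q((1/t)):|\alpha|<1\}$, and $d\alpha$ is the Haar measure on $\mathbb F_q((1/t))$ normalized by $\int_{\mathbb T}1\,d\alpha=1$. Put $e_q(c)=\exp(2\pi i\operatorname{tr}(c)/p)$ for $c\in\mathbb F_q$, where $\operatorname{tr}:\mathbb F_q\to\mathbb F_p$ is the trace map, and $e(\alpha)=e_q(\alpha_{-1})$. $\mathcal M$ is the set of monic polynomials in $\mathbb F_q[t]$. A nonzero polynomial is $r$-free if it is not divisible by $\pi^r$ for any irreducible $\pi\in\mathbb F_q[t]$; $0$ is not $r$-free. $a_r$ is the indicator function of the $r$-free polynomials. The zeta function is $\zeta_q(s)=\sum_{f\in\mathcal M}|f|^{-s}=1/(1-q^{1-s})$. The singular series is $$\mathfrak S_r(k)=\prod_{\pi}\big(1+(|\pi|^r-1)^{1-k}\big),$$ the product being over monic irreducible $\pi\in\mathbb F_q[t]$, and $$B(k)=\Big(\frac{q^{k-1}}{q^{k-1}-1}\Big)\Big(\frac1q\sum_{a\in\mathbb F_q}\Big|e_q(a)+\frac1{q-1}\Big|^k-\frac1{(q-1)^k}\Big).$$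 *)

theory Defs
  imports
    "HOL-Probability.Probability"
    "HOL-Computational_Algebra.Formal_Laurent_Series"
    "HOL-Number_Theory.Cong"
begin

section \<open>The additive character of a finite field\<close>

text \<open>
  Throughout, \<open>'a\<close> is the field with \<open>q = CARD('a)\<close> elements and \<open>p = CHAR('a)\<close>.
\<close>

lemma ex1_card_eq_CHAR_power:
  "\<exists>!h. CARD('a::finite_field) = CHAR('a) ^ h"
proof -
  define p where "p = CHAR('a)"
  have p: "prime p" unfolding p_def by simp
  define sub where "sub S \<longleftrightarrow> (0::'a) \<in> S \<and> (\<forall>x\<in>S. \<forall>y\<in>S. x - y \<in> S)" for S
  define Q where "Q n \<longleftrightarrow> (\<exists>S. sub S \<and> card S = p ^ n)" for n
  have Q0: "Q 0" unfolding Q_def sub_def by (intro exI[of _ "{0}"]) auto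
  have bound: "n \<le> CARD('a)" if Qn: "Q n" for n
  proof -
    obtain S :: "'a set" where "card S = p ^ n" using Qn unfolding Q_def by blast
    hence "p ^ n \<le> CARD('a)" using card_mono[of "UNIV::'a set" S] by simp
    moreover have "n < p ^ n" using prime_gt_1_nat[OF p] by (simp add: power_gt_expt)
    ultimately show ?thesis by linarith
  qed
  define m where "m = (GREATEST n. Q n)"
  have Qm: "Q m" unfolding m_def by (rule GreatestI_nat[of Q, OF Q0 bound])
  have maxm: "n \<le> m" if "Q n" for n
    unfolding m_def by (rule Greatest_le_nat[of Q, OF that bound])
  obtain S where S: "sub S" "card S = p ^ m" using Qm unfolding Q_def by blast
  have S0: "0 \<in> S" and Sd: "x \<in> S \<Longrightarrow> y \<in> S \<Longrightarrow> x - y \<in> S" for x y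
    using S(1) unfolding sub_def by auto
  have Sm: "- x \<in> S" if "x \<in> S" for x using Sd[OF S0 that] by simp
  have Sa: "x + y \<in> S" if "x \<in> S" "y \<in> S" for x y using Sd[OF that(1) Sm[OF that(2)]] by simp
  have Sn: "of_nat n * x \<in> S" if "x \<in> S" for n x
    using that by (induction n) (auto simp: S0 algebra_simps intro: Sa)
  have "S = UNIV"
  proof (rule ccontr)
    assume "S \<noteq> UNIV"
    then obtain x where x: "x \<notin> S" by auto
    define f where "f = (\<lambda>(s, n). s + of_nat n * x)"
    have key: "i = j" if ij: "i < p" "j < p" "(of_nat i - of_nat j) * x \<in> S" for i j
    proof (rule ccontr)
      assume "i \<noteq> j"
      have "\<exists>k. [(int i - int j) * k = 1] (mod int p)"
      proof (rule cong_solve_coprime_int)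
        have "\<not> int p dvd int i - int j"
        proof
          assume "int p dvd int i - int j"
          hence "int i mod int p = int j mod int p" by (simp add: mod_eq_dvd_iff)
          thus False using ij \<open>i \<noteq> j\<close> by simp
        qed
        thus "coprime (int i - int j) (int p)"
          using p by (metis coprime_commute prime_imp_coprime prime_nat_int_transfer)
      qed
      then obtain k where k: "[(int i - int j) * k = 1] (mod int p)" by blast
      define n where "n = nat (k mod int p)"
      have n: "int n = k mod int p" using p by (simp add: n_def prime_gt_0_nat)
      have "[(int i - int j) * int n = 1] (mod int p)"
        using k unfolding n cong_def by (simp add: mod_mult_right_eq)
      then obtain l where "(int i - int j) * int n - 1 = int p * l"
        by (auto simp: cong_iff_dvd_diff)
      hence "of_int ((int i - int j) * int n - 1) = (of_int (int p * l) :: 'a)" by simp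
      hence "(of_nat i - of_nat j) * of_nat n = (1 :: 'a)" by (simp add: p_def)
      moreover have "of_nat n * ((of_nat i - of_nat j) * x) \<in> S" by (rule Sn[OF ij(3)])
      ultimately show False using x by (metis mult.assoc mult.commute mult_1)
    qed
    have inj: "inj_on f (S \<times> {..<p})"
    proof (rule inj_onI)
      fix u v assume uv: "u \<in> S \<times> {..<p}" "v \<in> S \<times> {..<p}" "f u = f v"
      obtain s i t j where [simp]: "u = (s, i)" "v = (t, j)" by (metis surj_pair)
      have "(of_nat i - of_nat j) * x = t - s" using uv(3)
        by (simp add: f_def algebra_simps)
      hence "i = j" using key[of i j] uv Sd by simp
      thus "u = v" using uv(3) by (simp add: f_def)
    qed
    have "sub (f ` (S \<times> {..<p}))"
      unfolding sub_def
    proof (intro conjI ballI)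
      show "0 \<in> f ` (S \<times> {..<p})"
        by (rule image_eqI[of _ _ "(0, 0)"]) (use S0 p in \<open>auto simp: f_def prime_gt_0_nat\<close>)
    next
      fix u v assume "u \<in> f ` (S \<times> {..<p})" "v \<in> f ` (S \<times> {..<p})"
      then obtain s i t j where *: "s \<in> S" "t \<in> S" "i < p" "j < p"
        "u = s + of_nat i * x" "v = t + of_nat j * x"
        by (auto simp: f_def)
      define n where "n = (i + (p - j)) mod p"
      have "(of_nat n :: 'a) = of_nat (i + (p - j))"
        unfolding n_def of_nat_eq_iff_cong_CHAR by (simp add: cong_def p_def)
      also have "\<dots> = of_nat i - of_nat j" using *(4) by (simp add: of_nat_diff p_def)
      finally have n: "(of_nat n :: 'a) = of_nat i - of_nat j" .
      have "u - v = f (s - t, n)" unfolding f_def prod.case n *(5,6) by (simp add: algebra_simps)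
      moreover have "n < p" using p by (simp add: n_def prime_gt_0_nat)
      ultimately show "u - v \<in> f ` (S \<times> {..<p})" using * Sd by auto
    qed
    moreover have "card (f ` (S \<times> {..<p})) = p ^ Suc m"
      using S(2) by (simp add: card_image[OF inj] card_cartesian_product)
    ultimately have "Q (Suc m)" unfolding Q_def by blast
    thus False using maxm by fastforce
  qed
  hence "CARD('a) = CHAR('a) ^ m" using S(2) by (simp add: p_def)
  moreover have "h = m" if "CARD('a) = CHAR('a) ^ h" for h
    using that calculation prime_gt_1_nat[OF p] by (simp add: p_def)
  ultimately show ?thesis by blast
qed

definition ff_degree :: "'a::finite_field itself \<Rightarrow> nat" where
  "ff_degree _ = (THE h. CARD('a) = CHAR('a) ^ h)"

lemma card_eq_CHAR_power: "CARD('a::finite_field) = CHAR('a) ^ ff_degree TYPE('a)"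
  unfolding ff_degree_def by (rule theI'[OF ex1_card_eq_CHAR_power])

definition ff_trace :: "'a::finite_field \<Rightarrow> 'a" where
  "ff_trace c = (\<Sum>i<ff_degree TYPE('a). c ^ (CHAR('a) ^ i))"

text \<open>
  The prime field is the set of all \<open>of_nat n\<close>, so an element of \<open>\<F>\<^sub>p\<close> is identified
  with its representative in \<open>{0..<p}\<close>.
\<close>

lemma ex1_ff_trace_eq_of_nat:
  "\<exists>!n. n < CHAR('a) \<and> of_nat n = ff_trace (c :: 'a::finite_field)"
proof -
  define p where "p = CHAR('a)"
  have p: "prime p" unfolding p_def by simp
  have inj: "inj_on (of_nat :: nat \<Rightarrow> 'a) {..<p}"
    by (intro inj_onI) (auto simp: of_nat_eq_iff_cong_CHAR cong_def p_def)
  define P where "P = (monom 1 p - monom 1 1 :: 'a poly)"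
  have "coeff P p = 1" using prime_gt_1_nat[OF p] by (simp add: P_def)
  hence P0: "P \<noteq> 0" by auto
  have degP: "degree P \<le> p"
    unfolding P_def using prime_gt_1_nat[OF p]
    by (intro degree_diff_le order_trans[OF degree_monom_le]) auto
  have roots: "{x. poly P x = 0} = {x. x ^ p = x}" by (auto simp: P_def poly_monom)
  have frob: "(of_nat n :: 'a) ^ p = of_nat n" for n
    using freshmans_dream_sum[of p "\<lambda>_. 1 :: 'a" "{..<n}"] p by (simp add: p_def)
  have "of_nat ` {..<p} = {x :: 'a. x ^ p = x}"
  proof (rule card_seteq)
    show "of_nat ` {..<p} \<subseteq> {x :: 'a. x ^ p = x}" using frob by auto
    have "card {x :: 'a. x ^ p = x} \<le> p"
      using card_poly_roots_bound[OF P0] degP unfolding roots by linarith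
    thus "card {x :: 'a. x ^ p = x} \<le> card (of_nat ` {..<p} :: 'a set)"
      using inj by (simp add: card_image)
  qed simp
  moreover have "ff_trace c ^ p = ff_trace c"
  proof -
    define h where "h = ff_degree TYPE('a)"
    have q: "c ^ (p ^ h) = c"
      using finite_field_power_card_eq_same[of c] card_eq_CHAR_power[where ?'a = 'a]
      by (simp add: p_def h_def)
    have "ff_trace c ^ p = (\<Sum>i<h. c ^ (p ^ Suc i))"
      unfolding ff_trace_def h_def[symmetric]
      by (subst freshmans_dream_sum) (use p in \<open>auto simp: p_def mult.commute simp flip: power_mult\<close>)
    also have "\<dots> = (\<Sum>i<h. c ^ (p ^ i))"
      using sum.lessThan_Suc_shift[of "\<lambda>i. c ^ (p ^ i)" h] q by simp
    finally show ?thesis by (simp add: ff_trace_def h_def p_def)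
  qed
  ultimately have "ff_trace c \<in> of_nat ` {..<p}" by blast
  then obtain n where "n < p" "of_nat n = ff_trace c" by auto
  moreover have "n' = n" if "n' < p" "of_nat n' = ff_trace c" for n'
    using inj calculation that by (auto simp: inj_on_def)
  ultimately show ?thesis unfolding p_def by blast
qed

definition ff_char :: "'a::finite_field \<Rightarrow> complex" where
  "ff_char c = exp (2 * of_real pi * \<i> *
     of_nat (THE n. n < CHAR('a) \<and> of_nat n = ff_trace c) / of_nat CHAR('a))"


section \<open>Laurent series in \<open>1/t\<close>\<close>

text \<open>
  \<open>\<F>\<^sub>q((1/t))\<close> is the library type \<open>'a fls\<close> with the library's variable \<open>X\<close>
  standing for \<open>1/t\<close>: thus \<open>t = X\<^sup>-\<^sup>1\<close> (\<open>fls_X_inv\<close>), the coefficient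
  of \<open>t\<^sup>i\<close> in \<open>\<alpha>\<close> is \<open>fls_nth \<alpha> (-i)\<close>, and \<open>ord \<alpha> = -fls_subdegree \<alpha>\<close>
  for nonzero \<open>\<alpha>\<close>.
\<close>

definition laurent_abs :: "'a::finite_field fls \<Rightarrow> real" where
  "laurent_abs \<alpha> = (if \<alpha> = 0 then 0 else real CARD('a) powi (- fls_subdegree \<alpha>))"

definition torus :: "'a::finite_field fls set" where
  "torus = {\<alpha>. laurent_abs \<alpha> < 1}"

definition laurent_char :: "'a::finite_field fls \<Rightarrow> complex" where
  "laurent_char \<alpha> = ff_char (fls_nth \<alpha> 1)"

definition poly_to_laurent :: "'a::finite_field poly \<Rightarrow> 'a fls" where
  "poly_to_laurent f = poly (map_poly fls_const f) fls_X_inv"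

definition poly_abs :: "'a::finite_field poly \<Rightarrow> real" where
  "poly_abs f = laurent_abs (poly_to_laurent f)"

lemma poly_to_laurent_nth:
  "fls_nth (poly_to_laurent f) n = (if n \<le> 0 then coeff f (nat (- n)) else 0)"
proof -
  have sum_nth: "fls_nth (\<Sum>i\<in>A. g i) n = (\<Sum>i\<in>A. fls_nth (g i) n)"
    for A :: "nat set" and g :: "nat \<Rightarrow> 'a fls"
    by (induction A rule: infinite_finite_induct) auto
  have "poly_to_laurent f = (\<Sum>i\<le>degree f. fls_const (coeff f i) * fls_X_inv ^ i)"
    unfolding poly_to_laurent_def poly_altdef
    by (simp add: coeff_map_poly degree_map_poly)
  hence "fls_nth (poly_to_laurent f) n =
      (\<Sum>i\<le>degree f. coeff f i * (if n = - int i then 1 else 0))"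
    by (simp add: sum_nth)
  also have "\<dots> = (\<Sum>i\<le>degree f. if i = nat (- n) \<and> n \<le> 0 then coeff f i else 0)"
    by (intro sum.cong) auto
  also have "\<dots> = (if n \<le> 0 then coeff f (nat (- n)) else 0)"
    by (auto simp: sum.delta not_le coeff_eq_0)
  finally show ?thesis .
qed

lemma poly_abs_eq: "poly_abs f = (if f = 0 then 0 else real CARD('a) ^ degree (f :: 'a::finite_field poly))"
proof (cases "f = 0")
  case False
  have "fls_subdegree (poly_to_laurent f) = - int (degree f)"
    using False by (intro fls_subdegree_eqI) (auto simp: poly_to_laurent_nth coeff_eq_0)
  moreover have "fls_nth (poly_to_laurent f) (- int (degree f)) \<noteq> 0"
    using False by (simp add: poly_to_laurent_nth)
  hence "poly_to_laurent f \<noteq> 0" by auto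
  ultimately show ?thesis using False by (simp add: poly_abs_def laurent_abs_def)
qed (simp add: poly_abs_def laurent_abs_def poly_to_laurent_def)

lemma torus_iff: "\<alpha> \<in> torus \<longleftrightarrow> (\<forall>i\<le>0. fls_nth \<alpha> i = 0)" for \<alpha> :: "'a::finite_field fls"
proof (cases "\<alpha> = 0")
  case False
  have q: "real CARD('a) > 1"
    using card_mono[of UNIV "{0, 1 :: 'a}"] by simp
  have "laurent_abs \<alpha> < 1 \<longleftrightarrow> real CARD('a) powi (- fls_subdegree \<alpha>) < real CARD('a) powi 0"
    using False by (simp add: laurent_abs_def)
  also have "\<dots> \<longleftrightarrow> fls_subdegree \<alpha> > 0"
    using q power_int_strict_increasing[of "- fls_subdegree \<alpha>" 0 "real CARD('a)"]
      power_int_increasing[of 0 "- fls_subdegree \<alpha>" "real CARD('a)"]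
    by (meson leD le_less_linear less_imp_le neg_0_le_iff_le neg_less_0_iff_less)
  also have "\<dots> \<longleftrightarrow> (\<forall>i\<le>0. fls_nth \<alpha> i = 0)"
    using False by (metis fls_eq0_below_subdegree leD linorder_le_less_linear nth_fls_subdegree_nonzero
        order.strict_trans1)
  finally show ?thesis by (simp add: torus_def)
qed (simp add: torus_def laurent_abs_def)


section \<open>Haar measure\<close>

text \<open>
  The library topologizes \<open>'a fls\<close> by the metric \<open>2 powi (- fls_subdegree (a - b))\<close>,
  which induces the same topology as \<open>laurent_abs (a - b)\<close>. The space is locally compact and
  second countable, so regularity of a translation-invariant Borel measure that is finite on compact
  sets is automatic.
\<close>

definition normalized_haar :: "'a::finite_field fls measure \<Rightarrow> bool" where
  "normalized_haar M \<longleftrightarrow> sets M = sets borel \<and>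
     (\<forall>x. \<forall>A\<in>sets borel. emeasure M ((\<lambda>y. x + y) ` A) = emeasure M A) \<and>
     (\<forall>K. compact K \<longrightarrow> emeasure M K < \<infinity>) \<and>
     emeasure M torus = 1"

definition fls_cyl :: "'a::finite_field fls \<Rightarrow> nat \<Rightarrow> 'a fls set" where
  "fls_cyl x n = {y. \<forall>i\<le>int n. fls_nth y i = fls_nth x i}"

lemma fls_cyl_eq_ball: "fls_cyl x n = ball x (inverse (2 ^ n))"
proof -
  have "dist x y < inverse (2 ^ n) \<longleftrightarrow> (\<forall>i\<le>int n. fls_nth y i = fls_nth x i)" for y
  proof (cases "x = y")
    case False
    define d where "d = fls_subdegree (x - y)"
    have nz: "x - y \<noteq> 0" using False by simp
    have "dist x y < inverse (2 ^ n) \<longleftrightarrow> int n < d"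
    proof (cases "d \<ge> 0")
      case True
      hence "dist x y < inverse (2 ^ n) \<longleftrightarrow> n < nat d"
        using False by (simp add: dist_fls_def d_def)
      thus ?thesis using True by linarith
    next
      case F: False
      have "inverse (2 ^ n) \<le> (1::real)" by (simp add: field_simps)
      also have "1 \<le> (2::real) ^ nat (- d)" by simp
      finally show ?thesis using False F by (simp add: dist_fls_def d_def)
    qed
    also have "\<dots> \<longleftrightarrow> (\<forall>i\<le>int n. fls_nth (x - y) i = 0)"
      unfolding d_def using nz
      by (metis fls_eq0_below_subdegree leD linorder_le_less_linear nth_fls_subdegree_nonzero
          order.strict_trans1)
    also have "\<dots> \<longleftrightarrow> (\<forall>i\<le>int n. fls_nth y i = fls_nth x i)" by auto
    finally show ?thesis .
  qed simp
  thus ?thesis by (auto simp: fls_cyl_def)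
qed

lemma torus_eq_fls_cyl: "torus = fls_cyl 0 0"
  by (auto simp: torus_iff fls_cyl_def)

lemma ex_fls_low_zero: "\<exists>m::nat. \<forall>i. i < - int m \<longrightarrow> fls_nth x i = 0"
  by (intro exI[of _ "nat (- fls_subdegree x)"]) (auto intro: fls_eq0_below_subdegree)

definition fls_of_list :: "'a::finite_field list \<times> nat \<Rightarrow> 'a fls" where
  "fls_of_list = (\<lambda>(cs, m). Abs_fls (\<lambda>i. if i < - int m then 0 else nth_default 0 cs (nat (i + int m))))"

lemma fls_of_list_nth:
  "fls_nth (fls_of_list (cs, m)) i = (if i < - int m then 0 else nth_default 0 cs (nat (i + int m)))"
  unfolding fls_of_list_def prod.case
  by (subst nth_Abs_fls_ex_lower_bound) (auto intro!: exI[of _ "- int m"])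

lemma ex_fls_of_list:
  "\<exists>u. \<forall>i. fls_nth (fls_of_list u) i = (if i \<le> int n then fls_nth x i else 0)"
proof -
  obtain m :: nat where m: "\<And>i. i < - int m \<Longrightarrow> fls_nth x i = 0" using ex_fls_low_zero by blast
  show ?thesis
    by (rule exI[of _ "(map (\<lambda>j. fls_nth x (int j - int m)) [0..<n + m + 1], m)"])
       (auto simp: fls_of_list_nth nth_default_def m simp del: upt_Suc)
qed

lemma countable_fls_cyl: "countable (range (\<lambda>(x, n). fls_cyl x n :: 'a::finite_field fls set))"
proof -
  have "range (\<lambda>(x, n). fls_cyl x n) \<subseteq> range (\<lambda>(u, n). fls_cyl (fls_of_list u :: 'a fls) n)"
  proof safe
    fix x :: "'a fls" and n
    obtain u where "\<forall>i. fls_nth (fls_of_list u) i = (if i \<le> int n then fls_nth x i else 0)"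
      using ex_fls_of_list by blast
    hence "fls_cyl x n = fls_cyl (fls_of_list u) n" by (auto simp: fls_cyl_def)
    thus "fls_cyl x n \<in> range (\<lambda>(u, n). fls_cyl (fls_of_list u) n)" by (auto intro!: image_eqI[of _ _ "(u, n)"])
  qed
  thus ?thesis by (rule countable_subset) auto
qed

definition fls_cyls :: "'a::finite_field fls set set" where
  "fls_cyls = insert {} (range (\<lambda>(x, n). fls_cyl x n))"

lemma fls_cyl_in_cyls [simp, intro]: "fls_cyl x n \<in> fls_cyls"
  by (auto simp: fls_cyls_def)

lemma sets_borel_fls: "sets (borel :: 'a::finite_field fls measure) = sigma_sets UNIV fls_cyls"
proof (rule antisym)
  have "U \<in> sigma_sets UNIV fls_cyls" if "open U" for U :: "'a fls set"
  proof -
    have "U = \<Union>{C \<in> range (\<lambda>(x, n). fls_cyl x n). C \<subseteq> U}"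
    proof (intro equalityI subsetI)
      fix x assume "x \<in> U"
      then obtain e where e: "e > 0" "ball x e \<subseteq> U" using \<open>open U\<close> open_contains_ball by blast
      obtain n where "inverse (2::real) ^ n < e"
        using real_arch_pow_inv[of e "inverse 2"] e by auto
      hence "inverse (2 ^ n) \<le> e" by (simp add: field_simps)
      hence "fls_cyl x n \<subseteq> U" using e(2) subset_ball[of "inverse (2 ^ n)" e x]
        unfolding fls_cyl_eq_ball by blast
      moreover have "x \<in> fls_cyl x n" by (simp add: fls_cyl_def)
      ultimately show "x \<in> \<Union>{C \<in> range (\<lambda>(x, n). fls_cyl x n). C \<subseteq> U}"
        by (auto intro!: exI[of _ "fls_cyl x n"] image_eqI[of _ _ "(x, n)"])
    qed auto
    moreover have "countable {C \<in> range (\<lambda>(x, n). fls_cyl x n :: 'a fls set). C \<subseteq> U}"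
      by (rule countable_subset[OF _ countable_fls_cyl]) auto
    ultimately show ?thesis
      by (smt (verit, best) CollectD sigma_sets_UNION sigma_sets.Basic fls_cyls_def insertCI)
  qed
  thus "sets (borel :: 'a fls measure) \<subseteq> sigma_sets UNIV fls_cyls"
    unfolding borel_def by (subst sets_measure_of) (auto intro!: sigma_sets_mono)
  have "C \<in> sets borel" if "C \<in> fls_cyls" for C :: "'a fls set"
    using that by (auto simp: fls_cyls_def fls_cyl_eq_ball)
  thus "sigma_sets UNIV fls_cyls \<subseteq> sets (borel :: 'a fls measure)"
    by (metis sets.sigma_sets_subset space_borel subsetI)
qed

lemma measurable_borel_flsI:
  assumes "\<And>x n. f -` fls_cyl x n \<inter> space M \<in> sets M"
  shows   "f \<in> measurable M (borel :: 'a::finite_field fls measure)"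
proof (rule measurable_sigma_sets[OF sets_borel_fls])
  show "f -` C \<inter> space M \<in> sets M" if "C \<in> fls_cyls" for C
    using that assms by (auto simp: fls_cyls_def)
qed auto

lemma measure_eqI_fls_cyl:
  fixes M N :: "'a::finite_field fls measure"
  assumes "sets M = sets borel" "sets N = sets borel"
  assumes "\<And>x n. emeasure M (fls_cyl x n) = emeasure N (fls_cyl x n)"
  assumes "\<And>x. emeasure M (fls_cyl x 0) \<noteq> \<infinity>"
  shows   "M = N"
proof (rule measure_eqI_generator_eq_countable[where E = fls_cyls and \<Omega> = UNIV])
  show "Int_stable (fls_cyls :: 'a fls set set)"
  proof (rule Int_stableI)
    have *: "fls_cyl x m \<inter> fls_cyl y n \<in> fls_cyls" if "m \<le> n" for x y :: "'a fls" and m n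
    proof (cases "y \<in> fls_cyl x m")
      case True
      hence "fls_cyl x m \<inter> fls_cyl y n = fls_cyl y n" using that by (fastforce simp: fls_cyl_def)
      thus ?thesis by simp
    next
      case False
      hence "fls_cyl x m \<inter> fls_cyl y n = {}" using that by (fastforce simp: fls_cyl_def)
      thus ?thesis by (simp add: fls_cyls_def)
    qed
    fix A B :: "'a fls set" assume "A \<in> fls_cyls" "B \<in> fls_cyls"
    moreover have "fls_cyl x m \<inter> fls_cyl y n \<in> fls_cyls" for x y :: "'a fls" and m n
      using *[of m n x y] *[of n m y x] by (metis Int_commute linear)
    moreover have "{} \<in> (fls_cyls :: 'a fls set set)" by (simp add: fls_cyls_def)
    moreover have "A = {} \<or> (\<exists>x m. A = fls_cyl x m)" "B = {} \<or> (\<exists>x m. B = fls_cyl x m)"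
      using calculation(1,2) by (auto simp: fls_cyls_def)
    ultimately show "A \<inter> B \<in> fls_cyls" by (metis Int_empty_left Int_empty_right)
  qed
  have "range (\<lambda>x. fls_cyl x 0) \<subseteq> range (\<lambda>(x, n). fls_cyl x n :: 'a fls set)" by auto
  thus "countable (range (\<lambda>x. fls_cyl x 0) :: 'a fls set set)"
    using countable_fls_cyl countable_subset by blast
  have "x \<in> fls_cyl x 0" for x :: "'a fls" by (simp add: fls_cyl_def)
  thus "\<Union>(range (\<lambda>x. fls_cyl x 0)) = (UNIV :: 'a fls set)" by blast
  show "emeasure M C = emeasure N C" if "C \<in> fls_cyls" for C
    using that assms(3) by (auto simp: fls_cyls_def)
qed (use assms in \<open>auto simp: sets_borel_fls\<close>)

lemma normalized_haar_fls_cyl: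
  fixes M :: "'a::finite_field fls measure"
  assumes "normalized_haar M"
  shows   "emeasure M (fls_cyl x n) = inverse (of_nat CARD('a)) ^ n"
proof -
  have sets: "sets M = sets borel"
    and inv: "\<And>x A. A \<in> sets borel \<Longrightarrow> emeasure M ((+) x ` A) = emeasure M A"
    and one: "emeasure M torus = 1"
    using assms by (auto simp: normalized_haar_def)
  have meas: "fls_cyl x n \<in> sets borel" for x :: "'a fls" and n by (simp add: fls_cyl_eq_ball)
  have trans: "emeasure M (fls_cyl x n) = emeasure M (fls_cyl 0 n)" for x n
  proof -
    have "y \<in> fls_cyl x n \<Longrightarrow> y - x \<in> fls_cyl 0 n" for y by (simp add: fls_cyl_def)
    hence "fls_cyl x n = (+) x ` fls_cyl 0 n"
      by (force simp: fls_cyl_def intro: image_eqI[of _ _ "_ - x"])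
    thus ?thesis using inv meas by simp
  qed
  have "emeasure M (fls_cyl 0 n) = inverse (of_nat CARD('a)) ^ n"
  proof (induction n)
    case 0
    thus ?case using one by (simp add: torus_eq_fls_cyl)
  next
    case (Suc n)
    define X where "X c = (fls_const c * fls_X ^ Suc n :: 'a fls)" for c
    have X: "fls_nth (X c) i = (if i = int (Suc n) then c else 0)" for c i
      unfolding X_def by (simp del: power_Suc of_nat_Suc)
    have "fls_cyl 0 n = (\<Union>c\<in>UNIV. fls_cyl (X c) (Suc n))"
    proof (intro equalityI subsetI)
      fix y :: "'a fls" assume y: "y \<in> fls_cyl 0 n"
      have "y \<in> fls_cyl (X (fls_nth y (int (Suc n)))) (Suc n)"
        using y by (auto simp: fls_cyl_def X)
      thus "y \<in> (\<Union>c\<in>UNIV. fls_cyl (X c) (Suc n))" by blast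
    qed (auto simp: fls_cyl_def X)
    moreover have "disjoint_family (\<lambda>c. fls_cyl (X c) (Suc n))"
      unfolding disjoint_family_on_def
    proof safe
      fix c d :: 'a and y assume "c \<noteq> d" "y \<in> fls_cyl (X c) (Suc n)" "y \<in> fls_cyl (X d) (Suc n)"
      hence "fls_nth y (int (Suc n)) = c" "fls_nth y (int (Suc n)) = d"
        by (auto simp: fls_cyl_def X simp del: of_nat_Suc)
      thus "y \<in> {}" using \<open>c \<noteq> d\<close> by simp
    qed
    ultimately have "emeasure M (fls_cyl 0 n) = (\<Sum>c\<in>(UNIV::'a set). emeasure M (fls_cyl (X c) (Suc n)))"
      using meas sets by (subst sum_emeasure) (auto simp: disjoint_family_on_def)
    also have "\<dots> = (\<Sum>c\<in>(UNIV::'a set). emeasure M (fls_cyl 0 (Suc n)))"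
      by (intro sum.cong refl trans)
    finally have "inverse (of_nat CARD('a)) ^ n = emeasure M (fls_cyl 0 (Suc n)) * of_nat CARD('a)"
      using Suc.IH by (simp add: mult.commute)
    hence "inverse (of_nat CARD('a)) ^ n / of_nat CARD('a) = emeasure M (fls_cyl 0 (Suc n))"
      by (simp add: mult_divide_eq_ennreal)
    thus ?case by (simp add: divide_ennreal_def mult.commute)
  qed
  thus ?thesis by (simp only: trans[of x n])
qed

lemma ex_normalized_haar: "\<exists>M :: 'a::finite_field fls measure. normalized_haar M"
proof -
  define U where "U = measure_pmf (pmf_of_set (UNIV :: 'a set))"
  interpret product_prob_space "\<lambda>_. U" "UNIV :: nat set"
    unfolding U_def by unfold_locales
  define N where "N = PiM (UNIV :: nat set) (\<lambda>_. U)"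
  have "prob_space N" unfolding N_def by unfold_locales
  define D where "D = {x :: 'a fls. \<forall>i>0. fls_nth x i = 0}"
  have "D \<subseteq> range fls_of_list"
  proof
    fix x assume x: "x \<in> D"
    obtain u where u: "\<forall>i. fls_nth (fls_of_list u) i = (if i \<le> int 0 then fls_nth x i else 0)"
      using ex_fls_of_list by blast
    have "x = fls_of_list u" using x by (intro fls_eqI) (auto simp: u D_def)
    thus "x \<in> range fls_of_list" by blast
  qed
  hence D: "countable D" by (rule countable_subset) auto
  define \<psi> where "\<psi> s = Abs_fls (\<lambda>i. if i > 0 then s (nat i - 1) else 0 :: 'a)" for s :: "nat \<Rightarrow> 'a"
  have \<psi>: "fls_nth (\<psi> s) i = (if i > 0 then s (nat i - 1) else 0)" for s i
    unfolding \<psi>_def by (subst nth_Abs_fls_ex_lower_bound) (auto intro!: exI[of _ 0])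
  define P where "P = N \<Otimes>\<^sub>M count_space D"
  define \<Phi> where "\<Phi> = (\<lambda>(s, d). \<psi> s + d)"
  define M where "M = distr P borel \<Phi>"
  interpret N: prob_space N by fact
  interpret C: sigma_finite_measure "count_space D"
    using D by (rule sigma_finite_measure_count_space_countable)
  have spN: "space N = UNIV" by (simp add: N_def U_def space_PiM)
  define Z where "Z x n = {s. \<forall>i\<in>{..<n}. s i \<in> {fls_nth x (int i + 1)}}" for x :: "'a fls" and n
  have Z: "Z x n = {s \<in> space (PiM UNIV (\<lambda>_. U)). \<forall>i\<in>{..<n}. s i \<in> {fls_nth x (int i + 1)}}" for x n
    using spN by (simp add: Z_def N_def)
  have Zs: "Z x n \<in> sets N" for x n
    unfolding Z N_def by (intro sets.sets_Collect_finite_All sets_Collect_single) (auto simp: U_def)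
  have single: "emeasure U {c} = inverse (of_nat CARD('a))" for c
    by (simp add: U_def emeasure_pmf_single inverse_ennreal ennreal_of_nat_eq_real_of_nat divide_inverse)
  have Ze: "emeasure N (Z x n) = inverse (of_nat CARD('a)) ^ n" for x n
    unfolding Z N_def by (subst emeasure_PiM_Collect) (auto simp: single, auto simp: U_def)
  have pre: "\<exists>d\<in>D. \<Phi> -` fls_cyl x n \<inter> space P = Z x n \<times> {d}" for x n
  proof -
    obtain u where u: "\<forall>i. fls_nth (fls_of_list u) i = (if i \<le> int 0 then fls_nth x i else 0)"
      using ex_fls_of_list by blast
    define d where "d = fls_of_list u"
    have d: "fls_nth d i = (if i \<le> 0 then fls_nth x i else 0)" for i
      using u by (simp add: d_def)
    have dD: "d \<in> D" by (simp add: D_def d)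
    have "\<psi> s + e \<in> fls_cyl x n \<longleftrightarrow> s \<in> Z x n \<and> e = d" if e: "e \<in> D" for s e
    proof
      assume *: "\<psi> s + e \<in> fls_cyl x n"
      have "fls_nth e i = fls_nth d i" for i
      proof (cases "i \<le> 0")
        case True
        hence "fls_nth (\<psi> s + e) i = fls_nth x i" using * unfolding fls_cyl_def by auto
        thus ?thesis using True by (simp add: \<psi> d)
      qed (use e in \<open>simp add: D_def d\<close>)
      hence "e = d" by (intro fls_eqI)
      moreover have "s i = fls_nth x (int i + 1)" if "i < n" for i
      proof -
        have "fls_nth (\<psi> s + e) (int i + 1) = fls_nth x (int i + 1)"
          using * that unfolding fls_cyl_def by auto
        thus ?thesis using e by (simp add: \<psi> D_def nat_add_distrib)
      qed
      ultimately show "s \<in> Z x n \<and> e = d" by (simp add: Z_def)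
    next
      assume *: "s \<in> Z x n \<and> e = d"
      have "fls_nth (\<psi> s + d) i = fls_nth x i" if "i \<le> int n" for i
      proof (cases "i > 0")
        case True
        define j where "j = nat i - 1"
        have "i = int j + 1" "j < n" using True that by (auto simp: j_def)
        thus ?thesis using * by (simp add: \<psi> d Z_def nat_add_distrib)
      qed (simp add: \<psi> d)
      thus "\<psi> s + e \<in> fls_cyl x n" using * by (simp add: fls_cyl_def)
    qed
    hence "\<Phi> -` fls_cyl x n \<inter> space P = Z x n \<times> {d}"
      using dD spN by (auto simp: \<Phi>_def P_def space_pair_measure)
    thus ?thesis using dD by blast
  qed
  have \<Phi>: "\<Phi> \<in> measurable P borel"
  proof (rule measurable_borel_flsI)
    fix x n
    obtain d where "d \<in> D" "\<Phi> -` fls_cyl x n \<inter> space P = Z x n \<times> {d}" using pre by blast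
    thus "\<Phi> -` fls_cyl x n \<inter> space P \<in> sets P" using Zs by (simp add: P_def)
  qed
  have setsM: "sets M = sets borel" by (simp add: M_def)
  have meas: "fls_cyl x n \<in> sets borel" for x :: "'a fls" and n by (simp add: fls_cyl_eq_ball)
  have Mcyl: "emeasure M (fls_cyl x n) = inverse (of_nat CARD('a)) ^ n" for x n
  proof -
    obtain d where d: "d \<in> D" "\<Phi> -` fls_cyl x n \<inter> space P = Z x n \<times> {d}" using pre by blast
    have "emeasure M (fls_cyl x n) = emeasure P (Z x n \<times> {d})"
      using d unfolding M_def by (simp add: emeasure_distr \<Phi> meas)
    also have "\<dots> = emeasure N (Z x n) * emeasure (count_space D) {d}"
      unfolding P_def using d Zs by (intro C.emeasure_pair_measure_Times) auto
    finally show ?thesis using d by (simp add: Ze)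
  qed
  have "emeasure M ((+) x ` A) = emeasure M A" if A: "A \<in> sets borel" for x A
  proof -
    have vim: "(\<lambda>y. y - x) -` B = (+) x ` B" for B
      by (auto intro: image_eqI[of _ _ "_ - x"])
    have cyl: "(+) x ` fls_cyl z n = fls_cyl (x + z) n" for z n
      unfolding vim[symmetric] by (auto simp: fls_cyl_def algebra_simps)
    have spM: "space M = UNIV" by (simp add: M_def)
    have sub: "(\<lambda>y. y - x) \<in> measurable M borel"
      by (rule measurable_borel_flsI) (simp add: vim cyl setsM meas spM)
    have eq: "emeasure (distr M borel (\<lambda>y. y - x)) (fls_cyl z n) = emeasure M (fls_cyl z n)" for z n
      by (simp only: emeasure_distr[OF sub meas] vim cyl spM Int_UNIV_right Mcyl)
    have "distr M borel (\<lambda>y. y - x) = M"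
      by (rule measure_eqI_fls_cyl) (simp_all add: setsM eq Mcyl)
    hence "emeasure M A = emeasure (distr M borel (\<lambda>y. y - x)) A" by simp
    also have "\<dots> = emeasure M ((+) x ` A)"
      by (simp only: emeasure_distr[OF sub A] vim spM Int_UNIV_right)
    finally show ?thesis by simp
  qed
  moreover have "emeasure M K < \<infinity>" if cpt: "compact K" for K
  proof -
    have "K \<subseteq> (\<Union>x\<in>K. fls_cyl x 0)" by (auto simp: fls_cyl_def)
    moreover have "open (fls_cyl x 0)" for x :: "'a fls" by (simp add: fls_cyl_eq_ball)
    ultimately obtain F where F: "F \<subseteq> K" "finite F" "K \<subseteq> (\<Union>x\<in>F. fls_cyl x 0)"
      using compactE_image[OF cpt, of K "\<lambda>x. fls_cyl x 0"] by metis
    have "emeasure M K \<le> emeasure M (\<Union>x\<in>F. fls_cyl x 0)"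
      using F by (intro emeasure_mono) (auto simp: setsM meas)
    also have "\<dots> \<le> (\<Sum>x\<in>F. emeasure M (fls_cyl x 0))"
      using F by (intro emeasure_subadditive_finite) (auto simp: setsM meas)
    also have "\<dots> < \<infinity>" by (simp add: Mcyl of_nat_less_top)
    finally show ?thesis .
  qed
  ultimately show ?thesis
    unfolding normalized_haar_def
    by (intro exI[of _ M]) (auto simp: setsM torus_eq_fls_cyl Mcyl)
qed

lemma ex1_normalized_haar: "\<exists>!M :: 'a::finite_field fls measure. normalized_haar M"
proof -
  have "M = N" if "normalized_haar M" "normalized_haar N" for M N :: "'a fls measure"
    by (rule measure_eqI_fls_cyl)
       (use that in \<open>auto simp: normalized_haar_fls_cyl\<close>, auto simp: normalized_haar_def)
  thus ?thesis using ex_normalized_haar by blast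
qed

definition haar :: "'a::finite_field fls measure" where
  "haar = (THE M. normalized_haar M)"

lemma normalized_haar_haar: "normalized_haar haar"
  unfolding haar_def by (rule theI'[OF ex1_normalized_haar])


section \<open>\<open>r\<close>-free polynomials and the constants of the asymptotic formula\<close>

definition r_free :: "nat \<Rightarrow> 'a::finite_field poly \<Rightarrow> bool" where
  "r_free r f \<longleftrightarrow> f \<noteq> 0 \<and> (\<forall>\<pi>. irreducible \<pi> \<longrightarrow> \<not> \<pi> ^ r dvd f)"

definition a_ind :: "nat \<Rightarrow> 'a::finite_field poly \<Rightarrow> complex" where
  "a_ind r f = of_bool (r_free r f)"

definition monics :: "'a::finite_field poly set" where
  "monics = {f. lead_coeff f = 1}"

definition exp_sum :: "nat \<Rightarrow> nat \<Rightarrow> 'a::finite_field fls \<Rightarrow> complex" where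
  "exp_sum r N \<alpha> = (\<Sum>f | f \<in> monics \<and> poly_abs f \<le> real CARD('a) ^ N.
     a_ind r f * laurent_char (poly_to_laurent f * \<alpha>))"

definition zeta_ff :: "'a::finite_field itself \<Rightarrow> real \<Rightarrow> real" where
  "zeta_ff _ s = (\<Sum>\<^sub>\<infinity>f\<in>(monics :: 'a poly set). poly_abs f powr (- s))"

text \<open>
  The product over the monic irreducibles is an unordered infinite product: the limit of the finite
  subproducts along the directed set of finite subsets, just as \<open>infsum\<close> is for sums.
\<close>

definition singular_series :: "'a::finite_field itself \<Rightarrow> nat \<Rightarrow> real \<Rightarrow> real" where
  "singular_series _ r k =
     Lim (finite_subsets_at_top {\<pi> :: 'a poly. \<pi> \<in> monics \<and> irreducible \<pi>})
       (\<lambda>F. \<Prod>\<pi>\<in>F. 1 + (poly_abs \<pi> ^ r - 1) powr (1 - k))"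

definition B_const :: "'a::finite_field itself \<Rightarrow> real \<Rightarrow> real" where
  "B_const _ k = (let q = real CARD('a) in
     q powr (k - 1) / (q powr (k - 1) - 1) *
     (1 / q * (\<Sum>a\<in>(UNIV :: 'a set). cmod (ff_char a + 1 / (of_real q - 1)) powr k)
        - 1 / (q - 1) powr k))"

definition main_const :: "'a::finite_field itself \<Rightarrow> nat \<Rightarrow> real \<Rightarrow> real" where
  "main_const A r k = (1 / zeta_ff A (real r)) powr k * singular_series A r k * B_const A k"

definition theta :: "nat \<Rightarrow> real \<Rightarrow> real \<Rightarrow> real" where
  "theta r k \<epsilon> = (let \<rho> = 1 / real r in
     if k > 3 + \<rho> then 1 - \<rho>
     else if k > 2 + \<rho> then 1 / 2 * (1 - \<rho>) * (k - 1 - \<rho>) - \<epsilon>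
     else (1 - \<rho>)\<^sup>2 * (k - 1 - \<rho>) / ((1 - \<rho>) * (k - 1 - \<rho>) + (3 - k)) - \<epsilon>)"

end

theory Submission
  imports Defs "HOL-Computational_Algebra.Polynomial_Factorial"
begin

text \<open>
  Squarefree monic polynomials are indexed by finite sets \<open>F\<close> of monic irreducibles, so Moebius
  inversion writes the exponential sum as a signed sum over \<open>F\<close> of complete sums
  \<open>T\<^sub>M(\<gamma>) = \<Sum> e(g\<gamma>)\<close>, over monic \<open>g\<close> of degree at most \<open>M\<close>, evaluated at
  \<open>\<gamma> = \<Prod>F\<^sup>r \<alpha>\<close>. Such a sum depends only on how many leading
  coefficients of the fractional part of \<open>\<gamma>\<close> vanish and on the first one that does not.

  Around each \<open>a/g\<close> with \<open>g\<close> dividing some \<open>\<Prod>F\<^sup>r\<close> of degree at most \<open>N/2\<close> the sum is compared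
  with a model, the constant \<open>\<Sum> \<mu>(d)/|d|\<^sup>r\<close> (over \<open>d\<close> with \<open>g\<close> dividing \<open>d\<^sup>r\<close>) times \<open>T\<^sub>N(\<beta>) + 1/(q - 1)\<close>;
  adding \<open>1/(q - 1)\<close> makes the complete sums scale exactly. The \<open>k\<close>-th moment of the model is
  the main term. The difference of the \<open>k\<close>-th moments is at most a constant times
  \<open>\<integral>|model|\<^bsup>k-1\<^esup>|error| + \<integral>|error|\<^sup>k\<close>. In the first integral, the terms of the error that are
  not absorbed by the model are independent of the model. The second is bounded by
  \<open>sup |error| = O(q\<^bsup>N(1+1/r)/2\<^esup>)\<close> and by the moment of order \<open>1 + 1/r\<close>, which is
  \<open>q\<^bsup>N/r\<^esup>\<close> up to a power of \<open>N\<close>. This saves \<open>(1 - 1/r)(k - 1 - 1/r)/2\<close> for every \<open>k\<close>, which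
  is at least the third expression for \<open>\<theta>\<close> when \<open>k \<le> 2 + 1/r\<close>.
\<close>

section \<open>Characters and orthogonality\<close>

text \<open>If exactly \<open>j < M\<close> leading coefficients of the fractional part vanish and
  \<open>c\<close> is the next one, the complete sum is
  \<open>(q^j - 1)/(q - 1) + q^j e_q(c)\<close>. Adding \<open>1/(q - 1)\<close> makes it
  proportional to \<open>q^j\<close>; this is the origin of the shift by \<open>1/(q - 1)\<close> in
  \<open>B(k)\<close>. The constants so introduced are bounded by 1 for each of the O(q^(N/r))
  squarefree polynomials.

  The moment of order 1 + 1/r is the one at which all degrees weigh the same. The terms with
  \<open>deg d = n\<close> have first moment about \<open>q^n\<close> and second moment about
  \<open>q^(N - rn + n)\<close>, and interpolation gives \<open>q^(N/r)\<close> whatever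
  \<open>n\<close> is.

  For k > 3 + 1/r the exponent contains no epsilon. A power of N may therefore be lost in the
  moments of the error alone, where the saving is strictly larger than needed, but not in the mixed
  integral. There each term of the error is averaged over each arc of the model separately, and the
  weights are summed geometrically.\<close>

lemma CARD_finite_field_ge_2: "CARD('a::finite_field) \<ge> 2"
  using card_mono[of UNIV "{0, 1 :: 'a}"] by simp

text \<open>The exponential has period \<open>p\<close> in \<open>n\<close>, so any representative
  of the trace serves. This removes the choice made by \<open>THE\<close> in the definition.\<close>

lemma ff_char_eqI:
  assumes "of_nat n = ff_trace (c :: 'a::finite_field)"
  shows   "ff_char c = exp (2 * of_real pi * \<i> * of_nat n / of_nat CHAR('a))"
proof -
  define p where "p = CHAR('a)"
  have p: "prime p" unfolding p_def by simp
  define m where "m = (THE n. n < CHAR('a) \<and> of_nat n = ff_trace c)"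
  have m: "m < p \<and> of_nat m = ff_trace c"
    unfolding m_def p_def by (rule theI'[OF ex1_ff_trace_eq_of_nat])
  hence "(of_nat n :: 'a) = of_nat m" using assms by simp
  hence "n mod p = m mod p" unfolding of_nat_eq_iff_cong_CHAR cong_def p_def .
  hence "n = p * (n div p) + m" using m by (metis mod_less mult_div_mod_eq)
  then obtain l where n: "n = p * l + m" by blast
  have "2 * of_real pi * \<i> * of_nat n / of_nat p =
      2 * of_real pi * \<i> * of_nat m / of_nat p + 2 * of_real pi * \<i> * of_nat l"
    using p unfolding n by (simp add: field_simps prime_gt_0_nat)
  moreover have "exp (2 * of_real pi * \<i> * of_nat l) = 1"
    by (metis exp_2pi_1_int mult.commute of_int_of_nat_eq mult.assoc)
  ultimately have "exp (2 * of_real pi * \<i> * of_nat n / of_nat p) =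
      exp (2 * of_real pi * \<i> * of_nat m / of_nat p)"
    by (simp add: exp_add)
  thus ?thesis by (simp add: ff_char_def m_def p_def)
qed

lemma ff_trace_add: "ff_trace (a + b) = ff_trace a + ff_trace (b :: 'a::finite_field)"
  unfolding ff_trace_def
  by (simp add: sum.distrib[symmetric] freshmans_dream'[OF _ refl])

lemma ff_char_add: "ff_char (a + b) = ff_char a * ff_char (b :: 'a::finite_field)"
proof -
  obtain m n where "of_nat m = ff_trace a" "of_nat n = ff_trace b"
    using ex1_ff_trace_eq_of_nat[of a] ex1_ff_trace_eq_of_nat[of b] by blast
  moreover from this have "of_nat (m + n) = ff_trace (a + b)" by (simp add: ff_trace_add)
  ultimately show ?thesis
    by (simp add: ff_char_eqI add_divide_distrib ring_distribs exp_add[symmetric] del: of_nat_add)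
       (simp add: add_divide_distrib ring_distribs exp_add)
qed

lemma ff_char_0 [simp]: "ff_char (0 :: 'a::finite_field) = 1"
proof -
  have "of_nat 0 = ff_trace (0::'a)" by (simp add: ff_trace_def power_0_left)
  from ff_char_eqI[OF this] show ?thesis by simp
qed

lemma norm_ff_char [simp]: "cmod (ff_char (c :: 'a::finite_field)) = 1"
proof -
  have "2 * of_real pi * \<i> * of_nat n / of_nat m = \<i> * of_real (2 * pi * real n / real m)" for n m
    by simp
  thus ?thesis unfolding ff_char_def by (metis norm_exp_i_times)
qed

text \<open>The trace is a polynomial in \<open>c\<close> of degree at most
  \<open>p^(h-1) < q\<close>, nonzero because its linear coefficient is 1. So it does not vanish on
  the whole field.\<close>

lemma ff_char_nontrivial: "\<exists>c :: 'a::finite_field. ff_char c \<noteq> 1"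
proof -
  define p where "p = CHAR('a)"
  have p: "prime p" unfolding p_def by simp
  define h where "h = ff_degree TYPE('a)"
  have q: "CARD('a) = p ^ h" unfolding p_def h_def by (rule card_eq_CHAR_power)
  have "h \<noteq> 0" using q CARD_finite_field_ge_2[where 'a = 'a] by (cases h) auto
  define P :: "'a poly" where "P = (\<Sum>i<h. monom 1 (p ^ i))"
  have "coeff P 1 = (\<Sum>i<h. if i = 0 then 1 else 0)"
    unfolding P_def coeff_sum using p
    by (intro sum.cong refl) (auto simp: prime_nat_iff)
  hence P0: "P \<noteq> 0" using \<open>h \<noteq> 0\<close> by (auto simp: sum.delta)
  have "degree P \<le> p ^ (h - 1)"
    unfolding P_def using p
    by (intro degree_sum_le order_trans[OF degree_monom_le])
       (auto intro!: power_increasing prime_ge_1_nat)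
  also have "\<dots> < CARD('a)" unfolding q using \<open>h \<noteq> 0\<close> prime_gt_1_nat[OF p]
    by (intro power_strict_increasing) auto
  finally have "card {x. poly P x = 0} < CARD('a)" using card_poly_roots_bound[OF P0] by linarith
  hence "{x. poly P x = 0} \<noteq> UNIV" by auto
  then obtain c where c: "poly P c \<noteq> 0" by auto
  have "poly P c = ff_trace c"
    by (simp add: P_def ff_trace_def poly_sum poly_monom h_def p_def)
  then obtain n where n: "n < p" "of_nat n = ff_trace c" "n \<noteq> 0"
    using ex1_ff_trace_eq_of_nat[of c] c unfolding p_def by (metis of_nat_0)
  have "ff_char c = exp (2 * of_real pi * \<i> * of_nat n / of_nat p)"
    unfolding p_def by (rule ff_char_eqI) fact
  moreover have "exp (2 * of_real pi * \<i> * of_nat n / of_nat p) \<noteq> 1"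
  proof
    assume "exp (2 * of_real pi * \<i> * of_nat n / of_nat p) = 1"
    then obtain l :: int where "2 * pi * real n / real p = of_int (2 * l) * pi"
      by (auto simp: exp_eq_1)
    hence "real n = real_of_int l * real p" using p by (simp add: field_simps prime_gt_0_nat)
    hence "int n = l * int p" by (metis of_int_eq_iff of_int_mult of_int_of_nat_eq)
    hence "p dvd n" by (metis dvd_triv_right int_dvd_int_iff)
    thus False using n by (auto dest: dvd_imp_le)
  qed
  ultimately show ?thesis by metis
qed

text \<open>Translation by \<open>v\<close> permutes \<open>V\<close> and multiplies the sum by
  \<open>\<psi> v\<close>, which is not 1.\<close>

lemma sum_character_eq_0:
  fixes \<psi> :: "'b::ab_group_add \<Rightarrow> complex"
  assumes add: "\<And>u v. u \<in> V \<Longrightarrow> v \<in> V \<Longrightarrow> \<psi> (u + v) = \<psi> u * \<psi> v"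
  assumes V: "\<And>u v. u \<in> V \<Longrightarrow> v \<in> V \<Longrightarrow> u + v \<in> V"
  assumes v: "v \<in> V" "- v \<in> V" "\<psi> v \<noteq> 1"
  shows   "(\<Sum>u\<in>V. \<psi> u) = 0"
proof -
  have "(\<Sum>u\<in>V. \<psi> u) = (\<Sum>u\<in>V. \<psi> (v + u))"
    by (rule sum.reindex_bij_witness[of _ "\<lambda>u. v + u" "\<lambda>u. - v + u"])
       (use V v V[OF v(2)] in auto)
  also have "\<dots> = \<psi> v * (\<Sum>u\<in>V. \<psi> u)"
    using v by (simp add: sum_distrib_left add)
  finally show ?thesis using v(3) by simp
qed

section \<open>Polynomials inside the Laurent series\<close>

lemma poly_to_laurent_add: "poly_to_laurent (f + g) = poly_to_laurent f + poly_to_laurent g"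
  by (intro fls_eqI) (simp add: poly_to_laurent_nth)

lemma poly_to_laurent_diff: "poly_to_laurent (f - g) = poly_to_laurent f - poly_to_laurent g"
  by (intro fls_eqI) (simp add: poly_to_laurent_nth)

lemma poly_to_laurent_0 [simp]: "poly_to_laurent 0 = 0"
  by (intro fls_eqI) (simp add: poly_to_laurent_nth)

lemma poly_to_laurent_1 [simp]: "poly_to_laurent 1 = 1"
  by (intro fls_eqI) (simp add: poly_to_laurent_nth)

lemma poly_to_laurent_pCons:
  "poly_to_laurent (pCons a f) = fls_const a + fls_X_inv * poly_to_laurent f"
  by (simp add: poly_to_laurent_def map_poly_pCons)

lemma poly_to_laurent_smult: "poly_to_laurent (smult a f) = fls_const a * poly_to_laurent f"
  by (intro fls_eqI) (simp add: poly_to_laurent_nth)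

lemma poly_to_laurent_mult: "poly_to_laurent (f * g) = poly_to_laurent f * poly_to_laurent g"
  by (induction f) (simp_all add: poly_to_laurent_pCons poly_to_laurent_add poly_to_laurent_smult
      algebra_simps)

text \<open>As \<open>t\<close> is the inverse of the library's variable, multiplying by
  \<open>t^i\<close> reads the coefficient \<open>i\<close> places further on. The free bound
  \<open>m\<close> lets polynomials of different degrees share one index range.\<close>

lemma poly_to_laurent_times_nth:
  assumes "degree f \<le> m"
  shows   "fls_nth (poly_to_laurent f * \<alpha>) n = (\<Sum>i\<le>m. coeff f i * fls_nth \<alpha> (n + int i))"
proof -
  have "fls_nth (\<Sum>i\<in>A. g i) n = (\<Sum>i\<in>A. fls_nth (g i) n)"
    for A :: "nat set" and g :: "nat \<Rightarrow> 'a fls"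
    by (induction A rule: infinite_finite_induct) auto
  moreover have "poly_to_laurent f * \<alpha> = (\<Sum>i\<le>degree f. fls_const (coeff f i) * (fls_X_inv ^ i * \<alpha>))"
    unfolding poly_to_laurent_def poly_altdef
    by (simp add: coeff_map_poly degree_map_poly sum_distrib_right mult.assoc)
  ultimately have "fls_nth (poly_to_laurent f * \<alpha>) n =
      (\<Sum>i\<le>degree f. coeff f i * fls_nth \<alpha> (n + int i))"
    by (simp add: fls_X_inv_power_times_conv_shift)
  also have "\<dots> = (\<Sum>i\<le>m. coeff f i * fls_nth \<alpha> (n + int i))"
    using assms by (intro sum.mono_neutral_left) (auto simp: not_le coeff_eq_0)
  finally show ?thesis .
qed

text \<open>Described by coefficients rather than by the degree, so that 0 belongs to every
  \<open>Pol m\<close>. Each of them is an additive group with \<open>q^m\<close> elements, without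
  a special case for the degree of 0.\<close>

definition Pol :: "nat \<Rightarrow> 'a::finite_field poly set" where
  "Pol m = {f. \<forall>i\<ge>m. coeff f i = 0}"

lemma Pol_0 [simp]: "Pol 0 = {0}"
  by (auto simp: Pol_def intro: poly_eqI)

lemma zero_in_Pol [simp]: "0 \<in> Pol m"
  by (simp add: Pol_def)

lemma Pol_Suc_bij: "bij_betw (\<lambda>(c, f). pCons c f) (UNIV \<times> Pol m) (Pol (Suc m))"
proof (rule bij_betwI')
  show "f \<in> Pol (Suc m) \<Longrightarrow> \<exists>x\<in>UNIV \<times> Pol m. f = (case x of (c, f) \<Rightarrow> pCons c f)" for f :: "'a poly"
    by (cases f) (force simp: Pol_def coeff_pCons split: nat.splits)
qed (auto simp: Pol_def coeff_pCons split: nat.splits)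

lemma finite_Pol [simp, intro]: "finite (Pol m :: 'a::finite_field poly set)"
proof (induction m)
  case (Suc m)
  thus ?case using bij_betw_finite[OF Pol_Suc_bij[where 'a='a, of m]] by simp
qed simp

lemma card_Pol: "card (Pol m :: 'a::finite_field poly set) = CARD('a) ^ m"
proof (induction m)
  case (Suc m)
  thus ?case using bij_betw_same_card[OF Pol_Suc_bij[where 'a='a, of m]]
    by (simp add: card_cartesian_product)
qed simp

lemma Pol_mono: "m \<le> n \<Longrightarrow> Pol m \<subseteq> Pol n"
  by (auto simp: Pol_def)

lemma Pol_degree_le: "f \<in> Pol (Suc m) \<longleftrightarrow> degree f \<le> m"
  by (auto simp: Pol_def coeff_eq_0 intro: degree_le)

lemma Pol_degree_less: "f \<in> Pol m \<Longrightarrow> f \<noteq> 0 \<Longrightarrow> degree f < m"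
  by (metis (mono_tags, lifting) Pol_def leading_coeff_0_iff mem_Collect_eq not_le)

lemma degree_less_Pol: "degree f < m \<Longrightarrow> f \<in> Pol m"
  by (simp add: Pol_def coeff_eq_0)

lemma Pol_times:
  assumes "f \<in> Pol m" "degree g \<le> d"
  shows   "f * g \<in> Pol (m + d)"
proof (cases "f = 0")
  case False
  thus ?thesis using Pol_degree_less[OF assms(1)] assms(2) degree_mult_le[of f g]
    by (intro degree_less_Pol) linarith
qed simp

lemma Pol_add: "f \<in> Pol m \<Longrightarrow> g \<in> Pol m \<Longrightarrow> f + g \<in> Pol m"
  and Pol_diff: "f \<in> Pol m \<Longrightarrow> g \<in> Pol m \<Longrightarrow> f - g \<in> Pol m"
  by (auto simp: Pol_def)

section \<open>Monic polynomials of given degree\<close>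

definition monics_deg :: "nat \<Rightarrow> 'a::finite_field poly set" where
  "monics_deg m = {f \<in> monics. degree f = m}"

lemma monics_nonzero: "f \<in> monics \<Longrightarrow> f \<noteq> 0"
  by (auto simp: monics_def)

lemma one_in_monics [simp]: "1 \<in> monics"
  by (simp add: monics_def)

lemma monics_mult: "f \<in> monics \<Longrightarrow> g \<in> monics \<Longrightarrow> f * g \<in> monics"
  by (simp add: monics_def lead_coeff_mult)

lemma monics_power: "f \<in> monics \<Longrightarrow> f ^ n \<in> monics"
  by (induction n) (auto intro: monics_mult)

lemma monics_prod: "(\<And>x. x \<in> A \<Longrightarrow> f x \<in> monics) \<Longrightarrow> prod f A \<in> monics"
  by (induction A rule: infinite_finite_induct) (auto intro: monics_mult)

lemma degree_monics_mult: "f \<in> monics \<Longrightarrow> g \<in> monics \<Longrightarrow> degree (f * g) = degree f + degree g"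
  by (auto dest!: monics_nonzero intro: degree_mult_eq)

lemma monics_cancel: "f * g \<in> monics \<Longrightarrow> f \<in> monics \<Longrightarrow> g \<in> monics"
  by (auto simp: monics_def lead_coeff_mult)

text \<open>The monic polynomials of degree \<open>m\<close> form a coset of the group
  \<open>Pol m\<close>, so character sums over them reduce to orthogonality on that group.\<close>

lemma monics_deg_bij: "bij_betw (\<lambda>h. monom 1 m + h) (Pol m) (monics_deg m)"
proof (rule bij_betwI')
  fix h :: "'a poly" assume h: "h \<in> Pol m"
  hence "coeff (monom 1 m + h) m = 1" "degree (monom 1 m + h) \<le> m"
    by (auto simp: Pol_def intro!: degree_le)
  hence "degree (monom 1 m + h) = m" by (metis le_antisym le_degree one_neq_zero)
  thus "monom 1 m + h \<in> monics_deg m"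
    using \<open>coeff (monom 1 m + h) m = 1\<close> by (simp add: monics_deg_def monics_def)
next
  fix f :: "'a poly" assume f: "f \<in> monics_deg m"
  hence "f - monom 1 m \<in> Pol m"
    by (auto simp: monics_deg_def monics_def Pol_def coeff_eq_0)
  thus "\<exists>h\<in>Pol m. f = monom 1 m + h" by (intro bexI[of _ "f - monom 1 m"]) auto
qed auto

lemma finite_monics_deg [simp, intro]: "finite (monics_deg m :: 'a::finite_field poly set)"
  using bij_betw_finite[OF monics_deg_bij[where 'a='a, of m]] by simp

lemma card_monics_deg: "card (monics_deg m :: 'a::finite_field poly set) = CARD('a) ^ m"
  using bij_betw_same_card[OF monics_deg_bij[where 'a='a, of m]] by (simp add: card_Pol)

section \<open>Vanishing of the leading coefficients of the fractional part\<close>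

text \<open>Index \<open>i\<close> belongs to \<open>t^(-i)\<close>, so this says that \<gamma> is
  at distance less than \<open>q^(-m)\<close> from a polynomial. The polynomial part, at the indices
  up to 0, is unrestricted.\<close>

definition frac_zero :: "nat \<Rightarrow> 'a::finite_field fls \<Rightarrow> bool" where
  "frac_zero m \<gamma> \<longleftrightarrow> (\<forall>i. 1 \<le> i \<and> i \<le> int m \<longrightarrow> fls_nth \<gamma> i = 0)"

lemma frac_zero_0 [simp]: "frac_zero 0 \<gamma>"
  by (simp add: frac_zero_def)

lemma frac_zero_Suc: "frac_zero (Suc m) \<gamma> \<longleftrightarrow> frac_zero m \<gamma> \<and> fls_nth \<gamma> (int m + 1) = 0"
proof
  assume *: "frac_zero m \<gamma> \<and> fls_nth \<gamma> (int m + 1) = 0"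
  show "frac_zero (Suc m) \<gamma>" unfolding frac_zero_def
  proof (intro allI impI)
    fix i assume "1 \<le> i \<and> i \<le> int (Suc m)"
    thus "fls_nth \<gamma> i = 0" using * by (cases "i = int m + 1") (auto simp: frac_zero_def)
  qed
qed (auto simp: frac_zero_def)

lemma frac_zero_mono: "frac_zero n \<gamma> \<Longrightarrow> m \<le> n \<Longrightarrow> frac_zero m \<gamma>"
  by (auto simp: frac_zero_def)

text \<open>The character of a product is a bilinear pairing of the coefficients of \<open>f\<close>
  with the first \<open>m\<close> coefficients of the fractional part.\<close>

lemma laurent_char_times_nth:
  assumes "f \<in> Pol m"
  shows   "laurent_char (poly_to_laurent f * \<gamma>) = ff_char (\<Sum>i<m. coeff f i * fls_nth \<gamma> (int i + 1))"
proof (cases m)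
  case 0
  thus ?thesis using assms by (simp add: laurent_char_def)
next
  case (Suc k)
  hence "degree f \<le> k" using assms Pol_degree_le by auto
  thus ?thesis
    by (simp add: laurent_char_def poly_to_laurent_times_nth Suc lessThan_Suc_atMost add.commute)
qed

lemma laurent_char_add: "laurent_char (\<alpha> + \<beta>) = laurent_char \<alpha> * laurent_char \<beta>"
  by (simp add: laurent_char_def ff_char_add)

lemma norm_laurent_char [simp]: "cmod (laurent_char \<alpha>) = 1"
  by (simp add: laurent_char_def)

lemma sum_Pol_laurent_char:
  "(\<Sum>h\<in>Pol m. laurent_char (poly_to_laurent h * (\<gamma> :: 'a::finite_field fls))) =
     (if frac_zero m \<gamma> then of_nat CARD('a) ^ m else 0)"
proof (cases "frac_zero m \<gamma>")
  case True
  have "(\<Sum>i<m. coeff h i * fls_nth \<gamma> (int i + 1)) = 0" for h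
    using True by (intro sum.neutral) (auto simp: frac_zero_def)
  hence "laurent_char (poly_to_laurent h * \<gamma>) = 1" if "h \<in> Pol m" for h
    using that by (simp add: laurent_char_times_nth)
  thus ?thesis using True by (simp add: card_Pol)
next
  case False
  then obtain i where i: "1 \<le> i" "i \<le> int m" "fls_nth \<gamma> i \<noteq> 0" by (auto simp: frac_zero_def)
  define j where "j = nat (i - 1)"
  have j: "j < m" "int j + 1 = i" using i by (auto simp: j_def)
  obtain c :: 'a where c: "ff_char c \<noteq> 1" using ff_char_nontrivial by blast
  \<comment> \<open>Scaled so that the pairing of \<open>v\<close> with \<gamma> is exactly
    \<open>c\<close>.\<close>
  define v where "v = monom (c / fls_nth \<gamma> i) j"
  have v: "v \<in> Pol m" "- v \<in> Pol m" using j by (auto simp: v_def Pol_def)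
  have "(\<Sum>s<m. coeff v s * fls_nth \<gamma> (int s + 1)) = (\<Sum>s<m. if s = j then c else 0)"
    using i j by (intro sum.cong) (auto simp: v_def)
  hence "laurent_char (poly_to_laurent v * \<gamma>) = ff_char c"
    using v j by (simp add: laurent_char_times_nth sum.delta)
  hence "(\<Sum>h\<in>Pol m. laurent_char (poly_to_laurent h * \<gamma>)) = 0"
    using c v by (intro sum_character_eq_0[of _ _ v])
      (auto simp: poly_to_laurent_add ring_distribs laurent_char_add Pol_add)
  thus ?thesis using False by simp
qed

text \<open>The leading term \<open>t^m\<close> pairs with the first coefficient beyond those tested
  by \<open>frac_zero m\<close>; the rest is a sum over a group.\<close>

lemma sum_monics_deg_laurent_char:
  "(\<Sum>g\<in>monics_deg m. laurent_char (poly_to_laurent g * (\<gamma> :: 'a::finite_field fls))) =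
     (if frac_zero m \<gamma> then of_nat CARD('a) ^ m * ff_char (fls_nth \<gamma> (int m + 1)) else 0)"
proof -
  have "(\<Sum>g\<in>monics_deg m. laurent_char (poly_to_laurent g * \<gamma>)) =
      (\<Sum>h\<in>Pol m. laurent_char (poly_to_laurent (monom 1 m + h) * \<gamma>))"
    by (rule sum.reindex_bij_betw[OF monics_deg_bij, symmetric])
  also have "\<dots> = laurent_char (poly_to_laurent (monom 1 m) * \<gamma>) *
      (\<Sum>h\<in>Pol m. laurent_char (poly_to_laurent h * \<gamma>))"
    by (simp add: poly_to_laurent_add ring_distribs laurent_char_add sum_distrib_left)
  also have "laurent_char (poly_to_laurent (monom 1 m) * \<gamma>) = ff_char (fls_nth \<gamma> (int m + 1))"
  proof -
    have "(\<Sum>i\<le>m. coeff (monom 1 m) i * fls_nth \<gamma> (1 + int i)) = fls_nth \<gamma> (1 + int m)"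
      by (simp add: if_distrib[of "\<lambda>x. x * _"] sum.delta cong: if_cong)
    thus ?thesis
      by (simp add: laurent_char_def poly_to_laurent_times_nth[OF degree_monom_le] add.commute)
  qed
  finally show ?thesis by (simp add: sum_Pol_laurent_char)
qed

text \<open>When the first \<open>j + p\<close> coefficients vanish, only the leading term of
  \<open>f\<close> meets one that may be nonzero. Multiplication by \<open>f\<close> then shifts the
  fractional part without distortion.\<close>

lemma fls_nth_monic_times:
  assumes "f \<in> monics" "degree f = p" "frac_zero (j + p) \<gamma>"
  shows   "fls_nth (poly_to_laurent f * \<gamma>) (int j + 1) = fls_nth \<gamma> (int (j + p) + 1)"
proof -
  have "coeff f i * fls_nth \<gamma> (int j + 1 + int i) =
      (if i = p then fls_nth \<gamma> (int (j + p) + 1) else 0)" if "i \<le> p" for i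
    using assms that by (auto simp: monics_def frac_zero_def algebra_simps)
  thus ?thesis using assms(2) by (simp add: poly_to_laurent_times_nth[of f p] sum.delta)
qed

text \<open>The assumption \<open>frac_zero p \<gamma>\<close> excludes series near a fraction with
  denominator \<open>f\<close> that is not a polynomial; for those the product vanishes to high
  order while \<gamma> does not.\<close>

lemma frac_zero_monic_times:
  assumes "f \<in> monics" "degree f = p" "frac_zero p \<gamma>"
  shows   "frac_zero j (poly_to_laurent f * \<gamma>) \<longleftrightarrow> frac_zero (j + p) \<gamma>"
proof (induction j)
  case (Suc j)
  thus ?case using fls_nth_monic_times[OF assms(1,2), of j \<gamma>]
    by (auto simp: frac_zero_Suc)
qed (use assms in auto)

text \<open>Splitting off polynomial parts, the two hypotheses compare \<open>u\<close> and \<open>v\<close> times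
  the same series; coprimality forces the polynomial part of \<open>u * \<gamma>\<close> to be divisible by \<open>u\<close>.\<close>

lemma frac_zero_descent:
  fixes u v :: "'a::finite_field poly"
  assumes u: "u \<noteq> 0" and cop: "\<And>w. u dvd v * w \<Longrightarrow> u dvd w"
  assumes a: "frac_zero a (poly_to_laurent u * \<gamma>)" "degree v \<le> a"
  assumes b: "frac_zero b (poly_to_laurent v * \<gamma>)" "degree u \<le> b"
  shows   "frac_zero (a + degree u) \<gamma>"
proof -
  have split: "\<exists>P. \<forall>i\<le>int m. fls_nth (\<beta> - poly_to_laurent P) i = 0"
    if m: "frac_zero m \<beta>" for m and \<beta> :: "'a fls"
  proof -
    obtain l :: nat where l: "\<And>i. i < - int l \<Longrightarrow> fls_nth \<beta> i = 0" using ex_fls_low_zero by blast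
    define P where "P = Abs_poly (\<lambda>i. fls_nth \<beta> (- int i))"
    have "coeff P i = fls_nth \<beta> (- int i)" for i
      unfolding P_def by (subst coeff_Abs_poly[of l]) (auto intro: l)
    hence "\<forall>i\<le>int m. fls_nth (\<beta> - poly_to_laurent P) i = 0"
      using m by (auto simp: poly_to_laurent_nth frac_zero_def)
    thus ?thesis by blast
  qed
  have low: "fls_nth (poly_to_laurent w * \<beta>) i = 0"
    if "\<forall>i\<le>int m. fls_nth \<beta> i = 0" "degree w \<le> m" "i \<le> 0" for w :: "'a poly" and m \<beta> i
  proof -
    have "fls_nth \<beta> (i + int s) = 0" if "s \<le> m" for s
      using that \<open>\<forall>i\<le>int m. fls_nth \<beta> i = 0\<close> \<open>i \<le> 0\<close> by auto
    thus ?thesis by (simp add: poly_to_laurent_times_nth[OF \<open>degree w \<le> m\<close>])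
  qed
  obtain P where P: "\<forall>i\<le>int a. fls_nth (poly_to_laurent u * \<gamma> - poly_to_laurent P) i = 0"
    using split[OF a(1)] by blast
  obtain R where R: "\<forall>i\<le>int b. fls_nth (poly_to_laurent v * \<gamma> - poly_to_laurent R) i = 0"
    using split[OF b(1)] by blast
  have eq: "poly_to_laurent (u * R - v * P) =
      poly_to_laurent v * (poly_to_laurent u * \<gamma> - poly_to_laurent P) -
      poly_to_laurent u * (poly_to_laurent v * \<gamma> - poly_to_laurent R)"
    by (simp add: poly_to_laurent_diff poly_to_laurent_mult algebra_simps)
  have "coeff (u * R - v * P) i = 0" for i
  proof -
    have "fls_nth (poly_to_laurent (u * R - v * P)) (- int i) = 0"
      unfolding eq using low[OF P a(2), of "- int i"] low[OF R b(2), of "- int i"] by simp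
    thus ?thesis unfolding poly_to_laurent_nth by simp
  qed
  hence "u * R = v * P" by (metis eq_iff_diff_eq_0 leading_coeff_0_iff)
  then obtain P' where P': "P = u * P'" using cop[of P] by (metis dvdE dvd_triv_left)
  define \<gamma>' where "\<gamma>' = \<gamma> - poly_to_laurent P'"
  have u\<gamma>': "\<forall>i\<le>int a. fls_nth (poly_to_laurent u * \<gamma>') i = 0"
    using P by (simp add: \<gamma>'_def P' poly_to_laurent_mult algebra_simps)
  have "fls_nth \<gamma>' i = 0" if "i \<le> int (a + degree u)" for i
  proof (cases "\<gamma>' = 0")
    case False
    \<comment> \<open>The lowest coefficient of the product is the product of the leading
      coefficient of \<open>u\<close> and the lowest coefficient of \<open>\<gamma>'\<close>, and it
      sits \<open>degree u\<close> places earlier. So vanishing up to \<open>a\<close> becomes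
      vanishing up to \<open>a + degree u\<close>.\<close>
    define e where "e = fls_subdegree \<gamma>'"
    have "coeff u s * fls_nth \<gamma>' (e - int (degree u) + int s) =
        (if s = degree u then lead_coeff u * fls_nth \<gamma>' e else 0)" if "s \<le> degree u" for s
      using that by (auto simp: e_def intro!: fls_eq0_below_subdegree)
    hence "fls_nth (poly_to_laurent u * \<gamma>') (e - int (degree u)) = lead_coeff u * fls_nth \<gamma>' e"
      by (simp add: poly_to_laurent_times_nth[OF order.refl] sum.delta)
    also have "\<dots> \<noteq> 0" using u False by (simp add: e_def)
    finally have "e - int (degree u) > int a" using u\<gamma>' by (meson linorder_not_less)
    thus ?thesis using that by (intro fls_eq0_below_subdegree) (auto simp: e_def)
  qed simp
  thus ?thesis
    by (auto simp: frac_zero_def \<gamma>'_def poly_to_laurent_nth)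
qed

section \<open>Squarefree polynomials as finite sets of monic irreducibles\<close>

definition Irr :: "'a::finite_field poly set" where
  "Irr = {\<pi>. \<pi> \<in> monics \<and> irreducible \<pi>}"

text \<open>Under \<open>F \<mapsto> \<Prod>F\<close> divisibility becomes inclusion, the gcd
  becomes intersection, and the Moebius function becomes \<open>(-1) ^ card F\<close>.\<close>

definition Fs :: "'a::finite_field poly set set" where
  "Fs = {F. finite F \<and> F \<subseteq> Irr}"

definition nd :: "'a::finite_field poly set \<Rightarrow> nat" where
  "nd F = (\<Sum>\<pi>\<in>F. degree \<pi>)"

lemma Irr_prime: "\<pi> \<in> Irr \<Longrightarrow> prime_elem \<pi>"
  by (simp add: Irr_def field_poly_irreducible_imp_prime)

lemma Irr_degree: "\<pi> \<in> Irr \<Longrightarrow> degree \<pi> \<ge> 1"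
  unfolding Irr_def irreducible_def by (auto simp: is_unit_iff_degree Suc_le_eq)

lemma Irr_dvd_iff: "\<pi> \<in> Irr \<Longrightarrow> \<pi>' \<in> Irr \<Longrightarrow> \<pi> dvd \<pi>' \<longleftrightarrow> \<pi> = \<pi>'"
proof
  assume *: "\<pi> \<in> Irr" "\<pi>' \<in> Irr" "\<pi> dvd \<pi>'"
  then obtain w where w: "\<pi>' = \<pi> * w" by blast
  have "\<not> is_unit \<pi>" using * by (auto simp: Irr_def irreducible_def)
  hence "is_unit w" using *(2) w by (auto simp: Irr_def irreducible_def)
  moreover have "w \<in> monics" using * w monics_cancel[of \<pi> w] by (auto simp: Irr_def)
  ultimately have "w = 1"
    using monics_nonzero[of w] by (auto simp: is_unit_iff_degree monics_def elim!: degree_eq_zeroE)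
  thus "\<pi> = \<pi>'" using w by simp
qed auto

lemma Irr_dvd_exists:
  assumes "degree f \<ge> 1"
  shows   "\<exists>\<pi>\<in>Irr. \<pi> dvd (f :: 'a::finite_field poly)"
  using assms
proof (induction "degree f" arbitrary: f rule: less_induct)
  case less
  have f0: "f \<noteq> 0" using less.prems by auto
  show ?case
  proof (cases "irreducible f")
    case True
    define \<pi> where "\<pi> = smult (inverse (lead_coeff f)) f"
    have "irreducible ([:inverse (lead_coeff f):] * f)"
      using True f0 by (subst irreducible_mult_unit_left) (auto simp: is_unit_iff_degree)
    hence "\<pi> \<in> Irr" using f0 by (simp add: Irr_def \<pi>_def monics_def)
    moreover have "\<pi> dvd f" using f0 by (simp add: \<pi>_def smult_dvd_iff)
    ultimately show ?thesis by blast
  next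
    case False
    then obtain a b where ab: "f = a * b" "\<not> is_unit a" "\<not> is_unit b"
      using f0 less.prems by (auto simp: irreducible_def is_unit_iff_degree)
    hence "a \<noteq> 0" "b \<noteq> 0" using f0 by auto
    hence "degree a \<noteq> 0" "degree b \<noteq> 0"
      using ab(2,3) is_unit_iff_degree[of a] is_unit_iff_degree[of b] by blast+
    moreover have "degree f = degree a + degree b"
      unfolding ab(1) by (rule degree_mult_eq) fact+
    ultimately have "\<exists>\<pi>\<in>Irr. \<pi> dvd a" by (intro less.hyps) auto
    thus ?thesis using ab(1) dvd_mult2 by blast
  qed
qed

lemma finite_Irr_dvd: "f \<noteq> 0 \<Longrightarrow> finite {\<pi> \<in> Irr. \<pi> dvd (f :: 'a::finite_field poly)}"
  by (rule finite_subset[OF _ finite_Pol[of "Suc (degree f)"]])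
     (auto simp: Pol_degree_le dvd_imp_degree_le)

lemma Fs_empty [simp]: "{} \<in> Fs" and Fs_finite: "F \<in> Fs \<Longrightarrow> finite F"
  and Fs_Irr: "F \<in> Fs \<Longrightarrow> \<pi> \<in> F \<Longrightarrow> \<pi> \<in> Irr"
  and Fs_subset: "F \<in> Fs \<Longrightarrow> G \<subseteq> F \<Longrightarrow> G \<in> Fs"
  and Fs_Diff: "F \<in> Fs \<Longrightarrow> F - G \<in> Fs"
  and Fs_Int: "F \<in> Fs \<Longrightarrow> F \<inter> G \<in> Fs"
  and Fs_insert: "F \<in> Fs \<Longrightarrow> \<pi> \<in> Irr \<Longrightarrow> insert \<pi> F \<in> Fs"
  by (auto simp: Fs_def intro: finite_subset)

lemma nd_empty [simp]: "nd {} = 0"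
  by (simp add: nd_def)

lemma nd_Un: "finite F \<Longrightarrow> finite G \<Longrightarrow> F \<inter> G = {} \<Longrightarrow> nd (F \<union> G) = nd F + nd G"
  by (simp add: nd_def sum.union_disjoint)

lemma nd_Diff: "finite G \<Longrightarrow> F \<subseteq> G \<Longrightarrow> nd G = nd F + nd (G - F)"
  by (metis Diff_disjoint Diff_partition finite_Diff finite_subset nd_Un)

lemma nd_mono: "finite G \<Longrightarrow> F \<subseteq> G \<Longrightarrow> nd F \<le> nd G"
  using nd_Diff by fastforce

lemma prod_Fs_monics: "F \<in> Fs \<Longrightarrow> \<Prod>F \<in> monics"
  by (rule monics_prod) (auto simp: Fs_def Irr_def)

lemma prod_Fs_power_monics: "F \<in> Fs \<Longrightarrow> \<Prod>F ^ r \<in> monics"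
  by (intro monics_power prod_Fs_monics)

lemma degree_prod_Fs: "F \<in> Fs \<Longrightarrow> degree (\<Prod>F) = nd F"
  unfolding nd_def by (rule degree_prod_eq_sum_degree)
    (auto simp: Fs_def Irr_def dest!: subsetD monics_nonzero)

lemma degree_prod_Fs_power: "F \<in> Fs \<Longrightarrow> degree (\<Prod>F ^ r) = r * nd F"
  by (simp add: degree_power_eq monics_nonzero[OF prod_Fs_monics] degree_prod_Fs)

lemma Irr_dvd_prod_Fs: "F \<in> Fs \<Longrightarrow> \<pi> \<in> Irr \<Longrightarrow> \<pi> dvd \<Prod>F \<longleftrightarrow> \<pi> \<in> F"
proof
  assume *: "F \<in> Fs" "\<pi> \<in> Irr" "\<pi> dvd \<Prod>F"
  have "finite F" using * Fs_finite by blast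
  hence "\<exists>\<pi>'\<in>F. \<pi> dvd \<pi>'"
    using *(3) by (induction F) (use Irr_prime[OF *(2)] in
        \<open>auto simp: prime_elem_dvd_mult_iff prime_elem_not_unit\<close>)
  thus "\<pi> \<in> F" using * Irr_dvd_iff Fs_Irr by blast
qed (use Fs_finite in \<open>auto intro: dvd_prodI\<close>)

lemma inj_on_prod_Fs: "inj_on (\<lambda>F. \<Prod>F) Fs"
proof (rule inj_onI)
  fix F G :: "'a poly set" assume *: "F \<in> Fs" "G \<in> Fs" "\<Prod>F = \<Prod>G"
  have "\<pi> \<in> F \<longleftrightarrow> \<pi> \<in> G" for \<pi>
    using Irr_dvd_prod_Fs[OF *(1)] Irr_dvd_prod_Fs[OF *(2)] Fs_Irr * by metis
  thus "F = G" by blast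
qed

lemma finite_Fs_nd_eq [simp, intro]: "finite {F \<in> Fs. nd F = n \<and> P F}"
  and card_Fs_nd_eq: "card {F \<in> Fs. nd (F :: 'a::finite_field poly set) = n \<and> P F} \<le> CARD('a) ^ n"
proof -
  let ?A = "{F \<in> Fs. nd (F :: 'a poly set) = n \<and> P F}"
  have inj: "inj_on (\<lambda>F. \<Prod>F) ?A" by (rule inj_on_subset[OF inj_on_prod_Fs]) auto
  have sub: "(\<lambda>F. \<Prod>F) ` ?A \<subseteq> monics_deg n"
    by (auto simp: monics_deg_def prod_Fs_monics degree_prod_Fs)
  show "finite ?A" by (rule inj_on_finite[OF inj sub finite_monics_deg])
  show "card ?A \<le> CARD('a) ^ n"
    using card_inj_on_le[OF inj sub finite_monics_deg] by (simp add: card_monics_deg)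
qed

lemma finite_Fs_nd_le: "finite {F \<in> Fs. nd F \<le> n \<and> P F}"
proof -
  have "{F \<in> Fs. nd F \<le> n \<and> P F} = (\<Union>m\<le>n. {F \<in> Fs. nd F = m \<and> P F})" by auto
  thus ?thesis by auto
qed

lemma finite_Fs_mult_nd_le [simp, intro]:
  assumes "r > (0::nat)"
  shows   "finite {F \<in> Fs. r * nd F \<le> n \<and> P F}" "finite {F \<in> Fs. r * nd F \<le> n}"
proof -
  have le: "m \<le> n" if "r * m \<le> n" for m :: nat
    using that assms by (cases r) auto
  show "finite {F \<in> Fs. r * nd F \<le> n \<and> P F}"
    by (rule finite_subset[OF _ finite_Fs_nd_le[of n P]]) (use le in auto)
  show "finite {F \<in> Fs. r * nd F \<le> n}"
    by (rule finite_subset[OF _ finite_Fs_nd_le[of n "\<lambda>_. True"]]) (use le in auto)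
qed

text \<open>Grouping by degree, with at most \<open>q^n\<close> sets in each group, turns a sum over
  squarefree polynomials into a sum in one variable.\<close>

lemma sum_Fs_le:
  fixes \<phi> :: "nat \<Rightarrow> real"
  assumes "finite A" "A \<subseteq> Fs" "\<And>F. F \<in> A \<Longrightarrow> nd F \<in> B" "finite B" "\<And>n. n \<in> B \<Longrightarrow> \<phi> n \<ge> 0"
  shows   "(\<Sum>F\<in>A. \<phi> (nd (F :: 'a::finite_field poly set))) \<le> (\<Sum>n\<in>B. real CARD('a) ^ n * \<phi> n)"
proof -
  have "(\<Sum>F\<in>A. \<phi> (nd F)) = (\<Sum>n\<in>B. \<Sum>F | F \<in> A \<and> nd F = n. \<phi> (nd F))"
    using assms by (intro sum.group[symmetric]) auto
  also have "\<dots> = (\<Sum>n\<in>B. real (card {F \<in> A. nd F = n}) * \<phi> n)"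
    by (intro sum.cong refl) simp
  also have "\<dots> \<le> (\<Sum>n\<in>B. real CARD('a) ^ n * \<phi> n)"
  proof (intro sum_mono mult_right_mono)
    fix n assume "n \<in> B"
    have "card {F \<in> A. nd F = n} \<le> card {F \<in> Fs. nd (F :: 'a poly set) = n \<and> F \<in> A}"
      using assms(2) by (intro card_mono finite_Fs_nd_eq) auto
    also have "\<dots> \<le> CARD('a) ^ n" by (rule card_Fs_nd_eq)
    finally show "real (card {F \<in> A. nd F = n}) \<le> real CARD('a) ^ n"
      by (metis of_nat_le_iff of_nat_power)
  qed (use assms in auto)
  finally show ?thesis .
qed

section \<open>Moebius inversion\<close>

lemma Irr_power_dvd_cancel:
  assumes "\<pi> \<in> Irr" "\<pi> ^ r dvd v * w" "\<not> \<pi> dvd v"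
  shows   "\<pi> ^ r dvd w"
proof (cases "r = 0")
  case False
  thus ?thesis using prime_power_dvd_multD[OF Irr_prime[OF assms(1)] assms(2)] assms(3) by blast
qed auto

lemma prod_Fs_power_dvd_iff:
  assumes "F \<in> Fs"
  shows   "\<Prod>F ^ r dvd f \<longleftrightarrow> (\<forall>\<pi>\<in>F. \<pi> ^ r dvd f)"
proof
  assume "\<Prod>F ^ r dvd f"
  moreover have "\<pi> ^ r dvd \<Prod>F ^ r" if "\<pi> \<in> F" for \<pi>
    using that assms Fs_finite by (auto intro!: dvd_power_same dvd_prodI)
  ultimately show "\<forall>\<pi>\<in>F. \<pi> ^ r dvd f" using dvd_trans by blast
next
  have "finite F" using assms Fs_finite by blast
  thus "\<forall>\<pi>\<in>F. \<pi> ^ r dvd f \<Longrightarrow> \<Prod>F ^ r dvd f"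
    using assms
  proof (induction F)
    case (insert \<pi> F)
    have F: "F \<in> Fs" "\<pi> \<in> Irr" using insert.prems Fs_subset Fs_Irr by blast+
    then obtain w where w: "f = \<Prod>F ^ r * w" using insert by (auto elim!: dvdE)
    have "\<not> \<pi> dvd \<Prod>F" using F insert.hyps by (simp add: Irr_dvd_prod_Fs)
    hence "\<not> \<pi> dvd \<Prod>F ^ r" using Irr_prime[OF F(2)] prime_elem_dvd_power by blast
    moreover have "\<pi> ^ r dvd \<Prod>F ^ r * w" using insert.prems w by auto
    ultimately have "\<pi> ^ r dvd w" using Irr_power_dvd_cancel[OF F(2)] by blast
    thus ?case using insert.hyps w
      by (simp add: power_mult_distrib mult.commute mult_dvd_mono)
  qed auto
qed

text \<open>Coprimality in the form that \<open>frac_zero_descent\<close> asks for, checked one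
  prime at a time.\<close>

lemma prod_Fs_power_coprime:
  assumes "F \<in> Fs" "G \<in> Fs" "F \<inter> G = {}" "\<Prod>F ^ r dvd \<Prod>G ^ r * w"
  shows   "\<Prod>F ^ r dvd w"
  unfolding prod_Fs_power_dvd_iff[OF assms(1)]
proof
  fix \<pi> assume \<pi>: "\<pi> \<in> F"
  hence I: "\<pi> \<in> Irr" using assms Fs_Irr by blast
  have "\<not> \<pi> dvd \<Prod>G" using \<pi> I assms by (auto simp: Irr_dvd_prod_Fs)
  hence "\<not> \<pi> dvd \<Prod>G ^ r" using Irr_prime[OF I] prime_elem_dvd_power by blast
  moreover have "\<pi> ^ r dvd \<Prod>G ^ r * w"
    using \<pi> assms(4) unfolding prod_Fs_power_dvd_iff[OF assms(1)] by blast
  ultimately show "\<pi> ^ r dvd w" using Irr_power_dvd_cancel[OF I] by blast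
qed

text \<open>Expansion of the product of \<open>-1 + 1\<close> over \<open>A\<close>.\<close>

lemma sum_Pow_alternating:
  assumes "finite A"
  shows   "(\<Sum>F\<in>Pow A. (-1) ^ card F) = (of_bool (A = {}) :: 'b::comm_ring_1)"
proof -
  have "(\<Sum>F\<in>Pow A. (-1) ^ card F) = (\<Prod>x\<in>A. -1 + (1 :: 'b))"
    unfolding prod_add[OF assms] by (simp add: prod_constant)
  thus ?thesis using assms by (simp add: power_0_left)
qed

lemma Irr_power_dvd_set:
  assumes "f \<noteq> 0" "r \<ge> 1"
  shows   "finite {\<pi> \<in> Irr. \<pi> ^ r dvd f}"
proof -
  have "\<pi> dvd f" if "\<pi> ^ r dvd f" for \<pi> :: "'a poly"
    using that assms(2) by (metis dvd_power dvd_trans not_one_le_zero gr0I)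
  thus ?thesis by (intro finite_subset[OF _ finite_Irr_dvd[OF assms(1)]]) auto
qed

text \<open>The sets \<open>F\<close> that occur are all the subsets of the finite set of primes
  whose \<open>r\<close>-th power divides \<open>f\<close>. The case \<open>r = 1\<close> is
  ordinary Moebius inversion and serves for the zeta function.\<close>

lemma sum_moebius:
  assumes "f \<noteq> (0 :: 'a::finite_field poly)" "r \<ge> 1"
  shows   "(\<Sum>F | F \<in> Fs \<and> \<Prod>F ^ r dvd f. (-1) ^ card F) =
             (of_bool (\<forall>\<pi>\<in>Irr. \<not> \<pi> ^ r dvd f) :: 'b::comm_ring_1)"
proof -
  have "{F. F \<in> Fs \<and> \<Prod>F ^ r dvd f} = Pow {\<pi> \<in> Irr. \<pi> ^ r dvd f}"
    using Irr_power_dvd_set[OF assms] prod_Fs_power_dvd_iff[of _ r f]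
    by (auto simp: Fs_def intro: finite_subset)
  thus ?thesis using sum_Pow_alternating[OF Irr_power_dvd_set[OF assms]] by (simp add: Ball_def)
qed

lemma a_ind_eq_sum:
  assumes "f \<noteq> (0 :: 'a::finite_field poly)" "r \<ge> 1"
  shows   "a_ind r f = (\<Sum>F | F \<in> Fs \<and> \<Prod>F ^ r dvd f. (-1) ^ card F)"
proof -
  have "(\<forall>\<pi>. irreducible \<pi> \<longrightarrow> \<not> \<pi> ^ r dvd f) \<longleftrightarrow> (\<forall>\<pi>\<in>Irr. \<not> \<pi> ^ r dvd f)"
  proof safe
    fix \<pi> :: "'a poly" assume *: "\<forall>\<pi>\<in>Irr. \<not> \<pi> ^ r dvd f" "irreducible \<pi>" "\<pi> ^ r dvd f"
    have "degree \<pi> \<ge> 1" using *(2) by (auto simp: irreducible_def is_unit_iff_degree Suc_le_eq)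
    then obtain \<pi>' where "\<pi>' \<in> Irr" "\<pi>' dvd \<pi>" using Irr_dvd_exists by blast
    thus False using * dvd_power_same[of \<pi>' \<pi> r] dvd_trans by blast
  qed (auto simp: Irr_def)
  thus ?thesis using assms by (simp add: a_ind_def r_free_def sum_moebius)
qed

section \<open>Complete sums and the sieve form of the exponential sum\<close>

definition gm :: "nat \<Rightarrow> 'a::finite_field poly set \<Rightarrow> 'a fls \<Rightarrow> 'a fls" where
  "gm r F \<alpha> = poly_to_laurent (\<Prod>F ^ r) * \<alpha>"

definition monics_le :: "nat \<Rightarrow> 'a::finite_field poly set" where
  "monics_le m = {f \<in> monics. degree f \<le> m}"

definition T_sum :: "nat \<Rightarrow> 'a::finite_field fls \<Rightarrow> complex" where
  "T_sum M \<gamma> = (\<Sum>g\<in>monics_le M. laurent_char (poly_to_laurent g * \<gamma>))"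

lemma monics_le_UN: "monics_le M = (\<Union>m\<le>M. monics_deg m)"
  by (auto simp: monics_le_def monics_deg_def)

lemma finite_monics_le [simp, intro]: "finite (monics_le M)"
  by (simp add: monics_le_UN)

lemma sum_monics_le: "(\<Sum>g\<in>monics_le M. \<phi> g) = (\<Sum>m\<le>M. \<Sum>g\<in>monics_deg m. \<phi> g)"
  unfolding monics_le_UN by (rule sum.UNION_disjoint) (simp_all, auto simp: monics_deg_def)

lemma T_sum_eq:
  "T_sum M (\<gamma> :: 'a::finite_field fls) =
     (\<Sum>m\<le>M. if frac_zero m \<gamma> then of_nat CARD('a) ^ m * ff_char (fls_nth \<gamma> (int m + 1)) else 0)"
  unfolding T_sum_def sum_monics_le by (simp add: sum_monics_deg_laurent_char)

lemma norm_T_sum_le: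
  "cmod (T_sum M (\<gamma> :: 'a::finite_field fls)) \<le> (\<Sum>m\<le>M. real CARD('a) ^ m * of_bool (frac_zero m \<gamma>))"
  unfolding T_sum_eq
  by (intro order.trans[OF norm_sum] sum_mono) (auto simp: norm_mult norm_power)

lemma exp_sum_eq_monics_le:
  "exp_sum r N (\<alpha> :: 'a::finite_field fls) =
     (\<Sum>f\<in>monics_le N. a_ind r f * laurent_char (poly_to_laurent f * \<alpha>))"
proof -
  have "real CARD('a) ^ degree f \<le> real CARD('a) ^ N \<longleftrightarrow> degree f \<le> N" for f :: "'a poly"
    using CARD_finite_field_ge_2[where 'a='a] by (intro power_increasing_iff) auto
  hence "{f :: 'a poly. f \<in> monics \<and> poly_abs f \<le> real CARD('a) ^ N} = monics_le N"
    using monics_nonzero by (force simp: monics_le_def poly_abs_eq)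
  thus ?thesis by (simp add: exp_sum_def)
qed

lemma bij_betw_monics_multiples:
  assumes "d \<in> monics" "degree d \<le> N"
  shows   "bij_betw (\<lambda>g. g * d) (monics_le (N - degree d)) {f \<in> monics_le N. d dvd f}"
proof (rule bij_betwI')
  show "g * d \<in> {f \<in> monics_le N. d dvd f}" if "g \<in> monics_le (N - degree d)" for g
    using that assms by (auto simp: monics_le_def monics_mult degree_monics_mult)
next
  fix f assume f: "f \<in> {f \<in> monics_le N. d dvd f}"
  then obtain g where g: "f = d * g" by (auto elim: dvdE)
  hence "g \<in> monics" using f assms monics_cancel by (auto simp: monics_le_def)
  thus "\<exists>g\<in>monics_le (N - degree d). f = g * d"
    using f g assms by (intro bexI[of _ g]) (auto simp: monics_le_def degree_monics_mult mult.commute)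
qed (use monics_nonzero[OF assms(1)] in auto)

lemma exp_sum_eq:
  assumes r: "r \<ge> 1"
  shows "exp_sum r N (\<alpha> :: 'a::finite_field fls) =
     (\<Sum>F | F \<in> Fs \<and> r * nd F \<le> N. (-1) ^ card F * T_sum (N - r * nd F) (gm r F \<alpha>))"
proof -
  let ?I = "{F :: 'a poly set. F \<in> Fs \<and> r * nd F \<le> N}"
  have fin: "finite ?I" using r finite_Fs_mult_nd_le(2)[of r N] by simp
  have "exp_sum r N \<alpha> = (\<Sum>f\<in>monics_le N. \<Sum>F\<in>{F\<in>?I. \<Prod>F ^ r dvd f}.
      (-1) ^ card F * laurent_char (poly_to_laurent f * \<alpha>))"
    unfolding exp_sum_eq_monics_le
  proof (intro sum.cong refl)
    fix f :: "'a poly" assume f: "f \<in> monics_le N"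
    hence f0: "f \<noteq> 0" by (auto simp: monics_le_def dest: monics_nonzero)
    have "r * nd F \<le> N" if "F \<in> Fs" "\<Prod>F ^ r dvd f" for F
      using dvd_imp_degree_le[OF that(2) f0] f that(1) by (simp add: monics_le_def degree_prod_Fs_power)
    hence "{F \<in> ?I. \<Prod>F ^ r dvd f} = {F. F \<in> Fs \<and> \<Prod>F ^ r dvd f}" by auto
    thus "a_ind r f * laurent_char (poly_to_laurent f * \<alpha>) =
        (\<Sum>F\<in>{F\<in>?I. \<Prod>F ^ r dvd f}. (-1) ^ card F * laurent_char (poly_to_laurent f * \<alpha>))"
      using f0 r by (simp add: a_ind_eq_sum sum_distrib_right)
  qed
  also have "\<dots> = (\<Sum>F\<in>?I. \<Sum>f\<in>{f\<in>monics_le N. \<Prod>F ^ r dvd f}.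
      (-1) ^ card F * laurent_char (poly_to_laurent f * \<alpha>))"
    by (rule sum.swap_restrict[OF finite_monics_le fin])
  also have "\<dots> = (\<Sum>F\<in>?I. (-1) ^ card F * T_sum (N - r * nd F) (gm r F \<alpha>))"
  proof (intro sum.cong refl)
    fix F :: "'a poly set" assume F: "F \<in> ?I"
    have bij: "bij_betw (\<lambda>g. g * \<Prod>F ^ r) (monics_le (N - r * nd F))
        {f \<in> monics_le N. \<Prod>F ^ r dvd f}"
      using bij_betw_monics_multiples[of "\<Prod>F ^ r" N] F
      by (simp add: prod_Fs_power_monics degree_prod_Fs_power)
    show "(\<Sum>f\<in>{f\<in>monics_le N. \<Prod>F ^ r dvd f}. (-1) ^ card F * laurent_char (poly_to_laurent f * \<alpha>)) =
        (-1) ^ card F * T_sum (N - r * nd F) (gm r F \<alpha>)"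
      unfolding sum.reindex_bij_betw[OF bij, symmetric] T_sum_def gm_def
      by (simp add: sum_distrib_left poly_to_laurent_mult mult.assoc)
  qed
  finally show ?thesis .
qed

section \<open>Averages over truncated Laurent series\<close>

text \<open>Polynomials also parametrise the truncated fractional parts. With the same type on both
  sides the pairing becomes symmetric, see \<open>laurent_char_times_emb\<close>.\<close>

definition emb :: "'a::finite_field poly \<Rightarrow> 'a fls" where
  "emb h = Abs_fls (\<lambda>i. if i \<ge> 1 then coeff h (nat (i - 1)) else 0)"

text \<open>The integral over the torus of a function of the first \<open>N + 1\<close>
  coefficients, which are those that a polynomial of degree \<open>N\<close> pairs with. As a finite
  average it raises no question of integrability.\<close>

definition av :: "nat \<Rightarrow> ('a::finite_field fls \<Rightarrow> real) \<Rightarrow> real" where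
  "av N \<phi> = (\<Sum>h\<in>Pol (N + 1). \<phi> (emb h)) / real CARD('a) ^ (N + 1)"

lemma emb_nth: "fls_nth (emb h) i = (if i \<ge> 1 then coeff h (nat (i - 1)) else 0)"
  unfolding emb_def by (subst nth_Abs_fls_ex_lower_bound) (auto intro!: exI[of _ 0])

lemma emb_nth_Suc: "fls_nth (emb h) (int i + 1) = coeff h i"
  by (simp add: emb_nth)

lemma frac_zero_emb: "h \<in> Pol m \<Longrightarrow> frac_zero m (emb h) \<longleftrightarrow> h = 0"
proof
  assume *: "frac_zero m (emb h)" "h \<in> Pol m"
  show "h = 0"
  proof (rule poly_eqI)
    fix i show "coeff h i = coeff 0 i"
    proof (cases "i < m")
      case True
      hence "fls_nth (emb h) (int i + 1) = 0" using * by (auto simp: frac_zero_def)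
      thus ?thesis by (simp add: emb_nth_Suc)
    qed (use * in \<open>auto simp: Pol_def\<close>)
  qed
qed (auto simp: frac_zero_def emb_nth)

lemma torus_eq_UN_cyl: "torus = (\<Union>h\<in>Pol m. fls_cyl (emb h) m)"
proof (intro equalityI subsetI)
  fix \<alpha> :: "'a fls" assume \<alpha>: "\<alpha> \<in> torus"
  define h where "h = Abs_poly (\<lambda>i. if i < m then fls_nth \<alpha> (int i + 1) else 0)"
  have h: "coeff h i = (if i < m then fls_nth \<alpha> (int i + 1) else 0)" for i
    unfolding h_def by (subst coeff_Abs_poly[of m]) auto
  have "\<alpha> \<in> fls_cyl (emb h) m" using \<alpha> by (auto simp: fls_cyl_def emb_nth torus_iff h)
  moreover have "h \<in> Pol m" by (simp add: Pol_def h)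
  ultimately show "\<alpha> \<in> (\<Union>h\<in>Pol m. fls_cyl (emb h) m)" by blast
qed (auto simp: torus_iff fls_cyl_def emb_nth)

lemma disjoint_cyl_emb: "disjoint_family_on (\<lambda>h. fls_cyl (emb h) m) (Pol m)"
  unfolding disjoint_family_on_def
proof safe
  fix h g \<alpha> assume *: "h \<in> Pol m" "g \<in> Pol m" "h \<noteq> g"
    "\<alpha> \<in> fls_cyl (emb h) m" "\<alpha> \<in> fls_cyl (emb g) m"
  have "fls_nth (emb h) i = fls_nth (emb g) i" if "i \<le> int m" for i
    using *(4,5) that by (simp add: fls_cyl_def)
  moreover have "emb (h - g) = emb h - emb g" by (intro fls_eqI) (simp add: emb_nth)
  ultimately have "frac_zero m (emb (h - g))" by (simp add: frac_zero_def)
  thus "\<alpha> \<in> {}" using * by (simp add: frac_zero_emb Pol_diff)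
qed

lemma set_integral_torus_eq_av:
  fixes \<phi> :: "'a::finite_field fls \<Rightarrow> real"
  assumes "\<And>\<alpha> \<beta>. (\<And>i. 1 \<le> i \<Longrightarrow> i \<le> int N + 1 \<Longrightarrow> fls_nth \<alpha> i = fls_nth \<beta> i) \<Longrightarrow> \<phi> \<alpha> = \<phi> \<beta>"
  shows   "(LINT \<alpha>:torus|haar. \<phi> \<alpha>) = av N \<phi>"
proof -
  define m where "m = N + 1"
  have eq: "indicator torus \<alpha> *\<^sub>R \<phi> \<alpha> =
      (\<Sum>h\<in>Pol m. \<phi> (emb h) * indicator (fls_cyl (emb h) m) \<alpha>)" for \<alpha> :: "'a fls"
  proof -
    have "indicator torus \<alpha> = (\<Sum>h\<in>Pol m. indicator (fls_cyl (emb h) m) \<alpha> :: real)"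
      unfolding torus_eq_UN_cyl[of m] using disjoint_cyl_emb
      by (intro indicator_UN_disjoint) auto
    moreover have "indicator (fls_cyl (emb h) m) \<alpha> * \<phi> \<alpha> = \<phi> (emb h) * indicator (fls_cyl (emb h) m) \<alpha>" for h
    proof (cases "\<alpha> \<in> fls_cyl (emb h) m")
      case True
      hence "\<phi> \<alpha> = \<phi> (emb h)" by (intro assms) (auto simp: fls_cyl_def m_def)
      thus ?thesis by simp
    qed simp
    ultimately show ?thesis by (simp only: real_scaleR_def sum_distrib_right)
  qed
  have haar: "sets haar = sets borel" "normalized_haar (haar :: 'a fls measure)"
    using normalized_haar_haar by (auto simp: normalized_haar_def)
  have em: "emeasure haar (fls_cyl (x :: 'a fls) m) = ennreal (1 / real CARD('a) ^ m)" for x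
  proof -
    have "emeasure haar (fls_cyl x m) = inverse (of_nat CARD('a)) ^ m"
      by (rule normalized_haar_fls_cyl) fact
    also have "\<dots> = ennreal (1 / real CARD('a) ^ m)"
      by (simp add: ennreal_of_nat_eq_real_of_nat inverse_ennreal ennreal_power divide_inverse
          power_inverse)
    finally show ?thesis .
  qed
  have int: "integrable haar (indicator (fls_cyl (x :: 'a fls) m) :: _ \<Rightarrow> real)"
    and meas: "measure haar (fls_cyl (x :: 'a fls) m) = 1 / real CARD('a) ^ m" for x
    using em[of x] by (auto simp: fls_cyl_eq_ball haar measure_def)
  have "(LINT \<alpha>:torus|haar. \<phi> \<alpha>) =
      (LINT \<alpha>|haar. (\<Sum>h\<in>Pol m. \<phi> (emb h) * indicator (fls_cyl (emb h) m) \<alpha>))"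
    by (simp only: set_lebesgue_integral_def eq)
  also have "\<dots> = (\<Sum>h\<in>Pol m. LINT \<alpha>|haar. \<phi> (emb h) * indicator (fls_cyl (emb h) m) \<alpha>)"
    using int by (intro Bochner_Integration.integral_sum) auto
  also have "\<dots> = (\<Sum>h\<in>Pol m. \<phi> (emb h) * (1 / real CARD('a) ^ m))"
    using int meas haar by (intro sum.cong refl) (simp add: fls_cyl_eq_ball sets_eq_imp_space_eq[OF haar(1)])
  finally show ?thesis by (simp add: av_def m_def sum_divide_distrib)
qed

lemma av_add: "av N (\<lambda>\<alpha>. \<phi> \<alpha> + \<psi> \<alpha>) = av N \<phi> + av N \<psi>"
  and av_diff: "av N (\<lambda>\<alpha>. \<phi> \<alpha> - \<psi> \<alpha>) = av N \<phi> - av N \<psi>"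
  and av_cmult: "av N (\<lambda>\<alpha>. c * \<phi> \<alpha>) = c * av N \<phi>"
  by (simp_all add: av_def sum.distrib sum_subtractf sum_distrib_left add_divide_distrib diff_divide_distrib)

lemma av_sum: "av N (\<lambda>\<alpha>. \<Sum>x\<in>A. \<phi> x \<alpha>) = (\<Sum>x\<in>A. av N (\<phi> x))"
  unfolding av_def by (subst sum.swap) (simp add: sum_divide_distrib)

lemma av_mono: "(\<And>\<alpha>. \<phi> \<alpha> \<le> \<psi> \<alpha>) \<Longrightarrow> av N \<phi> \<le> av N \<psi>"
  unfolding av_def by (intro divide_right_mono sum_mono) auto

lemma av_abs: "\<bar>av N \<phi>\<bar> \<le> av N (\<lambda>\<alpha>. \<bar>\<phi> \<alpha>\<bar>)"
  unfolding av_def by (simp add: abs_divide divide_right_mono sum_abs)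

section \<open>Orthogonality and joint distribution of fractional parts\<close>

lemma laurent_char_times_emb:
  assumes "f \<in> Pol m" "h \<in> Pol m"
  shows   "laurent_char (poly_to_laurent f * emb h) = laurent_char (poly_to_laurent h * emb f)"
  unfolding laurent_char_times_nth[OF assms(1)] laurent_char_times_nth[OF assms(2)] emb_nth_Suc
  by (simp add: mult.commute)

lemma laurent_char_orthogonality:
  assumes "f \<in> Pol m"
  shows   "(\<Sum>h\<in>Pol m. laurent_char (poly_to_laurent f * emb (h :: 'a::finite_field poly))) =
             of_bool (f = 0) * of_nat CARD('a) ^ m"
proof -
  have "(\<Sum>h\<in>Pol m. laurent_char (poly_to_laurent f * emb h)) =
      (\<Sum>h\<in>Pol m. laurent_char (poly_to_laurent h * emb f))"
    using assms by (intro sum.cong refl laurent_char_times_emb[of f m]) auto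
  also have "\<dots> = (if frac_zero m (emb f) then of_nat CARD('a) ^ m else 0)"
    by (rule sum_Pol_laurent_char)
  finally show ?thesis using assms by (simp add: frac_zero_emb)
qed

lemma laurent_char_minus: "laurent_char (- \<alpha>) = cnj (laurent_char \<alpha>)"
proof -
  have "laurent_char \<alpha> * laurent_char (- \<alpha>) = 1"
    unfolding laurent_char_add[symmetric] by (simp add: laurent_char_def)
  moreover have "laurent_char \<alpha> * cnj (laurent_char \<alpha>) = 1"
    by (simp flip: complex_norm_square)
  ultimately have "laurent_char \<alpha> * laurent_char (- \<alpha>) = laurent_char \<alpha> * cnj (laurent_char \<alpha>)"
    by simp
  moreover have "laurent_char \<alpha> \<noteq> 0" using norm_laurent_char[of \<alpha>] by (metis norm_zero zero_neq_one)
  ultimately show ?thesis by simp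
qed

lemma frac_zero_eq_char_sum:
  "complex_of_real (of_bool (frac_zero m (\<gamma> :: 'a::finite_field fls))) =
     (\<Sum>h\<in>Pol m. laurent_char (poly_to_laurent h * \<gamma>)) / of_nat CARD('a) ^ m"
  by (simp add: sum_Pol_laurent_char)

text \<open>Both conditions are detected by characters. Averaging leaves only the pairs with
  \<open>h * u + h' * v = 0\<close>, and by \<open>triv\<close> that is the zero pair; so the
  conditions are independent. The shift \<tau> prescribes arbitrary coefficients in place of zeros
  and only contributes phases, trivial at \<open>h = 0\<close>.\<close>

lemma av_frac_zero_joint:
  fixes u v :: "'a::finite_field poly"
  assumes "j + degree u \<le> N + 1" "m + degree v \<le> N + 1"
  assumes triv: "\<And>h h'. h \<in> Pol j \<Longrightarrow> h' \<in> Pol m \<Longrightarrow> h * u + h' * v = 0 \<Longrightarrow> h = 0 \<and> h' = 0"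
  shows   "av N (\<lambda>\<alpha>. of_bool (frac_zero j (poly_to_laurent u * \<alpha> - \<tau>)) *
             of_bool (frac_zero m (poly_to_laurent v * \<alpha>))) = 1 / real CARD('a) ^ (j + m)"
proof -
  let ?q = "of_nat CARD('a) :: complex"
  let ?e = "\<lambda>f \<alpha>. laurent_char (poly_to_laurent f * \<alpha> :: 'a fls)"
  have q0: "?q \<noteq> 0" by simp
  have "(\<Sum>\<beta>\<in>Pol (N+1). complex_of_real (of_bool (frac_zero j (poly_to_laurent u * emb \<beta> - \<tau>)) *
          of_bool (frac_zero m (poly_to_laurent v * emb \<beta>)))) =
      (\<Sum>\<beta>\<in>Pol (N+1). \<Sum>h\<in>Pol j. \<Sum>h'\<in>Pol m.
        ?e h (- \<tau>) * ?e (h * u + h' * v) (emb \<beta>) / ?q ^ (j + m))"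
    unfolding of_real_mult frac_zero_eq_char_sum sum_divide_distrib sum_product
  proof (intro sum.cong refl)
    fix \<beta> h h' :: "'a poly"
    have "poly_to_laurent h * (poly_to_laurent u * emb \<beta> - \<tau>) + poly_to_laurent h' * (poly_to_laurent v * emb \<beta>)
        = poly_to_laurent h * (- \<tau>) + poly_to_laurent (h * u + h' * v) * emb \<beta>"
      by (simp add: poly_to_laurent_add poly_to_laurent_mult algebra_simps)
    hence "?e h (poly_to_laurent u * emb \<beta> - \<tau>) * ?e h' (poly_to_laurent v * emb \<beta>) =
        ?e h (- \<tau>) * ?e (h * u + h' * v) (emb \<beta>)"
      unfolding laurent_char_add[symmetric] by (rule arg_cong)
    thus "?e h (poly_to_laurent u * emb \<beta> - \<tau>) / ?q ^ j * (?e h' (poly_to_laurent v * emb \<beta>) / ?q ^ m) =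
        ?e h (- \<tau>) * ?e (h * u + h' * v) (emb \<beta>) / ?q ^ (j + m)"
      by (simp add: power_add)
  qed
  also have "\<dots> = (\<Sum>h\<in>Pol j. \<Sum>h'\<in>Pol m.
        ?e h (- \<tau>) * (\<Sum>\<beta>\<in>Pol (N+1). ?e (h * u + h' * v) (emb \<beta>)) / ?q ^ (j + m))"
    by (subst sum.swap, rule sum.cong[OF refl], subst sum.swap, rule sum.cong[OF refl])
       (simp add: sum_distrib_left sum_divide_distrib)
  also have "\<dots> = (\<Sum>h\<in>(Pol j :: 'a poly set). \<Sum>h'\<in>(Pol m :: 'a poly set). if h = 0 \<and> h' = 0 then ?q ^ (N+1) / ?q ^ (j + m) else 0)"
  proof (rule sum.cong[OF refl], rule sum.cong[OF refl])
    fix h h' :: "'a poly" assume h: "h \<in> Pol j" "h' \<in> Pol m"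
    have "h * u + h' * v \<in> Pol (N + 1)"
      using Pol_times[OF h(1) order.refl, of u] Pol_times[OF h(2) order.refl, of v]
        Pol_mono[OF assms(1)] Pol_mono[OF assms(2)] by (intro Pol_add) blast+
    hence "(\<Sum>\<beta>\<in>Pol (N+1). ?e (h * u + h' * v) (emb \<beta>)) = of_bool (h * u + h' * v = 0) * ?q ^ (N+1)"
      by (rule laurent_char_orthogonality)
    also have "h * u + h' * v = 0 \<longleftrightarrow> h = 0 \<and> h' = 0" using triv[OF h] by auto
    finally show "?e h (- \<tau>) * (\<Sum>\<beta>\<in>Pol (N+1). ?e (h * u + h' * v) (emb \<beta>)) / ?q ^ (j + m) =
       (if h = 0 \<and> h' = 0 then ?q ^ (N+1) / ?q ^ (j + m) else 0)"
      by (auto simp: laurent_char_def)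
  qed
  also have "\<dots> = (\<Sum>h\<in>(Pol j :: 'a poly set). if h = 0 then (\<Sum>h'\<in>(Pol m :: 'a poly set). if h' = 0 then ?q ^ (N+1) / ?q ^ (j + m) else 0) else 0)"
    by (intro sum.cong refl) auto
  also have "\<dots> = ?q ^ (N+1) / ?q ^ (j + m)" by (simp add: sum.delta)
  also have "\<dots> = complex_of_real (real CARD('a) ^ (N+1) / real CARD('a) ^ (j + m))" by simp
  finally have "(\<Sum>\<beta>\<in>Pol (N+1). of_bool (frac_zero j (poly_to_laurent u * emb \<beta> - \<tau>)) *
          of_bool (frac_zero m (poly_to_laurent v * emb \<beta>))) =
       real CARD('a) ^ (N+1) / real CARD('a) ^ (j + m)"
    unfolding of_real_sum[symmetric] of_real_eq_iff .
  thus ?thesis using q0 unfolding av_def by simp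
qed

lemma av_frac_zero_shift:
  fixes u :: "'a::finite_field poly"
  assumes "j + degree u \<le> N + 1" "u \<noteq> 0"
  shows   "av N (\<lambda>\<alpha>. of_bool (frac_zero j (poly_to_laurent u * \<alpha> - \<tau>))) = 1 / real CARD('a) ^ j"
  using av_frac_zero_joint[of j u N 0 1 \<tau>] assms by simp

lemma av_frac_zero:
  fixes u :: "'a::finite_field poly"
  assumes "j + degree u \<le> N + 1" "u \<noteq> 0"
  shows   "av N (\<lambda>\<alpha>. of_bool (frac_zero j (poly_to_laurent u * \<alpha>))) = 1 / real CARD('a) ^ j"
  using av_frac_zero_shift[OF assms, of 0] by simp

lemma av_frac_zero_nth:
  fixes u :: "'a::finite_field poly"
  assumes "j + degree u \<le> N" "u \<noteq> 0"
  shows   "av N (\<lambda>\<alpha>. of_bool (frac_zero j (poly_to_laurent u * \<alpha>) \<and>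
             fls_nth (poly_to_laurent u * \<alpha>) (int j + 1) = c)) = 1 / real CARD('a) ^ (j + 1)"
proof -
  \<comment> \<open>Prescribing the coefficient after \<open>j\<close> zeros means vanishing to
    order \<open>j + 1\<close> once a monomial is subtracted.\<close>
  have eq: "(frac_zero j \<gamma> \<and> fls_nth \<gamma> (int j + 1) = c) = frac_zero (Suc j) (\<gamma> - emb (monom c j))"
    for \<gamma> :: "'a fls"
  proof -
    have "fls_nth (emb (monom c j)) i = (if i = int j + 1 then c else 0)" for i
      by (auto simp: emb_nth)
    hence "frac_zero j (\<gamma> - emb (monom c j)) \<longleftrightarrow> frac_zero j \<gamma>"
      and "fls_nth (\<gamma> - emb (monom c j)) (int j + 1) = fls_nth \<gamma> (int j + 1) - c"
      by (auto simp: frac_zero_def)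
    thus ?thesis by (simp only: frac_zero_Suc) simp
  qed
  show ?thesis
    unfolding eq using av_frac_zero_shift[of "Suc j" u N "emb (monom c j)"] assms by simp
qed

text \<open>Pairs with equal frequency survive. Frequencies may repeat, because one polynomial can
  be a multiple of several \<open>\<Prod>F ^ r\<close>; hence the count of pairs on the
  right.\<close>

lemma av_parseval_le:
  fixes f :: "'b \<Rightarrow> 'a::finite_field poly"
  assumes X: "finite X" and f: "\<And>x. x \<in> X \<Longrightarrow> f x \<in> Pol (N + 1)" and e: "\<And>x. cmod (e x) \<le> 1"
  shows   "av N (\<lambda>\<alpha>. (cmod (\<Sum>x\<in>X. e x * laurent_char (poly_to_laurent (f x) * \<alpha>)))\<^sup>2)
             \<le> real (card {(x, y) \<in> X \<times> X. f x = f y})"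
proof -
  let ?q = "of_nat CARD('a) :: complex"
  let ?S = "\<lambda>\<alpha>. \<Sum>x\<in>X. e x * laurent_char (poly_to_laurent (f x) * \<alpha>)"
  have q0: "?q \<noteq> 0" by simp
  have sq: "complex_of_real ((cmod (?S \<alpha>))\<^sup>2) = (\<Sum>x\<in>X. \<Sum>y\<in>X. e x * cnj (e y) *
      laurent_char (poly_to_laurent (f x - f y) * \<alpha>))" for \<alpha>
  proof -
    have "complex_of_real ((cmod (?S \<alpha>))\<^sup>2) = ?S \<alpha> * cnj (?S \<alpha>)"
      by (rule complex_norm_square)
    also have "\<dots> = (\<Sum>x\<in>X. \<Sum>y\<in>X. e x * cnj (e y) *
        (laurent_char (poly_to_laurent (f x) * \<alpha>) * laurent_char (- (poly_to_laurent (f y) * \<alpha>))))"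
      by (simp add: sum_product laurent_char_minus mult_ac)
    finally show ?thesis
      by (simp add: laurent_char_add[symmetric] poly_to_laurent_diff algebra_simps)
  qed
  have "(\<Sum>h\<in>Pol (N+1). complex_of_real ((cmod (?S (emb h)))\<^sup>2)) =
      (\<Sum>x\<in>X. \<Sum>y\<in>X. e x * cnj (e y) * (\<Sum>h\<in>Pol (N+1). laurent_char (poly_to_laurent (f x - f y) * emb h)))"
    unfolding sq
    by (subst sum.swap, rule sum.cong[OF refl], subst sum.swap, rule sum.cong[OF refl])
       (simp add: sum_distrib_left)
  also have "\<dots> = (\<Sum>x\<in>X. \<Sum>y\<in>X. e x * cnj (e y) * (of_bool (f x = f y) * ?q ^ (N+1)))"
    using f by (intro sum.cong refl, subst laurent_char_orthogonality) (auto intro: Pol_diff)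
  also have "cmod \<dots> \<le> (\<Sum>x\<in>X. \<Sum>y\<in>X. of_bool (f x = f y) * real CARD('a) ^ (N+1))"
    using e by (intro order.trans[OF norm_sum] sum_mono)
      (auto simp: norm_mult norm_power mult_le_one intro!: mult_left_le_one_le)
  also have "\<dots> = real (card {(x, y) \<in> X \<times> X. f x = f y}) * real CARD('a) ^ (N+1)"
  proof -
    have "(\<Sum>x\<in>X. \<Sum>y\<in>X. of_bool (f x = f y) * real CARD('a) ^ (N+1)) =
        (\<Sum>z\<in>X\<times>X. of_bool (f (fst z) = f (snd z))) * real CARD('a) ^ (N+1)"
      by (simp add: sum.cartesian_product sum_distrib_right split_def)
    also have "(\<Sum>z\<in>X\<times>X. of_bool (f (fst z) = f (snd z))) =
        real (card {z\<in>X\<times>X. f (fst z) = f (snd z)})"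
      using X by (simp add: sum.If_cases of_bool_def Int_def)
    also have "{z\<in>X\<times>X. f (fst z) = f (snd z)} = {(x, y) \<in> X \<times> X. f x = f y}" by auto
    finally show ?thesis .
  qed
  finally have "(\<Sum>h\<in>Pol (N+1). (cmod (?S (emb h)))\<^sup>2) \<le>
      real (card {(x, y) \<in> X \<times> X. f x = f y}) * real CARD('a) ^ (N+1)"
    unfolding of_real_sum[symmetric] norm_of_real by linarith
  thus ?thesis using q0 unfolding av_def by (simp add: divide_le_eq)
qed

section \<open>Geometric sums\<close>

text \<open>The sum of the geometric series with ratio \<open>q^(-|a|)\<close>. The absolute value
  lets one constant serve increasing sums and tails.\<close>

definition geom_const :: "real \<Rightarrow> real \<Rightarrow> real" where
  "geom_const q a = 1 / (1 - q powr (- \<bar>a\<bar>))"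

lemma geom_const_ge_1:
  assumes q: "q > 1" and a: "a \<noteq> 0"
  shows   "geom_const q a \<ge> 1"
proof -
  have "q powr (- \<bar>a\<bar>) < q powr 0" using q a by (intro powr_less_mono) auto
  thus ?thesis using q by (simp add: geom_const_def field_simps)
qed

text \<open>The hypothesis reads \<open>n \<le> y\<close> for positive \<open>a\<close> and
  \<open>n \<ge> y\<close> for negative \<open>a\<close>. Either way the terms decay geometrically
  away from the extreme index, and the distance to it is injective on \<open>A\<close> because
  \<open>A\<close> lies on one side of it.\<close>

lemma geometric_sum_powr_le:
  fixes A :: "nat set" and q a y :: real
  assumes q: "q > 1" and a: "a \<noteq> 0" and A: "finite A" "\<And>n. n \<in> A \<Longrightarrow> a * real n \<le> a * y"
  shows   "(\<Sum>n\<in>A. q powr (a * real n)) \<le> geom_const q a * q powr (a * y)"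
proof (cases "A = {}")
  case True
  thus ?thesis using geom_const_ge_1[OF q a] by simp
next
  case False
  define x where "x = q powr (- \<bar>a\<bar>)"
  have "x < q powr 0" unfolding x_def using q a by (intro powr_less_mono) auto
  hence x: "0 < x" "x < 1" using q by (auto simp: x_def)
  define n0 where "n0 = (if a > 0 then Max A else Min A)"
  define d where "d n = nat \<bar>int n - int n0\<bar>" for n
  have n0: "n0 \<in> A" using False A by (auto simp: n0_def)
  have side: "(if a > 0 then n \<le> n0 else n0 \<le> n)" if "n \<in> A" for n
    using that A by (auto simp: n0_def)
  have inj: "inj_on d A"
  proof (rule inj_onI)
    fix m n assume *: "m \<in> A" "n \<in> A" "d m = d n"
    show "m = n" using side[OF *(1)] side[OF *(2)] *(3) by (auto simp: d_def split: if_splits)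
  qed
  have "q powr (a * real n) = q powr (a * real n0) * x ^ d n" if "n \<in> A" for n
  proof -
    have "x ^ d n = q powr (- \<bar>a\<bar> * real (d n))"
      using q by (simp add: x_def powr_power mult.commute)
    also have "\<bar>a\<bar> * real (d n) = a * real n0 - a * real n"
      using side[OF that] a by (auto simp: d_def abs_if algebra_simps split: if_splits)
    hence "- \<bar>a\<bar> * real (d n) = a * real n - a * real n0" by simp
    finally show ?thesis using q by (simp add: powr_diff)
  qed
  hence "(\<Sum>n\<in>A. q powr (a * real n)) = q powr (a * real n0) * (\<Sum>i\<in>d`A. x ^ i)"
    by (simp add: sum.reindex[OF inj] sum_distrib_left)
  also have "(\<Sum>i\<in>d`A. x ^ i) \<le> (\<Sum>i. x ^ i)"
    using x A by (intro sum_le_suminf summable_geometric) auto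
  also have "(\<Sum>i. x ^ i) = 1 / (1 - x)" using x by (intro suminf_geometric) auto
  also have "q powr (a * real n0) * (1 / (1 - x)) \<le> q powr (a * y) * (1 / (1 - x))"
    using x q A(2)[OF n0] by (intro mult_right_mono powr_mono) auto
  finally show ?thesis using q by (simp add: x_def geom_const_def mult.commute)
qed

lemma sum_powers_le:
  assumes "q \<ge> (2::real)"
  shows   "(\<Sum>m<H. q ^ m) \<le> q ^ H" "(\<Sum>m\<le>M. q ^ m) \<le> 2 * q ^ M"
proof -
  show *: "(\<Sum>m<H. q ^ m) \<le> q ^ H" for H
  proof (induction H)
    case (Suc H)
    have "q ^ H + q ^ H \<le> q * q ^ H" using assms by (simp add: mult_right_mono flip: mult_2)
    thus ?case using Suc by simp
  qed simp
  have "(\<Sum>m\<le>M. q ^ m) = (\<Sum>m<M. q ^ m) + q ^ M" by (simp flip: lessThan_Suc_atMost)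
  thus "(\<Sum>m\<le>M. q ^ m) \<le> 2 * q ^ M" using *[of M] by simp
qed

section \<open>The model exponential sum\<close>

definition T_star :: "nat \<Rightarrow> 'a::finite_field fls \<Rightarrow> complex" where
  "T_star M \<gamma> = T_sum M \<gamma> + 1 / (of_nat CARD('a) - 1)"

lemma CARD_real_ge_2: "real CARD('a::finite_field) \<ge> 2"
  using CARD_finite_field_ge_2[where 'a='a] by linarith

lemma CARD_real_gt_1: "real CARD('a::finite_field) > 1"
  using CARD_real_ge_2[where 'a='a] by linarith

lemma CARD_neq_1 [simp]: "CARD('a::finite_field) \<noteq> Suc 0"
  using CARD_finite_field_ge_2[where 'a='a] by linarith

text \<open>Below \<open>j\<close> all character values are 1 and the terms add up to
  \<open>(q^j - 1)/(q - 1)\<close>; above \<open>j\<close> all terms vanish. At \<open>j = M\<close>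
  the sum simply ends, so there the next coefficient may be 0.\<close>

lemma T_star_value:
  assumes "frac_zero j \<gamma>" "j \<le> M" "j = M \<or> fls_nth \<gamma> (int j + 1) \<noteq> 0"
  shows   "T_star M (\<gamma> :: 'a::finite_field fls) =
             of_nat CARD('a) ^ j * (ff_char (fls_nth \<gamma> (int j + 1)) + 1 / (of_nat CARD('a) - 1))"
proof -
  let ?q = "of_nat CARD('a) :: complex"
  let ?t = "\<lambda>m. if frac_zero m \<gamma> then ?q ^ m * ff_char (fls_nth \<gamma> (int m + 1)) else 0"
  have "T_sum M \<gamma> = (\<Sum>m\<in>{..<Suc j}. ?t m)"
    unfolding T_sum_eq
  proof (intro sum.mono_neutral_right ballI)
    fix m assume m: "m \<in> {..M} - {..<Suc j}"
    hence "j \<noteq> M" "Suc j \<le> m" by auto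
    hence "\<not> frac_zero (Suc j) \<gamma>" using assms by (simp add: frac_zero_Suc)
    hence "\<not> frac_zero m \<gamma>" using \<open>Suc j \<le> m\<close> frac_zero_mono by blast
    thus "?t m = 0" by simp
  qed (use assms in auto)
  also have "\<dots> = (\<Sum>m<j. ?t m) + ?q ^ j * ff_char (fls_nth \<gamma> (int j + 1))"
    using assms by simp
  also have "(\<Sum>m<j. ?t m) = (\<Sum>m<j. ?q ^ m)"
  proof (intro sum.cong refl)
    fix m assume "m \<in> {..<j}"
    hence "frac_zero (Suc m) \<gamma>" using assms(1) by (auto intro: frac_zero_mono)
    thus "?t m = ?q ^ m" by (auto simp: frac_zero_Suc)
  qed
  also have "\<dots> = (?q ^ j - 1) / (?q - 1)"
    by (simp add: sum_gp_strict minus_divide_divide[symmetric, of "1 - _"])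
  finally show ?thesis
    by (simp add: T_star_def diff_divide_distrib algebra_simps)
qed

lemma T_star_cases:
  assumes "frac_zero H \<gamma>" "H \<le> M"
  obtains j where "H \<le> j" "j \<le> M" "frac_zero j \<gamma>" "j = M \<or> fls_nth \<gamma> (int j + 1) \<noteq> 0"
proof -
  let ?A = "{j. j \<le> M \<and> frac_zero j \<gamma>}"
  have A: "finite ?A" "H \<in> ?A" using assms by auto
  have "Max ?A \<in> ?A" using A Max_in by blast
  moreover have "H \<le> Max ?A" using A by simp
  moreover have "Max ?A = M \<or> fls_nth \<gamma> (int (Max ?A) + 1) \<noteq> 0"
  proof (rule ccontr)
    assume "\<not> ?thesis"
    hence "Suc (Max ?A) \<in> ?A" using \<open>Max ?A \<in> ?A\<close> by (auto simp: frac_zero_Suc)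
    thus False using A(1) Max_ge not_less_eq_eq by blast
  qed
  ultimately show ?thesis using that by blast
qed

lemma norm_inverse_CARD_le: "cmod (1 / (of_nat CARD('a::finite_field) - 1)) \<le> 1"
proof -
  have "cmod (of_nat CARD('a) - 1) = real CARD('a) - 1"
  proof -
    have "of_nat CARD('a) - 1 = complex_of_real (real CARD('a) - 1)" by simp
    thus ?thesis using CARD_real_ge_2[where 'a='a] by (simp only: norm_of_real)
  qed
  thus ?thesis using CARD_real_ge_2[where 'a='a] by (simp add: norm_divide field_simps)
qed

lemma norm_T_star_le:
  assumes "frac_zero j \<gamma>" "j \<le> M" "j = M \<or> fls_nth \<gamma> (int j + 1) \<noteq> 0"
  shows   "cmod (T_star M (\<gamma> :: 'a::finite_field fls)) \<le> 2 * real CARD('a) ^ j"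
proof -
  have "cmod (ff_char (fls_nth \<gamma> (int j + 1)) + 1 / (of_nat CARD('a) - 1)) \<le> 1 + 1"
    by (rule order.trans[OF norm_triangle_ineq add_mono[OF _ norm_inverse_CARD_le]]) simp
  thus ?thesis unfolding T_star_value[OF assms] by (simp add: norm_mult norm_power)
qed

text \<open>Multiplication by \<open>u\<close> lowers \<open>j\<close> and \<open>M\<close> by
  \<open>p\<close> together and keeps the decisive coefficient, so only the factor
  \<open>q^j\<close> changes.\<close>

lemma T_star_scale:
  assumes u: "u \<in> monics" "degree u = p" and \<gamma>: "frac_zero p \<gamma>" "p \<le> M"
  shows   "T_star (M - p) (poly_to_laurent u * \<gamma>) = T_star M (\<gamma> :: 'a::finite_field fls) / of_nat CARD('a) ^ p"
proof -
  obtain j where j: "p \<le> j" "j \<le> M" "frac_zero j \<gamma>" "j = M \<or> fls_nth \<gamma> (int j + 1) \<noteq> 0"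
    using T_star_cases[OF \<gamma>] .
  define i where "i = j - p"
  have ij: "i + p = j" using j by (simp add: i_def)
  have fz: "frac_zero i (poly_to_laurent u * \<gamma>)"
    using frac_zero_monic_times[OF u \<gamma>(1), of i] j ij by simp
  have nth: "fls_nth (poly_to_laurent u * \<gamma>) (int i + 1) = fls_nth \<gamma> (int j + 1)"
    using fls_nth_monic_times[OF u, of i \<gamma>] j ij by simp
  have "T_star (M - p) (poly_to_laurent u * \<gamma>) =
      of_nat CARD('a) ^ i * (ff_char (fls_nth \<gamma> (int j + 1)) + 1 / (of_nat CARD('a) - 1))"
    using T_star_value[OF fz, of "M - p"] j ij unfolding nth by auto
  moreover have "T_star M \<gamma> =
      of_nat CARD('a) ^ j * (ff_char (fls_nth \<gamma> (int j + 1)) + 1 / (of_nat CARD('a) - 1))"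
    using T_star_value[OF j(3,2,4)] .
  ultimately show ?thesis by (simp add: ij[symmetric] power_add)
qed

lemma norm_T_sum_le_not_frac_zero:
  assumes "\<not> frac_zero H \<gamma>"
  shows   "cmod (T_sum M (\<gamma> :: 'a::finite_field fls)) \<le> real CARD('a) ^ H"
proof -
  have lt: "i < H" if "frac_zero i \<gamma>" for i
    using assms frac_zero_mono[OF that, of H] by (meson not_less)
  have "cmod (T_sum M \<gamma>) \<le> (\<Sum>m\<le>M. real CARD('a) ^ m * of_bool (frac_zero m \<gamma>))"
    by (rule norm_T_sum_le)
  also have "\<dots> \<le> (\<Sum>m\<in>{..M} \<inter> {..<H}. real CARD('a) ^ m * of_bool (frac_zero m \<gamma>))"
    by (rule eq_refl[OF sum.mono_neutral_right])
       (auto dest: lt)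
  also have "\<dots> \<le> (\<Sum>m\<in>{..M} \<inter> {..<H}. real CARD('a) ^ m)"
    by (intro sum_mono) auto
  also have "\<dots> \<le> (\<Sum>m<H. real CARD('a) ^ m)"
    by (intro sum_mono2) auto
  also have "\<dots> \<le> real CARD('a) ^ H"
    by (rule sum_powers_le[OF CARD_real_ge_2])
  finally show ?thesis .
qed

lemma norm_T_sum_le_trivial: "cmod (T_sum M (\<gamma> :: 'a::finite_field fls)) \<le> 2 * real CARD('a) ^ M"
proof -
  have "cmod (T_sum M \<gamma>) \<le> (\<Sum>m\<le>M. real CARD('a) ^ m * of_bool (frac_zero m \<gamma>))"
    by (rule norm_T_sum_le)
  also have "\<dots> \<le> (\<Sum>m\<le>M. real CARD('a) ^ m)"
    by (intro sum_mono) auto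
  also have "\<dots> \<le> 2 * real CARD('a) ^ M"
    by (rule sum_powers_le[OF CARD_real_ge_2])
  finally show ?thesis .
qed

section \<open>Major arcs\<close>

text \<open>
  \<open>F \<in> Maj r N \<alpha>\<close> says that \<open>\<alpha>\<close> is within \<open>q\<^bsup>-N/2\<^esup>/|d|\<^sup>r\<close> of a fraction with denominator \<open>d\<^sup>r\<close>,
  \<open>d = \<Prod>F\<close>. The least such \<open>F\<close>, the centre, consists of the primes dividing the reduced denominator.
  The term of \<open>G\<close> in the exponential sum is an exact multiple of the term of the centre \<open>F\<close>,
  up to an additive constant, when \<open>G\<close> is aligned with \<open>F\<close>.
\<close>

definition Maj :: "nat \<Rightarrow> nat \<Rightarrow> 'a::finite_field fls \<Rightarrow> 'a poly set set" where
  "Maj r N \<alpha> = {F \<in> Fs. r * nd F \<le> N div 2 \<and> frac_zero (N div 2) (gm r F \<alpha>)}"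

definition centre :: "nat \<Rightarrow> nat \<Rightarrow> 'a::finite_field fls \<Rightarrow> 'a poly set \<Rightarrow> bool" where
  "centre r N \<alpha> F \<longleftrightarrow> F \<in> Maj r N \<alpha> \<and> (\<forall>G\<in>Maj r N \<alpha>. F \<subseteq> G)"

definition aligned :: "nat \<Rightarrow> 'a::finite_field fls \<Rightarrow> 'a poly set \<Rightarrow> 'a poly set \<Rightarrow> bool" where
  "aligned r \<alpha> F G \<longleftrightarrow> F \<subseteq> G \<and> frac_zero (r * nd (G - F)) (gm r F \<alpha>)"

lemma prod_Fs_power_split:
  assumes "F \<in> Fs" "G \<subseteq> F"
  shows   "\<Prod>F ^ r = \<Prod>(F - G) ^ r * \<Prod>G ^ r"
  using assms Fs_finite[OF assms(1)] by (simp add: prod.subset_diff[of G F] power_mult_distrib)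

lemma gm_split:
  assumes "F \<in> Fs" "G \<subseteq> F"
  shows   "gm r F \<alpha> = poly_to_laurent (\<Prod>(F - G) ^ r) * gm r G \<alpha>"
  by (simp add: gm_def prod_Fs_power_split[OF assms] poly_to_laurent_mult mult.assoc)

text \<open>Dividing out the common factor \<open>\<Prod>(F \<inter> G) ^ r\<close> leaves two
  coprime multipliers, to which \<open>frac_zero_descent\<close> applies.\<close>

lemma gm_descent:
  assumes FG: "F \<in> Fs" "G \<in> Fs"
  assumes "frac_zero a (gm r F \<alpha>)" "r * nd (G - F) \<le> a"
  assumes "frac_zero b (gm r G \<alpha>)" "r * nd (F - G) \<le> b"
  shows   "frac_zero (a + r * nd (F - G)) (gm r (F \<inter> G) \<alpha>)"
proof -
  define u v where "u = \<Prod>(F - G) ^ r" and "v = \<Prod>(G - F) ^ r"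
  have sets: "F - F \<inter> G = F - G" "G - F \<inter> G = G - F" by auto
  have u: "gm r F \<alpha> = poly_to_laurent u * gm r (F \<inter> G) \<alpha>"
    and v: "gm r G \<alpha> = poly_to_laurent v * gm r (F \<inter> G) \<alpha>"
    using gm_split[OF FG(1), of "F \<inter> G" r \<alpha>] gm_split[OF FG(2), of "F \<inter> G" r \<alpha>]
    unfolding sets u_def v_def by auto
  have cop: "u dvd w" if "u dvd v * w" for w
    using that unfolding u_def v_def
    by (rule prod_Fs_power_coprime[rotated -1]) (use FG Fs_Diff in auto)
  have deg: "degree u = r * nd (F - G)" "degree v = r * nd (G - F)"
    unfolding u_def v_def using FG by (auto intro!: degree_prod_Fs_power Fs_Diff)
  have "u \<noteq> 0"
    unfolding u_def using FG by (intro monics_nonzero prod_Fs_power_monics Fs_Diff)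
  from frac_zero_descent[OF this cop assms(3)[unfolded u] _ assms(5)[unfolded v]]
  show ?thesis using assms(4,6) by (simp only: deg)
qed

text \<open>The degree bound and the order of vanishing in \<open>Maj\<close> are both
  \<open>N div 2\<close>, which is just what the descent requires of the two differences.\<close>

lemma Maj_Int:
  assumes "F \<in> Maj r N \<alpha>" "G \<in> Maj r N \<alpha>"
  shows   "F \<inter> G \<in> Maj r N \<alpha>"
proof -
  have FG: "F \<in> Fs" "G \<in> Fs" using assms by (auto simp: Maj_def)
  have "nd (F - G) \<le> nd F" "nd (G - F) \<le> nd G" "nd (F \<inter> G) \<le> nd F"
    using FG Fs_finite by (auto intro!: nd_mono)
  hence "r * nd (F - G) \<le> r * nd F" "r * nd (G - F) \<le> r * nd G" "r * nd (F \<inter> G) \<le> r * nd F"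
    by (auto intro: mult_le_mono2)
  moreover have "r * nd F \<le> N div 2" "r * nd G \<le> N div 2" using assms by (auto simp: Maj_def)
  ultimately have le: "r * nd (F - G) \<le> N div 2" "r * nd (G - F) \<le> N div 2"
    "r * nd (F \<inter> G) \<le> N div 2" by linarith+
  have "frac_zero (N div 2 + r * nd (F - G)) (gm r (F \<inter> G) \<alpha>)"
    using assms le by (intro gm_descent[where b = "N div 2"]) (auto simp: Maj_def)
  thus ?thesis using assms le FG by (auto simp: Maj_def intro: Fs_Int frac_zero_mono)
qed

text \<open>A member of least cardinality lies in every other member, because the family is closed
  under intersection.\<close>

lemma ex_centre:
  assumes "Maj r N \<alpha> \<noteq> {}"
  shows   "\<exists>F. centre r N \<alpha> F"
proof -
  obtain F where F: "F \<in> Maj r N \<alpha>" "\<And>G. G \<in> Maj r N \<alpha> \<Longrightarrow> card F \<le> card G"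
    using assms ex_has_least_nat[of "\<lambda>F. F \<in> Maj r N \<alpha>" _ card] by blast
  have "F \<subseteq> G" if G: "G \<in> Maj r N \<alpha>" for G
  proof -
    have "finite F" using F(1) by (auto simp: Maj_def intro: Fs_finite)
    moreover have "card F \<le> card (F \<inter> G)" using F Maj_Int[OF F(1) G] by blast
    ultimately have "F \<inter> G = F" by (intro card_seteq) auto
    thus ?thesis by blast
  qed
  thus ?thesis using F(1) unfolding centre_def by blast
qed

lemma centre_unique: "centre r N \<alpha> F \<Longrightarrow> centre r N \<alpha> G \<Longrightarrow> F = G"
  unfolding centre_def by blast

lemma centreD:
  assumes "centre r N \<alpha> F"
  shows   "F \<in> Fs" "r * nd F \<le> N div 2" "frac_zero (N div 2) (gm r F \<alpha>)" "N div 2 \<le> N - r * nd F"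
  using assms by (auto simp: centre_def Maj_def)

text \<open>The key independence statement: if the two congruence conditions are not independent,
  then any common solution descends to the intersection of \<open>F\<close> and \<open>G\<close>, which makes \<open>G\<close> aligned.\<close>

lemma av_not_aligned_le:
  fixes F G :: "'a::finite_field poly set"
  assumes FG: "F \<in> Fs" "G \<in> Fs" and j: "j + r * nd F \<le> N" "N div 2 \<le> j" and m: "m + r * nd G \<le> N"
  shows   "av N (\<lambda>\<alpha>. of_bool (centre r N \<alpha> F \<and> frac_zero j (gm r F \<alpha>) \<and>
             \<not> aligned r \<alpha> F G \<and> frac_zero m (gm r G \<alpha>))) \<le> 1 / real CARD('a) ^ (j + m)"
proof -
  let ?\<phi> = "\<lambda>\<alpha>. of_bool (centre r N \<alpha> F \<and> frac_zero j (gm r F \<alpha>) \<and>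
             \<not> aligned r \<alpha> F G \<and> frac_zero m (gm r G \<alpha>)) :: real"
  show ?thesis
  proof (cases "\<forall>h\<in>Pol j. \<forall>h'\<in>Pol m. h * \<Prod>F ^ r + h' * \<Prod>G ^ r = 0 \<longrightarrow> h = 0 \<and> h' = 0")
    case True
    have "av N ?\<phi> \<le> av N (\<lambda>\<alpha>. of_bool (frac_zero j (poly_to_laurent (\<Prod>F ^ r) * \<alpha> - 0)) *
             of_bool (frac_zero m (poly_to_laurent (\<Prod>G ^ r) * \<alpha>)))"
      by (intro av_mono) (simp add: gm_def)
    also have "\<dots> = 1 / real CARD('a) ^ (j + m)"
      using True j m by (intro av_frac_zero_joint) (auto simp: degree_prod_Fs_power FG)
    finally show ?thesis .
  next
    case False
    then obtain h h' where h: "h \<in> Pol j" "h' \<in> Pol m" "h * \<Prod>F ^ r + h' * \<Prod>G ^ r = 0"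
      "h \<noteq> 0 \<or> h' \<noteq> 0" by blast
    define u v w where "u = \<Prod>(F - G) ^ r" and "v = \<Prod>(G - F) ^ r" and "w = \<Prod>(F \<inter> G) ^ r"
    have nz: "u \<noteq> 0" "v \<noteq> 0" "w \<noteq> 0" unfolding u_def v_def w_def
      using FG by (auto intro!: monics_nonzero prod_Fs_power_monics Fs_Diff Fs_Int simp del: power_eq_0_iff)
    have sets: "F - F \<inter> G = F - G" "G - F \<inter> G = G - F" by auto
    have "\<Prod>F ^ r = u * w" "\<Prod>G ^ r = v * w" unfolding u_def v_def w_def
      using prod_Fs_power_split[OF FG(1), of "F \<inter> G" r] prod_Fs_power_split[OF FG(2), of "F \<inter> G" r]
      by (auto simp: sets)
    hence "(h * u + h' * v) * w = 0" using h(3) by (simp add: algebra_simps)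
    hence eq: "h * u = - (h' * v)" using nz by (simp add: add_eq_0_iff)
    have hnz: "h \<noteq> 0" "h' \<noteq> 0" using h(4) eq nz by auto
    \<comment> \<open>By coprimality a nontrivial relation forces \<open>u dvd h'\<close> and
      \<open>v dvd h\<close>. The resulting bounds \<open>degree u < m\<close> and
      \<open>degree v < j\<close> are the degree hypotheses of \<open>gm_descent\<close>.\<close>
    have "v * h' = u * (- h)" using eq by (simp add: mult.commute)
    hence "u dvd v * h'" by simp
    hence "u dvd h'" unfolding u_def v_def
      by (rule prod_Fs_power_coprime[rotated -1]) (use FG Fs_Diff in auto)
    hence du: "degree u < m" using Pol_degree_less[OF h(2) hnz(2)] dvd_imp_degree_le[OF _ hnz(2)] le_less_trans by blast
    have "u * h = v * (- h')" using eq by (simp add: mult.commute)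
    hence "v dvd u * h" by simp
    hence "v dvd h" unfolding u_def v_def
      by (rule prod_Fs_power_coprime[rotated -1]) (use FG Fs_Diff in auto)
    hence dv: "degree v < j" using Pol_degree_less[OF h(1) hnz(1)] dvd_imp_degree_le[OF _ hnz(1)] le_less_trans by blast
    have deg: "degree u = r * nd (F - G)" "degree v = r * nd (G - F)"
      unfolding u_def v_def using FG by (auto intro!: degree_prod_Fs_power Fs_Diff)
    have "?\<phi> \<alpha> = 0" for \<alpha>
    proof -
      have False if c: "centre r N \<alpha> F" and fj: "frac_zero j (gm r F \<alpha>)"
        and na: "\<not> aligned r \<alpha> F G" and fm: "frac_zero m (gm r G \<alpha>)"
      proof -
        have "frac_zero (j + r * nd (F - G)) (gm r (F \<inter> G) \<alpha>)"
          using fj fm du dv deg by (intro gm_descent[OF FG, where b = m]) auto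
        hence "frac_zero (N div 2) (gm r (F \<inter> G) \<alpha>)" using j by (elim frac_zero_mono) auto
        moreover have "r * nd (F \<inter> G) \<le> N div 2"
          using FG Fs_finite
          by (intro order.trans[OF mult_le_mono2 centreD(2)[OF c]] nd_mono) auto
        ultimately have "F \<inter> G \<in> Maj r N \<alpha>"
          using FG by (auto simp: Maj_def intro: Fs_Int)
        hence "F \<subseteq> G" using c by (auto simp: centre_def)
        moreover have "frac_zero (r * nd (G - F)) (gm r F \<alpha>)"
          using fj dv deg by (elim frac_zero_mono) auto
        ultimately show False using na by (simp add: aligned_def)
      qed
      thus ?thesis by auto
    qed
    hence "av N ?\<phi> = 0" unfolding av_def by (simp only: sum.neutral_const div_0)
    thus ?thesis by simp
  qed
qed

lemma av_frac_zero_gm: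
  fixes F :: "'a::finite_field poly set"
  assumes "F \<in> Fs" "j + r * nd F \<le> N + 1"
  shows   "av N (\<lambda>\<alpha>. of_bool (frac_zero j (gm r F \<alpha>))) = 1 / real CARD('a) ^ j"
  unfolding gm_def using assms monics_nonzero[OF prod_Fs_power_monics[of F r]]
  by (intro av_frac_zero) (simp_all only: degree_prod_Fs_power not_False_eq_True)

section \<open>Sums over all squarefree polynomials\<close>

lemma CARD_powr_neg: "real CARD('a::finite_field) powr (- (real r * real n)) = 1 / real CARD('a) ^ (r * n)"
  using CARD_real_ge_2[where 'a='a]
  by (simp add: powr_minus powr_realpow[symmetric] divide_inverse flip: of_nat_mult)

text \<open>With at most \<open>q^n\<close> sets of degree \<open>n\<close> the sum is dominated by
  a geometric one of ratio \<open>q^(1 - s)\<close>. Taking \<open>y = 0\<close> bounds the whole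
  series.\<close>

lemma Fs_tail_bound:
  fixes A :: "'a::finite_field poly set set"
  assumes s: "s > (1::real)" and A: "finite A" "A \<subseteq> Fs" "\<And>F. F \<in> A \<Longrightarrow> y \<le> real (nd F)"
  shows   "(\<Sum>F\<in>A. real CARD('a) powr (- (s * real (nd F))))
             \<le> geom_const (real CARD('a)) (1 - s) * real CARD('a) powr ((1 - s) * y)"
proof -
  have q: "real CARD('a) > 1" by (rule CARD_real_gt_1)
  have "(\<Sum>F\<in>A. real CARD('a) powr (- (s * real (nd F)))) \<le>
      (\<Sum>n\<in>nd ` A. real CARD('a) ^ n * real CARD('a) powr (- (s * real n)))"
    using A by (intro sum_Fs_le) auto
  also have "\<dots> = (\<Sum>n\<in>nd ` A. real CARD('a) powr ((1 - s) * real n))"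
    using q by (intro sum.cong refl) (simp add: powr_realpow[symmetric] powr_add[symmetric] algebra_simps)
  also have "\<dots> \<le> geom_const (real CARD('a)) (1 - s) * real CARD('a) powr ((1 - s) * y)"
    using A s q by (intro geometric_sum_powr_le) (auto intro: mult_left_mono_neg)
  finally show ?thesis .
qed

lemma Fs_summable:
  assumes s: "s > (1::real)" and A: "A \<subseteq> Fs"
  shows   "(\<lambda>F. real CARD('a) powr (- (s * real (nd (F :: 'a::finite_field poly set))))) summable_on A"
proof (rule nonneg_bdd_above_summable_on)
  show "bdd_above (sum (\<lambda>F. real CARD('a) powr (- (s * real (nd F)))) ` {F. F \<subseteq> A \<and> finite F})"
    using A Fs_tail_bound[OF s, of _ 0]
    by (intro bdd_aboveI2[of _ _ "geom_const (real CARD('a)) (1 - s) * real CARD('a) powr ((1 - s) * 0)"]) auto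
qed auto

lemma Fs_tail_bound_infsum:
  fixes A :: "'a::finite_field poly set set"
  assumes s: "s > (1::real)" and A: "A \<subseteq> Fs" "\<And>F. F \<in> A \<Longrightarrow> y \<le> real (nd F)"
  shows   "(\<Sum>\<^sub>\<infinity>F\<in>A. real CARD('a) powr (- (s * real (nd F))))
             \<le> geom_const (real CARD('a)) (1 - s) * real CARD('a) powr ((1 - s) * y)"
  using A by (intro infsum_le_finite_sums Fs_summable[OF s] Fs_tail_bound[OF s]) auto

section \<open>Moebius weights and the coefficients of the model\<close>

definition moeb_wt :: "nat \<Rightarrow> 'a::finite_field poly set \<Rightarrow> real" where
  "moeb_wt r F = (-1) ^ card F / real CARD('a) ^ (r * nd F)"

text \<open>By \<open>cF_eq\<close> and \<open>cF_empty\<close> its value is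
  \<open>(-1)^card F\<close> divided by zeta(r) and by the product of \<open>|\<pi>|^r - 1\<close>
  over \<open>F\<close>.\<close>

definition cF :: "nat \<Rightarrow> 'a::finite_field poly set \<Rightarrow> real" where
  "cF r F = infsum (moeb_wt r) {G \<in> Fs. F \<subseteq> G}"

lemma abs_moeb_wt:
  "\<bar>moeb_wt r (F :: 'a::finite_field poly set)\<bar> = real CARD('a) powr (- (real r * real (nd F)))"
  unfolding CARD_powr_neg moeb_wt_def by (simp add: abs_divide power_abs)

lemma moeb_wt_summable:
  assumes "r \<ge> 2" "A \<subseteq> Fs"
  shows   "(\<lambda>F. \<bar>moeb_wt r F\<bar>) summable_on A" "moeb_wt r summable_on A"
proof -
  show "(\<lambda>F. \<bar>moeb_wt r F\<bar>) summable_on A"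
    unfolding abs_moeb_wt using assms by (intro Fs_summable) auto
  thus "moeb_wt r summable_on A" using abs_summable_summable[of "moeb_wt r" A] by simp
qed

lemma moeb_wt_Un:
  assumes "F \<in> Fs" "G \<in> Fs" "F \<inter> G = {}"
  shows   "moeb_wt r (F \<union> G) = moeb_wt r F * moeb_wt r (G :: 'a::finite_field poly set)"
  using assms Fs_finite[OF assms(1)] Fs_finite[OF assms(2)]
  by (simp add: moeb_wt_def card_Un_disjoint nd_Un power_add ring_distribs)

text \<open>Each superset of \<open>F\<close> is \<open>F\<close> together with a disjoint set, so
  the part omitted from \<open>A\<close> is the weight of \<open>F\<close> times a tail over the
  differences. With \<open>A = {}\<close> and \<open>y = 0\<close> this bounds \<open>cF r F\<close>
  itself.\<close>

lemma cF_approx: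
  fixes F :: "'a::finite_field poly set"
  assumes r: "r \<ge> 2" and F: "F \<in> Fs" and A: "finite A" "A \<subseteq> {G \<in> Fs. F \<subseteq> G}"
    and y: "\<And>G. G \<in> Fs \<Longrightarrow> F \<subseteq> G \<Longrightarrow> G \<notin> A \<Longrightarrow> y \<le> real (nd (G - F))"
  shows   "\<bar>cF r F - sum (moeb_wt r) A\<bar> * real CARD('a) ^ (r * nd F)
             \<le> geom_const (real CARD('a)) (1 - real r) * real CARD('a) powr ((1 - real r) * y)"
proof -
  let ?C = "geom_const (real CARD('a)) (1 - real r)"
    define B where "B = {G \<in> Fs. F \<subseteq> G} - A"
    define D where "D = (\<lambda>G. G - F) ` B"
    have BFs: "B \<subseteq> Fs" and DFs: "D \<subseteq> Fs" by (auto simp: B_def D_def intro: Fs_Diff)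
    have un: "{G \<in> Fs. F \<subseteq> G} = A \<union> B" using A by (auto simp: B_def)
    have AFs: "A \<subseteq> Fs" using A by auto
    have "cF r F = infsum (moeb_wt r) A + infsum (moeb_wt r) B"
      unfolding cF_def un
      using BFs AFs r by (intro infsum_Un_disjoint moeb_wt_summable) (auto simp: B_def)
    hence "cF r F - sum (moeb_wt r) A = infsum (moeb_wt r) B" using A by simp
    also have "\<bar>\<dots>\<bar> \<le> (\<Sum>\<^sub>\<infinity>G\<in>B. \<bar>moeb_wt r G\<bar>)"
      using norm_infsum_bound[of "moeb_wt r" B] moeb_wt_summable(1)[OF r BFs] by simp
    also have "\<dots> = (\<Sum>\<^sub>\<infinity>G\<in>D. \<bar>moeb_wt r F\<bar> * \<bar>moeb_wt r G\<bar>)"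
    proof -
      have "bij_betw (\<lambda>G. G - F) B D"
        unfolding bij_betw_def D_def by (auto simp: B_def intro!: inj_onI)
      moreover have "\<bar>moeb_wt r G\<bar> = \<bar>moeb_wt r F\<bar> * \<bar>moeb_wt r (G - F)\<bar>" if "G \<in> B" for G
      proof -
        have "G = F \<union> (G - F)" using that by (auto simp: B_def)
        hence "moeb_wt r G = moeb_wt r F * moeb_wt r (G - F)"
          using moeb_wt_Un[of F "G - F" r] F that BFs Fs_Diff by fastforce
        thus ?thesis by (simp add: abs_mult)
      qed
      ultimately show ?thesis
        using infsum_reindex_bij_betw[of "\<lambda>G. G - F" B D "\<lambda>G. \<bar>moeb_wt r F\<bar> * \<bar>moeb_wt r G\<bar>"]
        by (simp cong: infsum_cong)
    qed
    also have "\<dots> = \<bar>moeb_wt r F\<bar> * (\<Sum>\<^sub>\<infinity>G\<in>D. \<bar>moeb_wt r G\<bar>)"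
      by (rule infsum_cmult_right')
    also have "\<dots> \<le> \<bar>moeb_wt r F\<bar> * (?C * real CARD('a) powr ((1 - real r) * y))"
      unfolding abs_moeb_wt
      using y DFs r by (intro mult_left_mono Fs_tail_bound_infsum) (auto simp: D_def B_def)
    also have "\<dots> = ?C * real CARD('a) powr ((1 - real r) * y) / real CARD('a) ^ (r * nd F)"
      unfolding abs_moeb_wt CARD_powr_neg by simp
    finally show ?thesis using CARD_real_ge_2[where 'a='a] by (simp add: field_simps)
qed

lemma Irr_power_gt_1:
  assumes "r \<ge> 2" "\<pi> \<in> (Irr :: 'a::finite_field poly set)"
  shows   "real CARD('a) ^ (r * degree \<pi>) > 1"
proof -
  have "real CARD('a) ^ 1 \<le> real CARD('a) ^ (r * degree \<pi>)"
    using assms Irr_degree[OF assms(2)] CARD_real_ge_2[where 'a='a] by (intro power_increasing) auto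
  thus ?thesis using CARD_real_ge_2[where 'a='a] unfolding power_one_right by linarith
qed

text \<open>Adding \<pi> to a superset that avoids it multiplies the weight by \<open>-x\<close>,
  where \<open>x = |\<pi>|^(-r)\<close>. So the part with \<pi> is \<open>-x\<close> times the part
  without it, the two parts sum to \<open>cF r F\<close>, and the claim is the solution of this
  linear equation.\<close>

lemma cF_insert:
  fixes F :: "'a::finite_field poly set"
  assumes r: "r \<ge> 2" and F: "F \<in> Fs" "\<pi> \<in> Irr" "\<pi> \<notin> F"
  shows   "cF r (insert \<pi> F) = - cF r F / (real CARD('a) ^ (r * degree \<pi>) - 1)"
proof -
  define x where "x = 1 / real CARD('a) ^ (r * degree \<pi>)"
  define A where "A = {G \<in> Fs. insert \<pi> F \<subseteq> G}"
  define B where "B = {G \<in> Fs. F \<subseteq> G \<and> \<pi> \<notin> G}"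
  have AB: "A \<subseteq> Fs" "B \<subseteq> Fs" "A \<inter> B = {}" "{G \<in> Fs. F \<subseteq> G} = A \<union> B"
    by (auto simp: A_def B_def)
  have sum: "cF r F = infsum (moeb_wt r) A + infsum (moeb_wt r) B"
    unfolding cF_def AB(4) using AB r by (intro infsum_Un_disjoint moeb_wt_summable)
  have "bij_betw (insert \<pi>) B A"
    unfolding bij_betw_def
  proof
    show "inj_on (insert \<pi>) B" by (rule inj_onI) (metis (mono_tags, lifting) B_def mem_Collect_eq insert_ident)
    show "insert \<pi> ` B = A"
    proof (intro equalityI subsetI)
      fix G assume G: "G \<in> A"
      hence "G - {\<pi>} \<in> B" "insert \<pi> (G - {\<pi>}) = G" using F by (auto simp: A_def B_def intro: Fs_Diff)
      thus "G \<in> insert \<pi> ` B" by (metis image_eqI)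
    qed (use F in \<open>auto simp: A_def B_def intro: Fs_insert\<close>)
  qed
  hence "infsum (moeb_wt r) A = (\<Sum>\<^sub>\<infinity>G\<in>B. moeb_wt r (insert \<pi> G))"
    by (rule infsum_reindex_bij_betw[symmetric])
  also have "\<dots> = (\<Sum>\<^sub>\<infinity>G\<in>B. (- x) * moeb_wt r G)"
  proof (rule infsum_cong)
    fix G assume "G \<in> B"
    hence "finite G" "\<pi> \<notin> G" by (auto simp: B_def intro: Fs_finite)
    thus "moeb_wt r (insert \<pi> G) = - x * moeb_wt r G"
      by (simp add: moeb_wt_def x_def nd_def ring_distribs power_add)
  qed
  also have "\<dots> = - x * infsum (moeb_wt r) B" by (rule infsum_cmult_right')
  finally have "infsum (moeb_wt r) A = - x * (cF r F - infsum (moeb_wt r) A)"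
    using sum by (simp add: algebra_simps)
  moreover have "cF r (insert \<pi> F) = infsum (moeb_wt r) A" by (simp add: cF_def A_def)
  ultimately have *: "cF r (insert \<pi> F) = - x * (cF r F - cF r (insert \<pi> F))" by simp
  have gt: "real CARD('a) ^ (r * degree \<pi>) > 1" by (rule Irr_power_gt_1[OF r F(2)])
  define Y where "Y = real CARD('a) ^ (r * degree \<pi>)"
  have "cF r (insert \<pi> F) * Y = - (cF r F - cF r (insert \<pi> F))"
    using gt by (subst *) (simp add: x_def Y_def)
  hence "cF r (insert \<pi> F) * (Y - 1) = - cF r F" by (simp add: algebra_simps)
  moreover have "Y - 1 \<noteq> 0" using gt by (simp add: Y_def)
  ultimately show ?thesis unfolding Y_def[symmetric]
    using nonzero_eq_divide_eq[of "Y - 1" "cF r (insert \<pi> F)" "- cF r F"] by blast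
qed

lemma cF_eq:
  fixes F :: "'a::finite_field poly set"
  assumes r: "r \<ge> 2" and F: "F \<in> Fs"
  shows   "cF r F = cF r ({} :: 'a poly set) * (\<Prod>\<pi>\<in>F. - 1 / (real CARD('a) ^ (r * degree \<pi>) - 1))"
proof -
  have "finite F" using F Fs_finite by blast
  thus ?thesis using F
  proof (induction F)
    case (insert \<pi> F)
    hence "F \<in> Fs" "\<pi> \<in> Irr" using Fs_subset Fs_Irr by blast+
    thus ?case using insert cF_insert[OF r, of F \<pi>] by simp
  qed simp
qed

section \<open>The zeta function and the singular series\<close>

lemma poly_abs_monic: "f \<in> monics \<Longrightarrow> poly_abs (f :: 'a::finite_field poly) = real CARD('a) ^ degree f"
  by (auto simp: poly_abs_eq dest: monics_nonzero)

lemma poly_abs_monic_powr: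
  assumes "f \<in> monics"
  shows   "poly_abs (f :: 'a::finite_field poly) powr (- real r) = 1 / real CARD('a) ^ (r * degree f)"
proof -
  have "poly_abs f powr (- real r) = real CARD('a) powr (- (real r * real (degree f)))"
    using CARD_real_ge_2[where 'a='a] assms
    by (simp add: poly_abs_monic powr_realpow[symmetric] powr_powr mult.commute)
  thus ?thesis unfolding CARD_powr_neg .
qed

lemma zeta_summable:
  assumes r: "r \<ge> 2"
  shows   "(\<lambda>f. 1 / real CARD('a) ^ (r * degree f)) summable_on (monics :: 'a::finite_field poly set)"
proof -
  have q: "real CARD('a) > 1" by (rule CARD_real_gt_1)
  define C where "C = geom_const (real CARD('a)) (1 - real r)"
  show ?thesis
  proof (rule nonneg_bdd_above_summable_on)
    have "(\<Sum>f\<in>A. 1 / real CARD('a) ^ (r * degree f)) \<le> C * real CARD('a) powr ((1 - real r) * 0)"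
      if A: "A \<subseteq> monics" "finite A" for A :: "'a poly set"
    proof -
      have "(\<Sum>f\<in>A. 1 / real CARD('a) ^ (r * degree f)) =
          (\<Sum>n\<in>degree ` A. \<Sum>f | f \<in> A \<and> degree f = n. 1 / real CARD('a) ^ (r * degree f))"
        using A by (intro sum.group[symmetric]) auto
      also have "\<dots> = (\<Sum>n\<in>degree ` A. real (card {f \<in> A. degree f = n}) / real CARD('a) ^ (r * n))"
        by (intro sum.cong refl) simp
      also have "\<dots> \<le> (\<Sum>n\<in>degree ` A. real CARD('a) ^ n / real CARD('a) ^ (r * n))"
      proof (intro sum_mono divide_right_mono)
        fix n
        have "card {f \<in> A. degree f = n} \<le> card (monics_deg n :: 'a poly set)"
          by (rule card_mono[OF finite_monics_deg]) (use A in \<open>auto simp: monics_deg_def\<close>)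
        thus "real (card {f \<in> A. degree f = n}) \<le> real CARD('a) ^ n"
          unfolding card_monics_deg of_nat_power[symmetric] of_nat_le_iff .
      qed auto
      also have "\<dots> = (\<Sum>n\<in>degree ` A. real CARD('a) powr ((1 - real r) * real n))"
        using q by (intro sum.cong refl)
          (simp add: powr_realpow[symmetric] powr_diff[symmetric] algebra_simps)
      also have "\<dots> \<le> C * real CARD('a) powr ((1 - real r) * 0)"
        unfolding C_def using A r q by (intro geometric_sum_powr_le) (auto simp: mult_nonpos_nonneg)
      finally show ?thesis .
    qed
    thus "bdd_above (sum (\<lambda>f. 1 / real CARD('a) ^ (r * degree f)) ` {A. A \<subseteq> (monics :: 'a poly set) \<and> finite A})"
      by (intro bdd_aboveI2[of _ _ "C * real CARD('a) powr ((1 - real r) * 0)"]) auto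
  qed auto
qed

lemma zeta_ff_eq:
  "zeta_ff TYPE('a::finite_field) (real r) = (\<Sum>\<^sub>\<infinity>f\<in>(monics :: 'a poly set). 1 / real CARD('a) ^ (r * degree f))"
  unfolding zeta_ff_def by (intro infsum_cong poly_abs_monic_powr)

text \<open>Dirichlet convolution of the Moebius function with 1: one absolutely convergent double
  series is summed by rows and also along the products \<open>f = \<Prod>F * g\<close>.\<close>

lemma cF_empty:
  assumes r: "r \<ge> 2"
  shows   "cF r ({} :: 'a::finite_field poly set) * zeta_ff TYPE('a) (real r) = 1"
proof -
  define w where "w = (\<lambda>f :: 'a poly. 1 / real CARD('a) ^ (r * degree f))"
  define \<Psi> where "\<Psi> = (\<lambda>(F :: 'a poly set, g). moeb_wt r F * w g)"
  define Z where "Z = infsum w monics"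
  have w: "(w has_sum Z) monics" unfolding Z_def w_def by (intro has_sum_infsum zeta_summable r)
  have wabs: "(\<lambda>f. norm (w f)) summable_on monics"
    using zeta_summable[OF r, where 'a='a] by (simp add: w_def)
  have "(\<lambda>x. norm (\<Psi> x)) summable_on (Fs \<times> monics)"
    unfolding Infinite_Sum.abs_summable_on_Sigma_iff
  proof (intro conjI ballI)
    fix F :: "'a poly set"
    show "(\<lambda>y. norm (\<Psi> (F, y))) summable_on monics"
      using summable_on_cmult_right[OF wabs, of "\<bar>moeb_wt r F\<bar>"] by (simp add: \<Psi>_def abs_mult)
    have "(\<Sum>\<^sub>\<infinity>y\<in>monics. norm (\<Psi> (F, y))) = \<bar>moeb_wt r F\<bar> * (\<Sum>\<^sub>\<infinity>y\<in>monics. norm (w y))" for F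
      by (simp add: \<Psi>_def abs_mult infsum_cmult_right')
    thus "(\<lambda>F. norm (\<Sum>\<^sub>\<infinity>y\<in>monics. norm (\<Psi> (F, y)))) summable_on Fs"
      using summable_on_cmult_left[OF moeb_wt_summable(1)[OF r order.refl], of "\<bar>\<Sum>\<^sub>\<infinity>y\<in>monics. norm (w y)\<bar>"]
      by (simp add: abs_mult)
  qed
  hence "\<Psi> summable_on (Fs \<times> monics)" by (rule abs_summable_summable)
  then obtain S where S: "(\<Psi> has_sum S) (Fs \<times> monics)" by (auto simp: summable_on_def)
  have "((\<lambda>F. moeb_wt r F * Z) has_sum S) (Fs :: 'a poly set set)"
    by (rule has_sum_SigmaD[OF S]) (use has_sum_cmult_right[OF w] in \<open>simp add: \<Psi>_def\<close>)
  moreover have "((\<lambda>F. moeb_wt r F * Z) has_sum (cF r ({} :: 'a poly set) * Z)) (Fs :: 'a poly set set)"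
    unfolding cF_def using has_sum_infsum[OF moeb_wt_summable(2)[OF r order.refl, where 'a='a]]
    by (intro has_sum_cmult_left) simp
  ultimately have S1: "S = cF r ({} :: 'a poly set) * Z" using has_sum_unique by blast
  \<comment> \<open>The exponent 1 is kept so that \<open>sum_moebius\<close> applies to the inner
    sum, which vanishes unless \<open>f = 1\<close>.\<close>
  define Q where "Q = (SIGMA f:(monics :: 'a poly set). {F \<in> Fs. \<Prod>F ^ 1 dvd f})"
  define \<Phi> where "\<Phi> = (\<lambda>(f, F :: 'a poly set). (-1) ^ card F * w f)"
  have "bij_betw (\<lambda>(F, g). (\<Prod>F * g, F)) (Fs \<times> monics) Q"
  proof (rule bij_betwI')
    fix x y :: "'a poly set \<times> 'a poly" assume *: "x \<in> Fs \<times> monics" "y \<in> Fs \<times> monics"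
    thus "((case x of (F, g) \<Rightarrow> (\<Prod>F * g, F)) = (case y of (F, g) \<Rightarrow> (\<Prod>F * g, F))) = (x = y)"
      using monics_nonzero[OF prod_Fs_monics[of "fst x"]]
      by (cases x; cases y) auto
  next
    fix x :: "'a poly set \<times> 'a poly" assume "x \<in> Fs \<times> monics"
    thus "(case x of (F, g) \<Rightarrow> (\<Prod>F * g, F)) \<in> Q"
      by (auto simp: Q_def intro: monics_mult prod_Fs_monics)
  next
    fix y :: "'a poly \<times> 'a poly set" assume "y \<in> Q"
    then obtain f F where y: "y = (f, F)" "f \<in> monics" "F \<in> Fs" "\<Prod>F dvd f" by (auto simp: Q_def)
    then obtain g where "f = \<Prod>F * g" by (auto elim: dvdE)
    moreover from this have "g \<in> monics" using y monics_cancel prod_Fs_monics by metis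
    ultimately show "\<exists>x\<in>Fs \<times> monics. y = (case x of (F, g) \<Rightarrow> (\<Prod>F * g, F))"
      using y by (intro bexI[of _ "(F, g)"]) auto
  qed
  moreover have "\<Psi> x = \<Phi> (case x of (F, g) \<Rightarrow> (\<Prod>F * g, F))" if "x \<in> Fs \<times> monics" for x
    using that by (auto simp: \<Psi>_def \<Phi>_def w_def moeb_wt_def degree_monics_mult prod_Fs_monics degree_prod_Fs
        ring_distribs power_add)
  ultimately have "(\<Phi> has_sum S) Q"
    using S has_sum_reindex_bij_betw[of "\<lambda>(F, g). (\<Prod>F * g, F)" "Fs \<times> monics" Q \<Phi> S]
    by (simp cong: has_sum_cong)
  hence "((\<lambda>f. of_bool (f = 1)) has_sum S) (monics :: 'a poly set)"
    unfolding Q_def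
  proof (rule has_sum_SigmaD)
    fix f :: "'a poly" assume f: "f \<in> monics"
    hence f0: "f \<noteq> 0" by (rule monics_nonzero)
    have ne: "(\<forall>\<pi>\<in>Irr. \<not> \<pi> ^ 1 dvd f) \<longleftrightarrow> f = 1"
    proof
      assume "\<forall>\<pi>\<in>Irr. \<not> \<pi> ^ 1 dvd f"
      hence "degree f = 0" using Irr_dvd_exists[of f] by fastforce
      thus "f = 1" using f by (auto simp: monics_def elim!: degree_eq_zeroE)
    next
      assume "f = 1"
      thus "\<forall>\<pi>\<in>Irr. \<not> \<pi> ^ 1 dvd f" using Irr_prime by (auto dest: prime_elem_not_unit)
    qed
    have fin: "finite {F \<in> Fs. \<Prod>F ^ 1 dvd f}"
      by (rule finite_subset[OF _ finite_Fs_nd_le[of "degree f" "\<lambda>_. True"]])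
         (auto simp: degree_prod_Fs[symmetric] f0 dvd_imp_degree_le)
    have "(\<Sum>F\<in>{F \<in> Fs. \<Prod>F ^ 1 dvd f}. \<Phi> (f, F)) = of_bool (f = 1) * w f"
      using sum_moebius[OF f0 order.refl, where 'b=real] unfolding ne
      by (simp add: \<Phi>_def flip: sum_distrib_right)
    also have "\<dots> = of_bool (f = 1)" by (auto simp: w_def)
    finally show "((\<lambda>F. \<Phi> (f, F)) has_sum of_bool (f = 1)) {F \<in> Fs. \<Prod>F ^ 1 dvd f}"
      using has_sum_finite[OF fin, of "\<lambda>F. \<Phi> (f, F)"] by simp
  qed
  moreover have "((\<lambda>f. of_bool (f = 1)) has_sum (1::real)) (monics :: 'a poly set)"
  proof -
    have "((\<lambda>f. of_bool (f = 1)) has_sum (1::real)) {1 :: 'a poly}"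
      using has_sum_finite[of "{1 :: 'a poly}" "\<lambda>f. of_bool (f = 1) :: real"] by simp
    thus ?thesis
      by (subst has_sum_cong_neutral[of "{1}" _ _ "\<lambda>f. of_bool (f = 1)"]) auto
  qed
  ultimately have "S = 1" using has_sum_unique by blast
  thus ?thesis using S1 by (simp add: Z_def w_def zeta_ff_eq)
qed

lemma zeta_pos: "r \<ge> 2 \<Longrightarrow> zeta_ff TYPE('a::finite_field) (real r) > 0"
  using cF_empty[where 'a='a, of r] infsum_nonneg[of monics "\<lambda>f :: 'a poly. 1 / real CARD('a) ^ (r * degree f)"]
  unfolding zeta_ff_eq by (cases "infsum (\<lambda>f :: 'a poly. 1 / real CARD('a) ^ (r * degree f)) monics = 0") auto

text \<open>The number of fractions with denominator \<open>\<Prod>F\<^sup>r\<close> whose reduced denominator has radical \<open>\<Prod>F\<close>.\<close>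

definition jordan :: "nat \<Rightarrow> 'a::finite_field poly set \<Rightarrow> real" where
  "jordan r F = (\<Prod>\<pi>\<in>F. real CARD('a) ^ (r * degree \<pi>) - 1)"

lemma sum_jordan:
  assumes "F \<in> Fs"
  shows   "(\<Sum>G\<in>Pow F. jordan r G) = real CARD('a) ^ (r * nd (F :: 'a::finite_field poly set))"
proof -
  have "(\<Prod>\<pi>\<in>F. (real CARD('a) ^ (r * degree \<pi>) - 1) + 1) = (\<Sum>G\<in>Pow F. jordan r G)"
    by (subst prod_add) (use assms Fs_finite in \<open>auto simp: jordan_def\<close>)
  thus ?thesis by (simp add: nd_def power_sum sum_distrib_left)
qed

lemma jordan_pos: "r \<ge> 2 \<Longrightarrow> F \<in> Fs \<Longrightarrow> jordan r F > 0"
  unfolding jordan_def using Irr_power_gt_1 Fs_Irr by (intro prod_pos) fastforce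

lemma jordan_le:
  assumes "r \<ge> 2" "F \<in> Fs"
  shows   "jordan r F \<le> real CARD('a) ^ (r * nd (F :: 'a::finite_field poly set))"
proof -
  have "jordan r F \<le> (\<Sum>G\<in>Pow F. jordan r G)"
  proof (rule member_le_sum)
    show "jordan r G \<ge> 0" if "G \<in> Pow F - {F}" for G
      using that jordan_pos[OF assms(1) Fs_subset[OF assms(2), of G]] by simp
  qed (use assms Fs_finite in auto)
  thus ?thesis using sum_jordan assms by metis
qed

lemma abs_cF_eq:
  assumes r: "r \<ge> 2" and F: "F \<in> Fs"
  shows   "\<bar>cF r (F :: 'a::finite_field poly set)\<bar> = 1 / zeta_ff TYPE('a) (real r) / jordan r F"
proof -
  have "\<bar>\<Prod>\<pi>\<in>F. - 1 / (real CARD('a) ^ (r * degree \<pi>) - 1)\<bar> = 1 / jordan r F"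
  proof -
    have "\<bar>\<Prod>\<pi>\<in>F. - 1 / (real CARD('a) ^ (r * degree \<pi>) - 1)\<bar> =
        (\<Prod>\<pi>\<in>F. 1 / (real CARD('a) ^ (r * degree \<pi>) - 1))"
      unfolding abs_prod
    proof (rule prod.cong[OF refl])
      fix \<pi> assume "\<pi> \<in> F"
      hence "real CARD('a) ^ (r * degree \<pi>) > 1" using Irr_power_gt_1[OF r] Fs_Irr[OF F] by blast
      thus "\<bar>- 1 / (real CARD('a) ^ (r * degree \<pi>) - 1)\<bar> = 1 / (real CARD('a) ^ (r * degree \<pi>) - 1)"
        by (simp add: abs_divide)
    qed
    thus ?thesis by (simp add: jordan_def prod_dividef)
  qed
  moreover have "\<bar>cF r ({} :: 'a poly set)\<bar> = 1 / zeta_ff TYPE('a) (real r)"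
  proof -
    have "cF r ({} :: 'a poly set) = 1 / zeta_ff TYPE('a) (real r)"
      using cF_empty[where 'a='a, OF r] zeta_pos[where 'a='a, OF r] by (simp add: eq_divide_eq)
    thus ?thesis using zeta_pos[where 'a='a, OF r] by simp
  qed
  ultimately show ?thesis
    using cF_eq[OF r F] by (simp add: abs_mult)
qed

definition series_term :: "nat \<Rightarrow> real \<Rightarrow> 'a::finite_field poly set \<Rightarrow> real" where
  "series_term r k F = (\<Prod>\<pi>\<in>F. (poly_abs \<pi> ^ r - 1) powr (1 - k))"

text \<open>The left side is, apart from the power of \<open>q^N\<close>, what the denominators with
  radical \<open>\<Prod>F\<close> contribute to the moment of the model: the number of arcs times
  the \<open>k\<close>-th power of the coefficient. Since \<open>|cF r F|\<close> is the inverse of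
  \<open>zeta(r) * jordan r F\<close>, the power \<open>jordan^(1 - k)\<close> remains.\<close>

lemma jordan_cF_powr:
  assumes r: "r \<ge> 2" and F: "F \<in> Fs"
  shows   "jordan r F * \<bar>cF r (F :: 'a::finite_field poly set)\<bar> powr k =
             (1 / zeta_ff TYPE('a) (real r)) powr k * series_term r k F"
proof -
  have J: "jordan r F > 0" by (rule jordan_pos) fact+
  have "series_term r k F = jordan r F powr (1 - k)"
  proof -
    have "series_term r k F = (\<Prod>\<pi>\<in>F. (real CARD('a) ^ (r * degree \<pi>) - 1) powr (1 - k))"
      unfolding series_term_def using Fs_Irr[OF F]
      by (intro prod.cong refl) (auto simp: poly_abs_monic Irr_def mult.commute simp flip: power_mult)
    thus ?thesis unfolding jordan_def using Irr_power_gt_1[OF r] Fs_Irr[OF F]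
      by (subst prod_powr_distrib) (auto intro: less_imp_le)
  qed
  thus ?thesis unfolding abs_cF_eq[OF r F]
    using J zeta_pos[where 'a='a, OF r] by (simp add: powr_divide powr_diff powr_mult)
qed

text \<open>The weight of \<open>F\<close> is at most a constant times
  \<open>q^(-r(k - 1) nd F)\<close>. As there are up to \<open>q^n\<close> sets of degree
  \<open>n\<close>, convergence rests on \<open>r(k - 1) > 1\<close>, that is on k > 1 +
  1/r.\<close>

lemma main_weight_approx:
  fixes A :: "'a::finite_field poly set set"
  assumes r: "r \<ge> 2" and k: "real r * (k - 1) > 1"
  assumes A: "A \<subseteq> Fs" "finite A" "\<And>F. F \<in> Fs \<Longrightarrow> F \<notin> A \<Longrightarrow> y \<le> real (nd F)"
  shows   "\<bar>(\<Sum>F\<in>A. jordan r F * \<bar>cF r F\<bar> powr k) -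
             (1 / zeta_ff TYPE('a) (real r)) powr k * singular_series TYPE('a) r k\<bar>
             \<le> geom_const (real CARD('a)) (1 - real r) powr k *
               geom_const (real CARD('a)) (1 - real r * (k - 1)) *
               real CARD('a) powr ((1 - real r * (k - 1)) * y)"
proof -
  let ?q = "real CARD('a)"
  let ?W = "\<lambda>F :: 'a poly set. jordan r F * \<bar>cF r F\<bar> powr k"
  let ?z = "(1 / zeta_ff TYPE('a) (real r)) powr k"
  have q2: "?q \<ge> 2" by (rule CARD_real_ge_2)
  have "k > 1"
  proof (rule ccontr)
    assume "\<not> k > 1"
    hence "real r * (k - 1) \<le> 0" by (intro mult_nonneg_nonpos) auto
    thus False using k by simp
  qed
  define C1 where "C1 = geom_const ?q (1 - real r)"
  have C1: "C1 \<ge> 1" unfolding C1_def using r CARD_real_gt_1 by (intro geom_const_ge_1) auto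
  define C2 where "C2 = geom_const ?q (1 - real r * (k - 1))"
  have Wle: "?W F \<le> C1 powr k * ?q powr (- ((real r * (k - 1)) * real (nd F)))" if F: "F \<in> Fs" for F
  proof -
    have "\<bar>cF r F\<bar> * ?q ^ (r * nd F) \<le> C1" using cF_approx[OF r F, of "{}" 0] q2 by (simp add: C1_def)
    hence "\<bar>cF r F\<bar> \<le> C1 * ?q powr (- (real r * real (nd F)))"
      unfolding CARD_powr_neg using q2 by (simp add: field_simps)
    hence "\<bar>cF r F\<bar> powr k \<le> (C1 * ?q powr (- (real r * real (nd F)))) powr k"
      using \<open>k > 1\<close> by (intro powr_mono2) auto
    also have "\<dots> = C1 powr k * ?q powr (- (real r * real (nd F) * k))"
      using C1 by (simp add: powr_mult powr_powr)
    finally have "?W F \<le> ?q ^ (r * nd F) * (C1 powr k * ?q powr (- (real r * real (nd F) * k)))"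
      using jordan_le[OF r F] jordan_pos[OF r F] by (intro mult_mono) auto
    also have "?q ^ (r * nd F) = ?q powr (real r * real (nd F))"
      using q2 by (simp add: powr_realpow[symmetric])
    also have "?q powr (real r * real (nd F)) * (C1 powr k * ?q powr (- (real r * real (nd F) * k))) =
        C1 powr k * ?q powr (- ((real r * (k - 1)) * real (nd F)))"
      by (simp add: powr_add[symmetric] algebra_simps)
    finally show ?thesis .
  qed
  have W0: "?W F \<ge> 0" if "F \<in> Fs" for F using jordan_pos[OF r that] by simp
  have majsum: "(\<lambda>F. C1 powr k * ?q powr (- ((real r * (k - 1)) * real (nd F)))) summable_on A" if "A \<subseteq> Fs" for A :: "'a poly set set"
    by (intro summable_on_cmult_right Fs_summable k that)
  have Wsum: "?W summable_on A" if "A \<subseteq> Fs" for A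
    by (rule summable_on_comparison_test[OF majsum[OF that]]) (use that Wle W0 in auto)
  have z: "?z > 0" using zeta_pos[where 'a='a, OF r] by simp
  have "series_term r k F = ?W F / ?z" if "F \<in> Fs" for F :: "'a poly set"
    using jordan_cF_powr[OF r that, of k] z by simp
  hence "series_term r k summable_on (Fs :: 'a poly set set) \<longleftrightarrow> (\<lambda>F :: 'a poly set. ?W F * (1 / ?z)) summable_on Fs"
    by (intro summable_on_cong) simp
  hence "series_term r k summable_on (Fs :: 'a poly set set)"
    using summable_on_cmult_left[OF Wsum[OF order.refl], of "1 / ?z"] by blast
  then obtain S where S: "(series_term r k has_sum S) (Fs :: 'a poly set set)"
    by (auto simp: summable_on_def)
  have "((\<lambda>P. \<Prod>\<pi>\<in>P. 1 + (poly_abs \<pi> ^ r - 1) powr (1 - k)) \<longlongrightarrow> S)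
      (finite_subsets_at_top (Irr :: 'a poly set))"
  proof -
    \<comment> \<open>Every finite family in \<open>Fs\<close> is contained in the power set of some
      finite set of primes. Hence the partial products, multiplied out over subsets, converge to the
      unordered sum of all terms.\<close>
    have "filterlim Pow (finite_subsets_at_top (Fs :: 'a poly set set)) (finite_subsets_at_top Irr)"
      unfolding filterlim_finite_subsets_at_top
    proof (intro allI impI)
      fix X :: "'a poly set set" assume X: "finite X \<and> X \<subseteq> Fs"
      hence "finite (\<Union>X)" "\<Union>X \<subseteq> Irr" using Fs_finite by (auto simp: Fs_def)
      thus "\<forall>\<^sub>F P in finite_subsets_at_top Irr. finite (Pow P) \<and> X \<subseteq> Pow P \<and> Pow P \<subseteq> (Fs :: 'a poly set set)"
        unfolding eventually_finite_subsets_at_top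
        by (intro exI[of _ "\<Union>X"]) (auto simp: Fs_def intro: finite_subset)
    qed
    hence "((\<lambda>P. sum (series_term r k) (Pow P)) \<longlongrightarrow> S) (finite_subsets_at_top (Irr :: 'a poly set))"
      using S unfolding has_sum_def by (rule filterlim_compose[rotated])
    moreover have "\<forall>\<^sub>F P in finite_subsets_at_top (Irr :: 'a poly set). sum (series_term r k) (Pow P) =
        (\<Prod>\<pi>\<in>P. 1 + (poly_abs \<pi> ^ r - 1) powr (1 - k))"
    proof (rule eventually_finite_subsets_at_top_weakI)
      fix P :: "'a poly set" assume P: "finite P"
      have "(\<Prod>\<pi>\<in>P. (poly_abs \<pi> ^ r - 1) powr (1 - k) + 1) = sum (series_term r k) (Pow P)"
        by (subst prod_add[OF P]) (simp add: series_term_def)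
      thus "sum (series_term r k) (Pow P) = (\<Prod>\<pi>\<in>P. 1 + (poly_abs \<pi> ^ r - 1) powr (1 - k))"
        by (simp add: add.commute)
    qed
    ultimately show ?thesis by (rule Lim_transform_eventually)
  qed
  hence sing: "singular_series TYPE('a) r k = S"
    unfolding singular_series_def Irr_def[symmetric] by (intro tendsto_Lim) auto
  have Whas: "(?W has_sum (?z * S)) Fs"
    using has_sum_cmult_right[OF S, of ?z]
    by (rule has_sum_cong[THEN iffD1, rotated]) (simp add: jordan_cF_powr[OF r])
  have "infsum ?W (A \<union> (Fs - A)) = infsum ?W A + infsum ?W (Fs - A)"
    using A by (intro infsum_Un_disjoint Wsum) auto
  moreover have "A \<union> (Fs - A) = Fs" using A by auto
  ultimately have "?z * S = sum ?W A + infsum ?W (Fs - A)"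
    using infsumI[OF Whas] A by simp
  hence "\<bar>sum ?W A - ?z * S\<bar> = infsum ?W (Fs - A)"
    using infsum_nonneg[of "Fs - A" ?W] W0 by auto
  also have "\<dots> \<le> (\<Sum>\<^sub>\<infinity>F\<in>Fs - A. C1 powr k * ?q powr (- ((real r * (k - 1)) * real (nd F))))"
    using Wle by (intro infsum_mono Wsum majsum) auto
  also have "\<dots> = C1 powr k * (\<Sum>\<^sub>\<infinity>F\<in>Fs - A. ?q powr (- ((real r * (k - 1)) * real (nd F))))"
    by (rule infsum_cmult_right')
  also have "\<dots> \<le> C1 powr k * (C2 * ?q powr ((1 - real r * (k - 1)) * y))"
    unfolding C2_def using A k by (intro mult_left_mono Fs_tail_bound_infsum) auto
  finally show ?thesis unfolding sing C1_def[symmetric] C2_def[symmetric] by (simp add: mult.assoc)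
qed

section \<open>Approximation of the exponential sum\<close>

definition Ns :: "nat \<Rightarrow> nat \<Rightarrow> 'a::finite_field poly set set" where
  "Ns r n = {F \<in> Fs. r * nd F \<le> n}"

text \<open>At most one summand is nonzero because centres are unique. The form of a sum avoids
  choosing the centre, and gives 0 where there is none.\<close>

definition model :: "nat \<Rightarrow> nat \<Rightarrow> 'a::finite_field fls \<Rightarrow> complex" where
  "model r N \<alpha> = (\<Sum>F\<in>Ns r (N div 2). of_bool (centre r N \<alpha> F) *
     (of_real (cF r F * real CARD('a) ^ (r * nd F)) * T_star (N - r * nd F) (gm r F \<alpha>)))"

text \<open>Vacuously true when \<alpha> has no centre, so that there the whole exponential sum
  counts as error.\<close>

definition misaligned :: "nat \<Rightarrow> nat \<Rightarrow> 'a::finite_field fls \<Rightarrow> 'a poly set \<Rightarrow> bool" where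
  "misaligned r N \<alpha> G \<longleftrightarrow> (\<forall>F. centre r N \<alpha> F \<longrightarrow> \<not> aligned r \<alpha> F G)"

lemma finite_Ns: "r \<ge> 2 \<Longrightarrow> finite (Ns r n)"
  unfolding Ns_def by (rule finite_Fs_mult_nd_le) simp

lemma card_Ns_le:
  assumes "r \<ge> 2"
  shows   "real (card (Ns r n :: 'a::finite_field poly set set)) \<le> 2 * real CARD('a) powr (real n / real r)"
proof -
  have "real (card (Ns r n :: 'a poly set set)) = (\<Sum>F\<in>(Ns r n :: 'a poly set set). 1)" by simp
  also have "\<dots> \<le> (\<Sum>m\<in>{..n div r}. real CARD('a) ^ m * 1)"
  proof (rule sum_Fs_le)
    show "nd F \<in> {..n div r}" if "F \<in> Ns r n" for F :: "'a poly set"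
      using that assms by (auto simp: Ns_def less_eq_div_iff_mult_less_eq mult.commute)
  qed (use finite_Ns[OF assms] in \<open>auto simp: Ns_def\<close>)
  also have "\<dots> \<le> 2 * real CARD('a) ^ (n div r)"
    using sum_powers_le(2)[OF CARD_real_ge_2[where 'a='a], of "n div r"] by simp
  also have "real CARD('a) ^ (n div r) = real CARD('a) powr (real (n div r))"
    using CARD_real_gt_1[where 'a='a] by (simp add: powr_realpow)
  also have "\<dots> \<le> real CARD('a) powr (real n / real r)"
    using CARD_real_gt_1[where 'a='a] of_nat_div_le_of_nat[of n r] by (intro powr_mono) auto
  finally show ?thesis by simp
qed

lemma model_centre:
  assumes "r \<ge> 2" "centre r N \<alpha> F"
  shows   "model r N \<alpha> = of_real (cF r F * real CARD('a) ^ (r * nd F)) *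
             T_star (N - r * nd F) (gm r F (\<alpha> :: 'a::finite_field fls))"
proof -
  let ?t = "\<lambda>F. of_real (cF r F * real CARD('a) ^ (r * nd F)) * T_star (N - r * nd F) (gm r F \<alpha>)"
  have "F \<in> Ns r (N div 2)" using centreD[OF assms(2)] by (simp add: Ns_def)
  moreover have "of_bool (centre r N \<alpha> G) * ?t G = (if F = G then ?t G else 0)" for G
  proof (cases "F = G")
    case True
    thus ?thesis using assms(2) by simp
  next
    case False
    hence "\<not> centre r N \<alpha> G" using centre_unique[OF assms(2)] by blast
    thus ?thesis using False by simp
  qed
  ultimately show ?thesis
    unfolding model_def by (simp only: sum.delta'[OF finite_Ns[OF assms(1)]] if_True)
qed

lemma model_no_centre: "(\<And>F. \<not> centre r N \<alpha> F) \<Longrightarrow> model r N \<alpha> = 0"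
  by (simp add: model_def)

text \<open>Otherwise \<open>G\<close> would lie in \<open>Maj\<close>, contain the centre and be
  aligned with it. So the misaligned terms of small degree are at most
  \<open>q^(N div 2)\<close>.\<close>

lemma misaligned_not_frac_zero:
  assumes "misaligned r N \<alpha> G" "G \<in> Ns r (N div 2)"
  shows   "\<not> frac_zero (N div 2) (gm r G \<alpha>)"
proof
  assume "frac_zero (N div 2) (gm r G \<alpha>)"
  hence G: "G \<in> Maj r N \<alpha>" using assms by (auto simp: Maj_def Ns_def)
  then obtain F where F: "centre r N \<alpha> F" using ex_centre by blast
  have "F \<subseteq> G" using F G by (auto simp: centre_def)
  moreover have "r * nd (G - F) \<le> N div 2"
  proof -
    have "G \<in> Fs" "r * nd G \<le> N div 2" using assms(2) by (auto simp: Ns_def)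
    moreover from this have "nd (G - F) \<le> nd G" by (intro nd_mono Fs_finite) auto
    ultimately show ?thesis using mult_le_mono2[of "nd (G - F)" "nd G" r] by linarith
  qed
  hence "frac_zero (r * nd (G - F)) (gm r F \<alpha>)"
    using centreD(3)[OF F] by (rule frac_zero_mono[rotated])
  ultimately show False using assms(1) F by (auto simp: misaligned_def aligned_def)
qed

text \<open>Two losses, both O(q^(N/r)). If the centre vanishes to order \<open>j\<close>, the sets
  missing from the alignment have \<open>r * nd (G - F) \<ge> j\<close>; their relative weights add
  up to O(q^(-(1 - 1/r) j)), against a height O(q^j). Besides, each aligned term carries the
  constant \<open>1/(q - 1)\<close>.\<close>

lemma aligned_sum_approx:
  fixes \<alpha> :: "'a::finite_field fls"
  assumes r: "r \<ge> 2" and c: "centre r N \<alpha> F"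
  shows   "cmod ((\<Sum>G | G \<in> Ns r N \<and> aligned r \<alpha> F G. (-1) ^ card G * T_sum (N - r * nd G) (gm r G \<alpha>)) - model r N \<alpha>)
             \<le> (2 * geom_const (real CARD('a)) (1 - real r) + 2) * real CARD('a) powr (real N / real r)"
proof -
  define q where "q = real CARD('a)"
  have q: "q \<ge> 2" "q > 1" unfolding q_def using CARD_real_ge_2 CARD_real_gt_1 by auto
  define g where "g = geom_const q (1 - real r)"
  define M where "M = N - r * nd F"
  define \<gamma> where "\<gamma> = gm r F \<alpha>"
  define t where "t = T_star M \<gamma>"
  define Al where "Al = {G \<in> Ns r N. aligned r \<alpha> F G}"
  have F: "F \<in> Fs" "r * nd F \<le> N" using centreD[OF c] by auto
  obtain j where j: "N div 2 \<le> j" "j \<le> M" "frac_zero j \<gamma>" "j = M \<or> fls_nth \<gamma> (int j + 1) \<noteq> 0"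
    using T_star_cases[of "N div 2" \<gamma> M] centreD[OF c] unfolding \<gamma>_def M_def by metis
  have "finite Al" unfolding Al_def by (simp add: finite_Ns[OF r])
  moreover have "Al \<subseteq> {G \<in> Fs. F \<subseteq> G}" by (auto simp: Al_def Ns_def aligned_def)
  ultimately have Al: "finite Al" "Al \<subseteq> {G \<in> Fs. F \<subseteq> G}" by auto
  have nd: "r * nd G = r * nd F + r * nd (G - F)" if "G \<in> Fs" "F \<subseteq> G" for G
    using nd_Diff[OF Fs_finite[OF that(1)] that(2)] by (simp add: ring_distribs)
  have tG: "T_sum (N - r * nd G) (gm r G \<alpha>) = t / of_nat CARD('a) ^ (r * nd (G - F)) - 1 / (of_nat CARD('a) - 1)"
    if G: "G \<in> Al" for G
  proof -
    have G': "G \<in> Fs" "F \<subseteq> G" "r * nd G \<le> N" "frac_zero (r * nd (G - F)) \<gamma>"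
      using G by (auto simp: Al_def Ns_def aligned_def \<gamma>_def)
    have "N - r * nd G = M - r * nd (G - F)" "r * nd (G - F) \<le> M"
      using nd[OF G'(1,2)] G'(3) by (auto simp: M_def)
    moreover have "G - F \<in> Fs" using G' Fs_Diff by blast
    ultimately have "T_star (N - r * nd G) (gm r G \<alpha>) = t / of_nat CARD('a) ^ (r * nd (G - F))"
      using T_star_scale[of "\<Prod>(G - F) ^ r" "r * nd (G - F)" \<gamma> M] G'
      by (simp add: gm_split[OF G'(1,2)] \<gamma>_def t_def prod_Fs_power_monics degree_prod_Fs_power)
    thus ?thesis by (simp add: T_star_def algebra_simps)
  qed
  have y: "real j / real r \<le> real (nd (G - F))" if G: "G \<in> Fs" "F \<subseteq> G" "G \<notin> Al" for G
  proof -
    have "j \<le> r * nd (G - F)"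
    proof (cases "r * nd G \<le> N")
      case True
      hence "\<not> frac_zero (r * nd (G - F)) \<gamma>" using G by (auto simp: Al_def Ns_def aligned_def \<gamma>_def)
      thus ?thesis using j(3) frac_zero_mono nat_le_linear by blast
    next
      case False
      thus ?thesis using nd[OF G(1,2)] j(2) F(2) by (simp add: M_def)
    qed
    hence "real j \<le> real r * real (nd (G - F))" by (metis of_nat_le_iff of_nat_mult)
    thus ?thesis using r by (simp add: field_simps)
  qed
  have wt: "(-1) ^ card G / q ^ (r * nd (G - F)) = q ^ (r * nd F) * moeb_wt r G" if "G \<in> Al" for G
    using nd[of G] Al(2) that q by (auto simp: moeb_wt_def q_def power_add field_simps)
  define D where "D = cF r F - sum (moeb_wt r) Al"
  have "(\<Sum>G\<in>Al. (-1) ^ card G * T_sum (N - r * nd G) (gm r G \<alpha>)) =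
      (\<Sum>G\<in>Al. t * of_real ((-1) ^ card G / q ^ (r * nd (G - F))) - (-1) ^ card G / (of_nat CARD('a) - 1))"
    by (intro sum.cong refl) (simp add: tG q_def algebra_simps)
  also have "\<dots> = t * of_real (q ^ (r * nd F) * sum (moeb_wt r) Al) -
      (\<Sum>G\<in>Al. (-1) ^ card G / (of_nat CARD('a) - 1))"
    by (simp only: wt sum_subtractf sum_distrib_left of_real_sum cong: sum.cong)
  also have "\<dots> - model r N \<alpha> = - (t * of_real (D * q ^ (r * nd F))) -
      (\<Sum>G\<in>Al. (-1) ^ card G / (of_nat CARD('a) - 1))"
    unfolding model_centre[OF r c] t_def M_def \<gamma>_def D_def q_def by (simp add: algebra_simps)
  also have "cmod \<dots> \<le> cmod t * (\<bar>D\<bar> * q ^ (r * nd F)) + real (card Al)"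
  proof -
    have "cmod (\<Sum>G\<in>Al. (-1) ^ card G / (of_nat CARD('a) - 1)) \<le> (\<Sum>G\<in>Al. 1)"
      using norm_inverse_CARD_le[where 'a='a]
      by (intro order.trans[OF norm_sum] sum_mono) (simp add: norm_divide norm_power)
    moreover have "cmod (t * of_real (D * q ^ (r * nd F))) = cmod t * (\<bar>D\<bar> * q ^ (r * nd F))"
      using q by (simp add: norm_mult abs_mult norm_power)
    ultimately show ?thesis
      using norm_triangle_ineq4[of "- (t * of_real (D * q ^ (r * nd F)))" "\<Sum>G\<in>Al. (-1) ^ card G / (of_nat CARD('a) - 1)"]
      by simp
  qed
  also have "cmod t * (\<bar>D\<bar> * q ^ (r * nd F)) \<le> 2 * q powr real j * (g * q powr ((1 - real r) * (real j / real r)))"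
  proof (rule mult_mono)
    show "cmod t \<le> 2 * q powr real j"
      using norm_T_star_le[OF j(3,2,4)] q by (simp add: t_def q_def powr_realpow)
    show "\<bar>D\<bar> * q ^ (r * nd F) \<le> g * q powr ((1 - real r) * (real j / real r))"
      unfolding D_def q_def g_def by (rule cF_approx[OF r F(1) Al y])
  qed (use q in auto)
  also have "\<dots> = 2 * g * q powr (real j / real r)"
    using r by (simp add: powr_add[symmetric] field_simps)
  also have "\<dots> \<le> 2 * g * q powr (real N / real r)"
    using q r j(2) geom_const_ge_1[OF q(2), of "1 - real r"]
    by (intro mult_left_mono powr_mono divide_right_mono) (auto simp: M_def g_def)
  also have "real (card Al) \<le> real (card (Ns r N :: 'a poly set set))"
    using finite_Ns[OF r, where 'a='a] by (intro of_nat_mono card_mono) (auto simp: Al_def)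
  also have "\<dots> \<le> 2 * q powr (real N / real r)" unfolding q_def by (rule card_Ns_le[OF r])
  finally show ?thesis unfolding q_def[symmetric] g_def[symmetric] Al_def by (simp add: algebra_simps)
qed

lemma error_pointwise:
  fixes \<alpha> :: "'a::finite_field fls"
  assumes r: "r \<ge> 2"
  shows   "cmod (exp_sum r N \<alpha> - model r N \<alpha>)
             \<le> (2 * geom_const (real CARD('a)) (1 - real r) + 2) * real CARD('a) powr (real N / real r) +
               (\<Sum>G\<in>Ns r N. of_bool (misaligned r N \<alpha> G) * cmod (T_sum (N - r * nd G) (gm r G \<alpha>)))"
proof -
  let ?t = "\<lambda>G. (-1) ^ card G * T_sum (N - r * nd G) (gm r G \<alpha>) :: complex"
  let ?A = "{G \<in> Ns r N. \<not> misaligned r N \<alpha> G}"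
  let ?C = "(2 * geom_const (real CARD('a)) (1 - real r) + 2) * real CARD('a) powr (real N / real r)"
  have "1 \<le> geom_const (real CARD('a)) (1 - real r)"
    using r CARD_real_gt_1 by (intro geom_const_ge_1) auto
  hence C0: "?C \<ge> 0" by (intro mult_nonneg_nonneg) auto
  have "exp_sum r N \<alpha> = sum ?t (Ns r N)"
    using exp_sum_eq[of r N \<alpha>] r by (simp add: Ns_def)
  also have "\<dots> = sum ?t ?A + sum ?t {G \<in> Ns r N. misaligned r N \<alpha> G}"
    using finite_Ns[OF r, where 'a='a] by (subst sum.union_disjoint[symmetric]) (auto intro!: sum.cong)
  finally have eq: "exp_sum r N \<alpha> - model r N \<alpha> =
      (sum ?t ?A - model r N \<alpha>) + sum ?t {G \<in> Ns r N. misaligned r N \<alpha> G}" by simp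
  have "cmod (sum ?t ?A - model r N \<alpha>) \<le> ?C"
  proof (cases "\<exists>F. centre r N \<alpha> F")
    case True
    then obtain F where F: "centre r N \<alpha> F" by blast
    have "misaligned r N \<alpha> G \<longleftrightarrow> \<not> aligned r \<alpha> F G" for G
      unfolding misaligned_def using F centre_unique[OF F] by blast
    hence "?A = {G. G \<in> Ns r N \<and> aligned r \<alpha> F G}" by blast
    thus ?thesis using aligned_sum_approx[OF r F] by (simp only:)
  next
    case False
    hence "?A = {}" unfolding misaligned_def by blast
    moreover have "model r N \<alpha> = 0" using False by (intro model_no_centre) blast
    ultimately show ?thesis using C0 by (simp only: sum.empty) simp
  qed
  moreover have "cmod (sum ?t {G \<in> Ns r N. misaligned r N \<alpha> G}) \<le>
      (\<Sum>G\<in>{G \<in> Ns r N. misaligned r N \<alpha> G}. cmod (T_sum (N - r * nd G) (gm r G \<alpha>)))"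
    by (intro order.trans[OF norm_sum] sum_mono) (simp add: norm_mult norm_power)
  moreover have "\<dots> = (\<Sum>G\<in>Ns r N. of_bool (misaligned r N \<alpha> G) * cmod (T_sum (N - r * nd G) (gm r G \<alpha>)))"
    using finite_Ns[OF r, where 'a='a] by (intro sum.mono_neutral_cong_left) auto
  ultimately show ?thesis unfolding eq
    using norm_triangle_ineq[of "sum ?t ?A - model r N \<alpha>" "sum ?t {G \<in> Ns r N. misaligned r N \<alpha> G}"]
    by linarith
qed

text \<open>Misaligned sets with \<open>r * nd G \<le> N div 2\<close> give terms of size at most
  \<open>q^(N/2)\<close>, and there are O(q^(N/(2r))) of them. Beyond that, the trivial bound for
  the complete sums has tail O(q^(N - (1 - 1/r) N/2)). The two bounds agree, which explains the cut
  at \<open>N div 2\<close>.\<close>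

lemma error_sup:
  fixes \<alpha> :: "'a::finite_field fls"
  assumes r: "r \<ge> 2"
  shows   "cmod (exp_sum r N \<alpha> - model r N \<alpha>)
             \<le> (4 + 2 * geom_const (real CARD('a)) (1 - real r) * (1 + real CARD('a))) *
               real CARD('a) powr (real N * (1 + 1 / real r) / 2)"
proof -
  define q where "q = real CARD('a)"
  have q: "q \<ge> 2" "q > 1" unfolding q_def using CARD_real_ge_2 CARD_real_gt_1 by auto
  define g where "g = geom_const q (1 - real r)"
  have g: "g \<ge> 1" unfolding g_def using r q by (intro geom_const_ge_1) auto
  define H where "H = N div 2"
  define Q where "Q = q powr (real N * (1 + 1 / real r) / 2)"
  have H: "real H \<le> real N / 2" "real N / 2 - 1 / 2 \<le> real H" unfolding H_def by linarith+
  let ?T = "\<lambda>G. cmod (T_sum (N - r * nd G) (gm r G \<alpha>))"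
  define B where "B = {G \<in> Ns r N. misaligned r N \<alpha> G}"
  have B: "finite B" "B \<subseteq> Ns r N" by (auto simp: B_def finite_Ns[OF r])
  have "(\<Sum>G\<in>Ns r N. of_bool (misaligned r N \<alpha> G) * ?T G) = sum ?T B"
    unfolding B_def using finite_Ns[OF r, where 'a='a] by (intro sum.mono_neutral_cong_right) auto
  also have "\<dots> = sum ?T (B \<inter> Ns r H) + sum ?T (B - Ns r H)"
    using B by (simp add: sum.Int_Diff)
  also have "sum ?T (B \<inter> Ns r H) \<le> (\<Sum>G\<in>B \<inter> Ns r H. q ^ H)"
    unfolding q_def
    by (intro sum_mono norm_T_sum_le_not_frac_zero)
       (auto simp: B_def H_def dest: misaligned_not_frac_zero)
  also have "\<dots> \<le> 2 * q powr (real H / real r) * q ^ H"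
  proof -
    have "card (B \<inter> Ns r H) \<le> card (Ns r H :: 'a poly set set)"
      using finite_Ns[OF r, where 'a='a] by (intro card_mono) auto
    hence "real (card (B \<inter> Ns r H)) \<le> 2 * q powr (real H / real r)"
      using card_Ns_le[OF r, of H, where 'a='a] unfolding q_def by linarith
    thus ?thesis using q by (simp add: mult_right_mono)
  qed
  also have "\<dots> = 2 * q powr (real H * (1 + 1 / real r))"
    using q by (simp add: powr_realpow[symmetric] powr_add[symmetric] algebra_simps)
  also have "\<dots> \<le> 2 * Q"
    unfolding Q_def using q H(1) mult_right_mono[OF H(1), of "1 + 1 / real r"]
    by (intro mult_left_mono powr_mono) (auto simp: algebra_simps)
  also have "sum ?T (B - Ns r H) \<le> (\<Sum>G\<in>B - Ns r H. 2 * q ^ N * q powr (- (real r * real (nd G))))"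
  proof (intro sum_mono)
    fix G assume "G \<in> B - Ns r H"
    hence "r * nd G \<le> N" using B by (auto simp: Ns_def)
    have "?T G \<le> 2 * q ^ (N - r * nd G)" unfolding q_def by (rule norm_T_sum_le_trivial)
    also have "\<dots> = 2 * q ^ N * q powr (- (real r * real (nd G)))"
      using \<open>r * nd G \<le> N\<close> q unfolding q_def CARD_powr_neg by (simp add: power_diff)
    finally show "?T G \<le> 2 * q ^ N * q powr (- (real r * real (nd G)))" .
  qed
  also have "\<dots> = 2 * q ^ N * (\<Sum>G\<in>B - Ns r H. q powr (- (real r * real (nd G))))"
    by (rule sum_distrib_left[symmetric])
  also have "\<dots> \<le> 2 * q ^ N * (g * q powr ((1 - real r) * (real H / real r)))"
    unfolding g_def q_def
  proof (intro mult_left_mono Fs_tail_bound)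
    fix G assume G: "G \<in> B - Ns r H"
    hence "\<not> r * nd G \<le> H" using B by (auto simp: Ns_def)
    hence "real H \<le> real r * real (nd G)" by (metis nat_le_linear of_nat_le_iff of_nat_mult)
    thus "real H / real r \<le> real (nd G)" using r by (simp add: field_simps)
  qed (use B r in \<open>auto simp: Ns_def\<close>)
  also have "\<dots> = 2 * g * q powr (real N - (1 - 1 / real r) * real H)"
    using q r by (simp add: powr_realpow[symmetric] powr_add[symmetric] field_simps)
  \<comment> \<open>The additional 1 in the exponent pays for the rounding in
    \<open>N div 2\<close>.\<close>
  also have "\<dots> \<le> 2 * g * q powr (real N * (1 + 1 / real r) / 2 + 1)"
  proof (intro mult_left_mono powr_mono)
    have "real N - (1 - \<rho>) * real H \<le> real N * (1 + \<rho>) / 2 + 1" if "0 \<le> \<rho>" "\<rho> \<le> 1" for \<rho>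
    proof -
      have "(1 - \<rho>) * (real N / 2 - 1 / 2) \<le> (1 - \<rho>) * real H"
        using H that by (intro mult_left_mono) auto
      thus ?thesis using that by (simp add: field_simps)
    qed
    thus "real N - (1 - 1 / real r) * real H \<le> real N * (1 + 1 / real r) / 2 + 1"
      using r by simp
  qed (use q g in auto)
  also have "\<dots> = 2 * g * q * Q" using q by (simp add: Q_def powr_add)
  finally have "(\<Sum>G\<in>Ns r N. of_bool (misaligned r N \<alpha> G) * ?T G) \<le> 2 * Q + 2 * g * q * Q" by simp
  moreover have "(2 * g + 2) * q powr (real N / real r) \<le> (2 * g + 2) * Q"
  proof (intro mult_left_mono)
    have "real N * (1 / real r) \<le> real N * ((1 + 1 / real r) / 2)"
      using r by (intro mult_left_mono) (auto simp: field_simps)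
    thus "q powr (real N / real r) \<le> Q" unfolding Q_def using q by (intro powr_mono) auto
  qed (use g in auto)
  ultimately show ?thesis
    using error_pointwise[OF r, of N \<alpha>] unfolding q_def[symmetric] g_def[symmetric] Q_def[symmetric]
    by (simp add: algebra_simps)
qed

section \<open>Moments of the exponential sum\<close>

definition level_sum :: "nat \<Rightarrow> nat \<Rightarrow> nat \<Rightarrow> 'a::finite_field fls \<Rightarrow> complex" where
  "level_sum r N n \<alpha> = (\<Sum>F | F \<in> Fs \<and> nd F = n. (-1) ^ card F * T_sum (N - r * n) (gm r F \<alpha>))"

lemma finite_Fs_nd: "finite {F. F \<in> Fs \<and> nd F = n}"
  using finite_Fs_nd_eq[of n "\<lambda>_. True"] by simp

lemma card_Fs_nd: "real (card {F. F \<in> Fs \<and> nd (F :: 'a::finite_field poly set) = n}) \<le> real CARD('a) ^ n"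
proof -
  have "card {F. F \<in> Fs \<and> nd (F :: 'a poly set) = n} \<le> CARD('a) ^ n"
    using card_Fs_nd_eq[where 'a='a, of n "\<lambda>_. True"] by simp
  thus ?thesis unfolding of_nat_power[symmetric] of_nat_le_iff .
qed

lemma Ns_nd_le_div:
  assumes "r \<ge> 2" "F \<in> Ns r n"
  shows   "nd F \<le> n div r"
  using assms by (simp add: Ns_def less_eq_div_iff_mult_less_eq mult.commute)

lemma exp_sum_eq_levels:
  assumes r: "r \<ge> 2"
  shows   "exp_sum r N (\<alpha> :: 'a::finite_field fls) = (\<Sum>n\<le>N div r. level_sum r N n \<alpha>)"
proof -
  have r0: "r > 0" using r by simp
  have "exp_sum r N \<alpha> = (\<Sum>F\<in>Ns r N. (-1) ^ card F * T_sum (N - r * nd F) (gm r F \<alpha>))"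
    using exp_sum_eq[of r N \<alpha>] r by (simp add: Ns_def)
  also have "\<dots> = (\<Sum>n\<in>{..N div r}. \<Sum>F | F \<in> Ns r N \<and> nd F = n. (-1) ^ card F * T_sum (N - r * nd F) (gm r F \<alpha>))"
    using finite_Ns[OF r, where 'a='a] Ns_nd_le_div[OF r] by (intro sum.group[symmetric]) auto
  also have "\<dots> = (\<Sum>n\<le>N div r. level_sum r N n \<alpha>)"
    unfolding level_sum_def
  proof (rule sum.cong[OF refl], rule sum.cong)
    fix n assume "n \<in> {..N div r}"
    hence "r * n \<le> N" using r0 by (simp add: less_eq_div_iff_mult_less_eq mult.commute)
    thus "{F. F \<in> Ns r N \<and> nd F = n} = {F :: 'a poly set. F \<in> Fs \<and> nd F = n}"
      by (auto simp: Ns_def)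
  qed simp
  finally show ?thesis .
qed

text \<open>The event \<open>frac_zero m\<close> has probability \<open>q^(-m)\<close> and cancels
  the factor \<open>q^m\<close>, so every complete sum has mean absolute value at most
  \<open>N + 1\<close>.\<close>

lemma av_level_sum_le:
  assumes "r * n \<le> N"
  shows   "av N (\<lambda>\<alpha> :: 'a::finite_field fls. cmod (level_sum r N n \<alpha>)) \<le> real CARD('a) ^ n * (real N + 1)"
proof -
  define q where "q = real CARD('a)"
  have q: "q > 1" unfolding q_def by (rule CARD_real_gt_1)
  let ?A = "{F :: 'a poly set. F \<in> Fs \<and> nd F = n}"
  have "av N (\<lambda>\<alpha> :: 'a fls. cmod (level_sum r N n \<alpha>)) \<le>
      av N (\<lambda>\<alpha>. \<Sum>F\<in>?A. \<Sum>m\<le>N - r * n. q ^ m * of_bool (frac_zero m (gm r F \<alpha>)))"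
  proof (rule av_mono)
    fix \<alpha> :: "'a fls"
    have "cmod (level_sum r N n \<alpha>) \<le> (\<Sum>F\<in>?A. cmod (T_sum (N - r * n) (gm r F \<alpha>)))"
      unfolding level_sum_def by (intro order.trans[OF norm_sum] sum_mono) (simp add: norm_mult norm_power)
    also have "\<dots> \<le> (\<Sum>F\<in>?A. \<Sum>m\<le>N - r * n. q ^ m * of_bool (frac_zero m (gm r F \<alpha>)))"
      unfolding q_def by (intro sum_mono norm_T_sum_le)
    finally show "cmod (level_sum r N n \<alpha>) \<le> (\<Sum>F\<in>?A. \<Sum>m\<le>N - r * n. q ^ m * of_bool (frac_zero m (gm r F \<alpha>)))" .
  qed
  also have "\<dots> = (\<Sum>F\<in>?A. \<Sum>m\<le>N - r * n. q ^ m * av N (\<lambda>\<alpha>. of_bool (frac_zero m (gm r F \<alpha>))))"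
    by (simp only: av_sum av_cmult)
  also have "\<dots> = (\<Sum>F\<in>?A. \<Sum>m\<le>N - r * n. 1)"
  proof (rule sum.cong[OF refl], rule sum.cong[OF refl])
    fix F :: "'a poly set" and m assume F: "F \<in> ?A" and m: "m \<in> {..N - r * n}"
    hence "m + r * nd F \<le> N + 1" using assms by auto
    hence "av N (\<lambda>\<alpha>. of_bool (frac_zero m (gm r F \<alpha>))) = 1 / q ^ m"
      unfolding q_def using F by (intro av_frac_zero_gm) auto
    thus "q ^ m * av N (\<lambda>\<alpha>. of_bool (frac_zero m (gm r F \<alpha>))) = 1" using q by simp
  qed
  also have "\<dots> = real (card ?A) * real (N - r * n + 1)" by simp
  also have "\<dots> \<le> q ^ n * (real N + 1)"
    using card_Fs_nd[where 'a='a, of n] unfolding q_def by (intro mult_mono) auto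
  finally show ?thesis unfolding q_def .
qed

lemma card_monics_le: "real (card (monics_le M :: 'a::finite_field poly set)) \<le> 2 * real CARD('a) ^ M"
proof -
  have "card (monics_le M :: 'a poly set) = (\<Sum>m\<le>M. card (monics_deg m :: 'a poly set))"
    unfolding monics_le_UN by (rule card_UN_disjoint) (simp_all, auto simp: monics_deg_def)
  hence "real (card (monics_le M :: 'a poly set)) = (\<Sum>m\<le>M. real CARD('a) ^ m)"
    by (simp add: card_monics_deg)
  thus ?thesis using sum_powers_le(2)[OF CARD_real_ge_2[where 'a='a], of M] by simp
qed

text \<open>The equation forces \<open>\<Prod>(G - F) ^ r\<close> to divide \<open>g\<close>, and
  \<open>g\<close> determines \<open>h\<close>.\<close>

lemma card_equal_multiples_le:
  fixes F G :: "'a::finite_field poly set"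
  assumes FG: "F \<in> Fs" "G \<in> Fs"
  shows   "real (card {(g, h) \<in> monics_le M \<times> monics_le M. g * \<Prod>F ^ r = h * \<Prod>G ^ r})
             \<le> 2 * real CARD('a) ^ M / real CARD('a) ^ (r * nd (G - F))"
proof -
  define u v w where "u = \<Prod>(F - G) ^ r" and "v = \<Prod>(G - F) ^ r" and "w = \<Prod>(F \<inter> G) ^ r"
  define S where "S = {(g, h) \<in> monics_le M \<times> monics_le M. g * \<Prod>F ^ r = h * \<Prod>G ^ r}"
  have nz: "w \<noteq> 0" "\<Prod>G ^ r \<noteq> 0" unfolding w_def
    by (rule monics_nonzero[OF prod_Fs_power_monics]; use FG Fs_Int in blast)+
  have v: "v \<in> monics" "degree v = r * nd (G - F)"
    unfolding v_def using FG Fs_Diff by (auto intro!: prod_Fs_power_monics degree_prod_Fs_power)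
  have sets: "F - F \<inter> G = F - G" "G - F \<inter> G = G - F" by auto
  have uw: "\<Prod>F ^ r = u * w" "\<Prod>G ^ r = v * w" unfolding u_def v_def w_def
    using prod_Fs_power_split[OF FG(1), of "F \<inter> G" r] prod_Fs_power_split[OF FG(2), of "F \<inter> G" r]
    by (auto simp: sets)
  have "inj_on fst S"
  proof (rule inj_onI)
    fix x y assume "x \<in> S" "y \<in> S" "fst x = fst y"
    thus "x = y" using nz(2) by (cases x; cases y) (auto simp: S_def)
  qed
  moreover have "fst ` S \<subseteq> {g \<in> monics_le M. v dvd g}"
  proof safe
    fix g h assume gh: "(g, h) \<in> S"
    hence "(g * u) * w = (h * v) * w" using uw by (auto simp: S_def mult.assoc)
    hence "u * g = v * h" using nz(1) by (simp add: mult.commute)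
    hence "v dvd u * g" by simp
    hence "v dvd g" unfolding u_def v_def
      by (rule prod_Fs_power_coprime[rotated -1]) (use FG Fs_Diff in auto)
    thus "v dvd fst (g, h)" by simp
  qed (auto simp: S_def)
  ultimately have "card S \<le> card {g \<in> monics_le M. v dvd g}"
    by (intro card_inj_on_le) auto
  also have "real \<dots> \<le> 2 * real CARD('a) ^ M / real CARD('a) ^ (r * nd (G - F))"
  proof (cases "degree v \<le> M")
    case True
    have "card {g \<in> monics_le M. v dvd g} = card (monics_le (M - degree v) :: 'a poly set)"
      using bij_betw_same_card[OF bij_betw_monics_multiples[OF v(1) True]] by simp
    also have "real \<dots> \<le> 2 * real CARD('a) ^ (M - degree v)" by (rule card_monics_le)
    also have "\<dots> = 2 * real CARD('a) ^ M / real CARD('a) ^ (r * nd (G - F))"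
      using True v(2) by (simp add: power_diff)
    finally show ?thesis .
  next
    case False
    have "degree v \<le> M" if "g \<in> monics_le M" "v dvd g" for g
      using dvd_imp_degree_le[OF that(2)] that(1) monics_nonzero[of g] by (auto simp: monics_le_def)
    hence *: "{g \<in> monics_le M. v dvd g} = {}" using False by blast
    show ?thesis unfolding * by simp
  qed
  finally show ?thesis unfolding S_def by simp
qed

text \<open>Both \<open>F\<close> and \<open>G\<close> are recorded by their intersection and the two differences; since
  \<open>r \<ge> 2\<close> the weight outweighs the number of choices for the differences.\<close>

lemma sum_pairs_le:
  assumes r: "r \<ge> 2"
  shows   "(\<Sum>F | F \<in> Fs \<and> nd F = n. \<Sum>G | G \<in> Fs \<and> nd G = n.
             1 / real CARD('a) ^ (r * nd (G - F :: 'a::finite_field poly set))) \<le> 2 * real CARD('a) ^ n"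
proof -
  define q where "q = real CARD('a)"
  have q: "q \<ge> 2" unfolding q_def by (rule CARD_real_ge_2)
  define A where "A m = {F :: 'a poly set. F \<in> Fs \<and> nd F = m}" for m
  define I where "I = {F :: 'a poly set. F \<in> Fs \<and> nd F \<le> n}"
  define X where "X = (SIGMA E:I. A (n - nd E) \<times> A (n - nd E))"
  define \<phi> where "\<phi> = (\<lambda>(F, G). (F \<inter> G, F - G, G - F :: 'a poly set))"
  have fin: "finite (A m)" "finite I" for m
    using finite_Fs_nd finite_Fs_nd_le[of n "\<lambda>_. True"] by (auto simp: A_def I_def)
  have ndI: "nd G = nd (F \<inter> G) + nd (G - F)" if "G \<in> Fs" for F G :: "'a poly set"
    using nd_Diff[OF Fs_finite[OF that], of "F \<inter> G"] by (simp add: Diff_Int)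
  have inj: "inj_on \<phi> (A n \<times> A n)"
  proof (rule inj_onI)
    fix x y assume "x \<in> A n \<times> A n" "y \<in> A n \<times> A n" and eq: "\<phi> x = \<phi> y"
    from eq have "fst x \<inter> snd x = fst y \<inter> snd y" "fst x - snd x = fst y - snd y" "snd x - fst x = snd y - fst y"
      by (auto simp: \<phi>_def split: prod.splits)
    hence "fst x = fst y" "snd x = snd y" by blast+
    thus "x = y" by (rule prod_eqI)
  qed
  have sub: "\<phi> ` (A n \<times> A n) \<subseteq> X"
  proof (rule image_subsetI)
    fix z assume "z \<in> A n \<times> A n"
    then obtain F G where z: "z = (F, G)" and FG: "F \<in> A n" "G \<in> A n" by blast
    from FG have "nd (G - F) = n - nd (F \<inter> G)" "nd (F - G) = n - nd (F \<inter> G)" "nd (F \<inter> G) \<le> n"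
      using ndI[of G F] ndI[of F G] by (auto simp: A_def Int_commute)
    thus "\<phi> z \<in> X" unfolding z using FG by (auto simp: \<phi>_def X_def I_def A_def intro: Fs_Int Fs_Diff)
  qed
  have "(\<Sum>F\<in>A n. \<Sum>G\<in>A n. 1 / q ^ (r * nd (G - F))) =
      (\<Sum>x\<in>A n \<times> A n. (\<lambda>(E, B, C). 1 / q ^ (r * nd C)) (\<phi> x))"
    by (simp add: sum.cartesian_product \<phi>_def split_def)
  also have "\<dots> = (\<Sum>y\<in>\<phi> ` (A n \<times> A n). (\<lambda>(E, B, C). 1 / q ^ (r * nd C)) y)"
    by (simp add: sum.reindex[OF inj] o_def)
  also have "\<dots> \<le> (\<Sum>y\<in>X. (\<lambda>(E, B, C). 1 / q ^ (r * nd C)) y)"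
    using fin q sub by (intro sum_mono2) (auto simp: X_def)
  also have "\<dots> = (\<Sum>E\<in>I. \<Sum>y\<in>A (n - nd E) \<times> A (n - nd E). 1 / q ^ (r * nd (snd y)))"
    unfolding X_def using fin by (subst sum.Sigma) (auto simp: split_def)
  also have "\<dots> \<le> (\<Sum>E\<in>I. 1)"
  proof (rule sum_mono)
    fix E
    define m where "m = n - nd E"
    have "(\<Sum>y\<in>A m \<times> A m. 1 / q ^ (r * nd (snd y))) = (\<Sum>y\<in>A m \<times> A m. 1 / q ^ (r * m))"
      by (intro sum.cong refl) (auto simp: A_def)
    also have "\<dots> = real (card (A m)) * real (card (A m)) / q ^ (r * m)" by (simp add: card_cartesian_product)
    also have "\<dots> \<le> q ^ m * q ^ m / q ^ (r * m)"
      using card_Fs_nd[where 'a='a, of m] q unfolding A_def q_def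
      by (intro divide_right_mono mult_mono) auto
    also have "q ^ m * q ^ m = q ^ (2 * m)" by (simp add: power_add[symmetric] mult_2)
    also have "q ^ (2 * m) \<le> q ^ (r * m)" using q r by (intro power_increasing) auto
    hence "q ^ (2 * m) / q ^ (r * m) \<le> 1" using q by simp
    finally show "(\<Sum>y\<in>A (n - nd E) \<times> A (n - nd E). 1 / q ^ (r * nd (snd y))) \<le> 1" unfolding m_def .
  qed
  also have "\<dots> \<le> (\<Sum>m\<in>{..n}. q ^ m * 1)"
    unfolding q_def using fin by (intro sum_Fs_le) (auto simp: I_def)
  also have "\<dots> \<le> 2 * q ^ n" using sum_powers_le(2)[OF q, of n] by simp
  finally show ?thesis unfolding A_def q_def .
qed

text \<open>By Parseval this counts the coincidences
  \<open>g * \<Prod>F ^ r = h * \<Prod>G ^ r\<close>. The bound has the order of the diagonal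
  \<open>F = G\<close>; the other pairs cost a constant factor.\<close>

lemma av_level_sum_square_le:
  assumes r: "r \<ge> 2" and n: "r * n \<le> N"
  shows   "av N (\<lambda>\<alpha> :: 'a::finite_field fls. (cmod (level_sum r N n \<alpha>))\<^sup>2)
             \<le> 4 * real CARD('a) ^ (N - r * n) * real CARD('a) ^ n"
proof -
  define q where "q = real CARD('a)"
  define M where "M = N - r * n"
  let ?A = "{F :: 'a poly set. F \<in> Fs \<and> nd F = n}"
  define X where "X = ?A \<times> (monics_le M :: 'a poly set)"
  define f where "f = (\<lambda>(F :: 'a poly set, g). g * \<Prod>F ^ r)"
  define e where "e = (\<lambda>(F :: 'a poly set, g :: 'a poly). (-1) ^ card F :: complex)"
  have finX: "finite X" unfolding X_def using finite_Fs_nd by blast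
  have lev: "level_sum r N n \<alpha> = (\<Sum>x\<in>X. e x * laurent_char (poly_to_laurent (f x) * \<alpha>))" for \<alpha> :: "'a fls"
    unfolding level_sum_def T_sum_def gm_def X_def M_def sum_distrib_left sum.cartesian_product e_def f_def
    by (intro sum.cong refl) (auto simp: poly_to_laurent_mult mult.assoc)
  have fX: "f x \<in> Pol (N + 1)" if x: "x \<in> X" for x
  proof -
    obtain F g where x': "x = (F, g)" "F \<in> Fs" "nd F = n" "g \<in> monics" "degree g \<le> M"
      using x by (auto simp: X_def monics_le_def)
    hence "degree (f x) \<le> N"
      using n by (simp add: f_def degree_monics_mult prod_Fs_power_monics degree_prod_Fs_power M_def)
    thus ?thesis using Pol_degree_le by auto
  qed
  have "av N (\<lambda>\<alpha> :: 'a fls. (cmod (level_sum r N n \<alpha>))\<^sup>2) \<le> real (card {(x, y) \<in> X \<times> X. f x = f y})"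
    unfolding lev
    by (rule av_parseval_le[OF finX fX]) (auto simp: e_def norm_power split: prod.splits)
  also have "card {(x, y) \<in> X \<times> X. f x = f y} =
      card (SIGMA F:?A. SIGMA G:?A. {(g, h) \<in> monics_le M \<times> monics_le M. g * \<Prod>F ^ r = h * \<Prod>G ^ r})"
    by (rule bij_betw_same_card[of "\<lambda>((F, g), (G, h)). (F, G, g, h)"],
        rule bij_betwI[where g = "\<lambda>(F, G, g, h). ((F, g), (G, h))"])
       (auto simp: X_def f_def)
  also have "\<dots> = (\<Sum>F\<in>?A. \<Sum>G\<in>?A. card {(g, h) \<in> monics_le M \<times> monics_le M. g * \<Prod>F ^ r = h * \<Prod>G ^ r})"
  proof -
    have fin: "finite {(g, h) \<in> monics_le M \<times> monics_le M. g * \<Prod>F ^ r = h * \<Prod>G ^ r}" for F G :: "'a poly set"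
      by (rule finite_subset[of _ "monics_le M \<times> monics_le M"]) auto
    have "card (SIGMA G:?A. {(g, h) \<in> monics_le M \<times> monics_le M. g * \<Prod>F ^ r = h * \<Prod>G ^ r}) =
        (\<Sum>G\<in>?A. card {(g, h) \<in> monics_le M \<times> monics_le M. g * \<Prod>F ^ r = h * \<Prod>G ^ r})" for F :: "'a poly set"
      using fin by (intro card_SigmaI finite_Fs_nd ballI)
    moreover have "finite (SIGMA G:?A. {(g, h) \<in> monics_le M \<times> monics_le M. g * \<Prod>F ^ r = h * \<Prod>G ^ r})"
      for F :: "'a poly set"
      using fin by (intro finite_SigmaI finite_Fs_nd)
    ultimately show ?thesis
      by (subst card_SigmaI[OF finite_Fs_nd]) (simp_all only: ball_triv simp_thms)
  qed
  also have "real \<dots> \<le> (\<Sum>F\<in>?A. \<Sum>G\<in>?A. 2 * q ^ M * (1 / q ^ (r * nd (G - F))))"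
    unfolding of_nat_sum q_def
  proof (intro sum_mono)
    fix F G :: "'a poly set" assume "F \<in> ?A" "G \<in> ?A"
    hence "F \<in> Fs" "G \<in> Fs" by auto
    from card_equal_multiples_le[OF this, of M r]
    show "real (card {(g, h) \<in> monics_le M \<times> monics_le M. g * \<Prod>F ^ r = h * \<Prod>G ^ r}) \<le>
        2 * real CARD('a) ^ M * (1 / real CARD('a) ^ (r * nd (G - F)))" by simp
  qed
  also have "\<dots> = 2 * q ^ M * (\<Sum>F\<in>?A. \<Sum>G\<in>?A. 1 / q ^ (r * nd (G - F)))"
    by (simp only: sum_distrib_left)
  also have "\<dots> \<le> 2 * q ^ M * (2 * q ^ n)"
    unfolding q_def by (intro mult_left_mono sum_pairs_le[OF r]) auto
  finally show ?thesis unfolding q_def M_def by simp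
qed

section \<open>Interpolation between the first and the second moment\<close>

lemma powr_interpolate:
  fixes s t \<rho> :: real
  assumes "s \<ge> 0" "t > 0" "0 \<le> \<rho>" "\<rho> \<le> 1"
  shows   "s powr (1 + \<rho>) \<le> t powr \<rho> * s + t powr (\<rho> - 1) * s\<^sup>2"
proof (cases "s \<le> t")
  case True
  have "s powr (1 + \<rho>) = s * s powr \<rho>" using assms by (simp add: powr_add)
  also have "\<dots> \<le> s * t powr \<rho>" using True assms by (intro mult_left_mono powr_mono2) auto
  also have "\<dots> \<le> t powr \<rho> * s + t powr (\<rho> - 1) * s\<^sup>2" by (simp add: mult.commute)
  finally show ?thesis .
next
  case False
  hence s: "s > 0" "t < s" using assms by auto
  have "s powr (1 + \<rho>) = s powr 2 * s powr (\<rho> - 1)" by (simp add: powr_add[symmetric])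
  also have "s powr 2 = s\<^sup>2" using s by (simp add: powr_numeral)
  also have "s\<^sup>2 * s powr (\<rho> - 1) \<le> s\<^sup>2 * t powr (\<rho> - 1)"
    using s assms by (intro mult_left_mono powr_mono2') auto
  also have "\<dots> \<le> t powr \<rho> * s + t powr (\<rho> - 1) * s\<^sup>2"
    using assms by (simp add: mult.commute)
  finally show ?thesis .
qed

text \<open>Crude in the number of terms, but it is applied to O(N) levels and the resulting power
  of \<open>N\<close> is absorbed later.\<close>

lemma norm_sum_powr_le:
  fixes a :: "'b \<Rightarrow> complex"
  assumes "finite I" "p \<ge> 0"
  shows   "cmod (\<Sum>i\<in>I. a i) powr p \<le> real (card I) powr p * (\<Sum>i\<in>I. cmod (a i) powr p)"
proof (cases "I = {}")
  case False
  define m where "m = Max ((\<lambda>i. cmod (a i)) ` I)"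
  have "m \<in> (\<lambda>i. cmod (a i)) ` I" unfolding m_def using assms False by (intro Max_in) auto
  then obtain i where i: "i \<in> I" "m = cmod (a i)" by auto
  have "cmod (\<Sum>i\<in>I. a i) \<le> (\<Sum>i\<in>I. m)"
    using assms(1) by (intro order.trans[OF norm_sum] sum_mono) (auto simp: m_def)
  hence "cmod (\<Sum>i\<in>I. a i) powr p \<le> (real (card I) * m) powr p"
    using assms by (intro powr_mono2) auto
  also have "\<dots> = real (card I) powr p * m powr p" using i by (simp add: powr_mult)
  also have "m powr p \<le> (\<Sum>i\<in>I. cmod (a i) powr p)"
    unfolding i(2) using i(1) assms by (intro member_le_sum) auto
  finally show ?thesis by (simp add: mult_left_mono)
qed simp

lemma av_level_sum_powr_le:
  assumes r: "r \<ge> 2" and n: "r * n \<le> N"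
  shows   "av N (\<lambda>\<alpha> :: 'a::finite_field fls. cmod (level_sum r N n \<alpha>) powr (1 + 1 / real r))
             \<le> (real N + 5) * real CARD('a) powr (real N / real r)"
proof -
  define q where "q = real CARD('a)"
  have q: "q > 1" unfolding q_def by (rule CARD_real_gt_1)
  define M where "M = N - r * n"
  define \<rho> where "\<rho> = 1 / real r"
  have \<rho>: "0 \<le> \<rho>" "\<rho> \<le> 1" using r by (auto simp: \<rho>_def)
  \<comment> \<open>Up to a factor polynomial in \<open>N\<close>, the quotient of the bounds for
    the second and the first moment; at this threshold both parts of the interpolation have the same
    size.\<close>
  define t where "t = q ^ M"
  have t: "t > 0" "t = q powr real M" using q by (auto simp: t_def powr_realpow)
  have M: "real M * \<rho> + real n = real N * \<rho>"
    using r n by (simp add: M_def of_nat_diff \<rho>_def field_simps)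
  have "av N (\<lambda>\<alpha> :: 'a fls. cmod (level_sum r N n \<alpha>) powr (1 + \<rho>)) \<le>
     av N (\<lambda>\<alpha> :: 'a fls. t powr \<rho> * cmod (level_sum r N n \<alpha>) + t powr (\<rho> - 1) * (cmod (level_sum r N n \<alpha>))\<^sup>2)"
    using t \<rho> by (intro av_mono powr_interpolate) auto
  also have "\<dots> = t powr \<rho> * av N (\<lambda>\<alpha> :: 'a fls. cmod (level_sum r N n \<alpha>)) +
     t powr (\<rho> - 1) * av N (\<lambda>\<alpha> :: 'a fls. (cmod (level_sum r N n \<alpha>))\<^sup>2)"
    by (simp only: av_add av_cmult)
  also have "\<dots> \<le> t powr \<rho> * (q ^ n * (real N + 1)) + t powr (\<rho> - 1) * (4 * t * q ^ n)"
    unfolding q_def t_def M_def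
    by (intro add_mono mult_left_mono av_level_sum_le[OF n] av_level_sum_square_le[OF r n]) auto
  also have "t powr (\<rho> - 1) * (4 * t * q ^ n) = t powr \<rho> * q ^ n * 4"
    using t(1) by (simp add: powr_diff)
  also have "t powr \<rho> * (q ^ n * (real N + 1)) + t powr \<rho> * q ^ n * 4 = (real N + 5) * (t powr \<rho> * q ^ n)"
    by (simp add: algebra_simps)
  also have "t powr \<rho> * q ^ n = q powr (real N * \<rho>)"
    using q by (simp add: t(2) powr_powr powr_realpow[symmetric] powr_add[symmetric] M)
  finally show ?thesis by (simp add: q_def \<rho>_def)
qed

lemma av_exp_sum_powr_le:
  assumes r: "r \<ge> 2"
  shows   "av N (\<lambda>\<alpha> :: 'a::finite_field fls. cmod (exp_sum r N \<alpha>) powr (1 + 1 / real r))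
             \<le> (real N + 5) ^ 4 * real CARD('a) powr (real N / real r)"
proof -
  define Q where "Q = real CARD('a) powr (real N / real r)"
  define p where "p = 1 + 1 / real r"
  have p: "0 \<le> p" "p \<le> 2" using r by (auto simp: p_def)
  define c where "c = real (N div r + 1)"
  have c: "1 \<le> c" "c \<le> real N + 5"
    using div_le_dividend[of N r] unfolding c_def by linarith+
  have "av N (\<lambda>\<alpha> :: 'a fls. cmod (exp_sum r N \<alpha>) powr p) \<le>
      av N (\<lambda>\<alpha> :: 'a fls. c powr p * (\<Sum>n\<le>N div r. cmod (level_sum r N n \<alpha>) powr p))"
  proof (rule av_mono)
    fix \<alpha> :: "'a fls"
    show "cmod (exp_sum r N \<alpha>) powr p \<le> c powr p * (\<Sum>n\<le>N div r. cmod (level_sum r N n \<alpha>) powr p)"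
      using norm_sum_powr_le[of "{..N div r}" p "\<lambda>n. level_sum r N n \<alpha>"] p
      by (simp add: exp_sum_eq_levels[OF r] c_def)
  qed
  also have "\<dots> = c powr p * (\<Sum>n\<le>N div r. av N (\<lambda>\<alpha> :: 'a fls. cmod (level_sum r N n \<alpha>) powr p))"
    by (simp only: av_cmult av_sum)
  also have "\<dots> \<le> c powr p * (\<Sum>n\<le>N div r. (real N + 5) * Q)"
    unfolding p_def Q_def
    using r by (intro mult_left_mono sum_mono av_level_sum_powr_le)
      (auto simp: less_eq_div_iff_mult_less_eq mult.commute)
  also have "\<dots> = c powr p * (c * ((real N + 5) * Q))" by (simp add: c_def)
  also have "\<dots> \<le> (real N + 5) ^ 2 * ((real N + 5) * ((real N + 5) * Q))"
  proof (intro mult_mono)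
    have "c powr p \<le> c powr 2" using c p by (intro powr_mono) auto
    also have "\<dots> = c ^ 2" using c by (simp add: powr_numeral)
    also have "\<dots> \<le> (real N + 5) ^ 2" using c by (intro power_mono) auto
    finally show "c powr p \<le> (real N + 5) ^ 2" .
  qed (use c in \<open>auto simp: Q_def\<close>)
  also have "\<dots> = (real N + 5) ^ 4 * Q" by (simp add: power4_eq_xxxx power2_eq_square)
  finally show ?thesis unfolding p_def Q_def .
qed

section \<open>Moments of the error term\<close>

lemma linear_le_exponential:
  assumes q: "q > (1::real)" and d: "d > 0" and y: "y \<ge> 0"
  shows   "1 + y \<le> (1 + 1 / (d * ln q)) * q powr (d * y)"
proof -
  define z where "z = d * ln q"
  have z: "z > 0" using q d by (simp add: z_def)
  have "1 + z * y \<le> exp (z * y)" by (rule exp_ge_add_one_self)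
  also have "exp (z * y) = q powr (d * y)" using q by (simp add: powr_def z_def mult_ac)
  finally have *: "1 + z * y \<le> q powr (d * y)" .
  have "1 + y \<le> (1 + 1 / z) * (1 + z * y)"
    using z y by (simp add: field_simps)
  also have "\<dots> \<le> (1 + 1 / z) * q powr (d * y)" using z * by (intro mult_left_mono) auto
  finally show ?thesis by (simp add: z_def)
qed

lemma polynomial_le_exponential:
  assumes q: "q > (1::real)" and d: "d > 0"
  shows   "\<exists>C\<ge>0. \<forall>N :: nat. (real N + 5) ^ 4 \<le> C * q powr (d * real N)"
proof -
  define c where "c = 1 + 1 / (d / 4 * ln q)"
  have c: "c \<ge> 0" using q d by (auto simp: c_def intro!: add_nonneg_nonneg)
  have "(real N + 5) ^ 4 \<le> (5 * c) ^ 4 * q powr (d * real N)" for N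
  proof -
    have "real N + 5 \<le> 5 * (1 + real N)" by simp
    also have "\<dots> \<le> 5 * (c * q powr (d / 4 * real N))"
      unfolding c_def using q d by (intro mult_left_mono linear_le_exponential) auto
    finally have "(real N + 5) ^ 4 \<le> (5 * c * q powr (d / 4 * real N)) ^ 4"
      by (intro power_mono) (auto simp: mult_ac)
    also have "\<dots> = (5 * c) ^ 4 * q powr (d * real N)"
      using q by (simp add: power_mult_distrib powr_power)
    finally show ?thesis .
  qed
  thus ?thesis using c by (intro exI[of _ "(5 * c) ^ 4"]) auto
qed

section \<open>Upper bounds for the model on its arcs\<close>

definition arc_ind :: "nat \<Rightarrow> nat \<Rightarrow> 'a::finite_field poly set \<Rightarrow> nat \<Rightarrow> 'a fls \<Rightarrow> real" where
  "arc_ind r N F j \<alpha> = of_bool (centre r N \<alpha> F \<and> frac_zero j (gm r F \<alpha>))"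

lemma norm_cF_le:
  assumes r: "r \<ge> 2" and F: "F \<in> Fs"
  shows   "\<bar>cF r F\<bar> * real CARD('a) ^ (r * nd (F :: 'a::finite_field poly set)) \<le> geom_const (real CARD('a)) (1 - real r)"
  using cF_approx[OF r F, of "{}" 0] CARD_real_gt_1[where 'a='a] by simp

lemma geom_const_r_ge_1: "r \<ge> 2 \<Longrightarrow> geom_const (real CARD('a::finite_field)) (1 - real r) \<ge> 1"
  using CARD_real_gt_1[where 'a='a] by (intro geom_const_ge_1) auto

text \<open>The model is bounded by its height on the one arc that contains \<alpha>; the remaining
  summands are nonnegative, so the arc need not be named.\<close>

lemma model_powr_le:
  fixes \<alpha> :: "'a::finite_field fls"
  assumes r: "r \<ge> 2" and s: "s > 0"
  shows   "cmod (model r N \<alpha>) powr s \<le>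
     (2 * geom_const (real CARD('a)) (1 - real r)) powr s *
     (\<Sum>F\<in>Ns r (N div 2). \<Sum>j\<in>{N div 2..N - r * nd F}. real CARD('a) powr (s * real j) * arc_ind r N F j \<alpha>)"
proof (cases "\<exists>F. centre r N \<alpha> F")
  case True
  define q where "q = real CARD('a)"
  have q: "q > 1" unfolding q_def by (rule CARD_real_gt_1)
  define g where "g = geom_const q (1 - real r)"
  have g: "g \<ge> 1" unfolding g_def q_def using r by (rule geom_const_r_ge_1)
  from True obtain F where F: "centre r N \<alpha> F" by blast
  obtain j where j: "N div 2 \<le> j" "j \<le> N - r * nd F" "frac_zero j (gm r F \<alpha>)"
    "j = N - r * nd F \<or> fls_nth (gm r F \<alpha>) (int j + 1) \<noteq> 0"
    using T_star_cases[of "N div 2" "gm r F \<alpha>" "N - r * nd F"] centreD[OF F] by metis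
  have FN: "F \<in> Ns r (N div 2)" using centreD[OF F] by (simp add: Ns_def)
  have "cmod (model r N \<alpha>) = (\<bar>cF r F\<bar> * q ^ (r * nd F)) * cmod (T_star (N - r * nd F) (gm r F \<alpha>))"
    using q by (simp add: model_centre[OF r F] norm_mult norm_power q_def)
  also have "\<dots> \<le> g * (2 * q ^ j)"
    unfolding q_def g_def
    using norm_cF_le[OF r centreD(1)[OF F]] norm_T_star_le[OF j(3,2,4)] g
    by (intro mult_mono) (auto simp: g_def q_def)
  finally have "cmod (model r N \<alpha>) powr s \<le> (2 * g * q powr real j) powr s"
    using s q by (intro powr_mono2) (auto simp: powr_realpow mult_ac)
  also have "\<dots> = (2 * g) powr s * (q powr (s * real j) * arc_ind r N F j \<alpha>)"
    using g q F j by (simp add: powr_mult powr_powr arc_ind_def mult.commute)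
  also have "q powr (s * real j) * arc_ind r N F j \<alpha> \<le>
      (\<Sum>j\<in>{N div 2..N - r * nd F}. q powr (s * real j) * arc_ind r N F j \<alpha>)"
    using j by (intro member_le_sum) (auto simp: arc_ind_def)
  also have "\<dots> \<le> (\<Sum>F\<in>Ns r (N div 2). \<Sum>j\<in>{N div 2..N - r * nd F}. q powr (s * real j) * arc_ind r N F j \<alpha>)"
    using FN finite_Ns[OF r, where 'a='a] by (intro member_le_sum sum_nonneg) (auto simp: arc_ind_def)
  finally show ?thesis unfolding q_def g_def using g by (simp add: mult_left_mono q_def g_def)
next
  case False
  hence "model r N \<alpha> = 0" by (intro model_no_centre) blast
  thus ?thesis by (auto intro!: mult_nonneg_nonneg sum_nonneg simp: arc_ind_def)
qed

lemma av_arc_ind_le: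
  fixes F :: "'a::finite_field poly set"
  assumes "F \<in> Fs" "j + r * nd F \<le> N"
  shows   "av N (arc_ind r N F j) \<le> 1 / real CARD('a) ^ j"
proof -
  have "av N (arc_ind r N F j) \<le> av N (\<lambda>\<alpha>. of_bool (frac_zero j (gm r F \<alpha>)))"
    by (intro av_mono) (auto simp: arc_ind_def)
  also have "\<dots> = 1 / real CARD('a) ^ j" using assms by (intro av_frac_zero_gm) auto
  finally show ?thesis .
qed

text \<open>At this order an arc of \<open>F\<close> contributes at most
  \<open>q^(N/r - nd F)\<close>, which offsets the \<open>q^n\<close> sets of degree
  \<open>n\<close>. What remains are the numbers of possible \<open>j\<close> and of possible
  degrees.\<close>

lemma av_model_powr_le:
  assumes r: "r \<ge> 2"
  shows   "av N (\<lambda>\<alpha> :: 'a::finite_field fls. cmod (model r N \<alpha>) powr (1 + 1 / real r)) \<le>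
     (2 * geom_const (real CARD('a)) (1 - real r)) powr (1 + 1 / real r) *
     ((real N + 1) ^ 2 * real CARD('a) powr (real N / real r))"
proof -
  define q where "q = real CARD('a)"
  have q: "q > 1" unfolding q_def by (rule CARD_real_gt_1)
  define p where "p = 1 + 1 / real r"
  define G where "G = (2 * geom_const q (1 - real r)) powr p"
  have "av N (\<lambda>\<alpha> :: 'a fls. cmod (model r N \<alpha>) powr p) \<le>
      av N (\<lambda>\<alpha>. G * (\<Sum>F\<in>Ns r (N div 2). \<Sum>j\<in>{N div 2..N - r * nd (F :: 'a poly set)}. q powr (p * real j) * arc_ind r N F j \<alpha>))"
    unfolding G_def q_def by (intro av_mono model_powr_le r) (simp add: p_def add_pos_nonneg)
  also have "\<dots> = G * (\<Sum>F\<in>Ns r (N div 2). \<Sum>j\<in>{N div 2..N - r * nd (F :: 'a poly set)}. q powr (p * real j) * av N (arc_ind r N F j))"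
    by (simp only: av_sum av_cmult)
  also have "\<dots> \<le> G * (\<Sum>F\<in>Ns r (N div 2). \<Sum>j\<in>{N div 2..N - r * nd (F :: 'a poly set)}. q powr (real N / real r) * q powr (- real (nd F)))"
  proof (intro mult_left_mono sum_mono)
    fix F :: "'a poly set" and j assume F: "F \<in> Ns r (N div 2)" and j: "j \<in> {N div 2..N - r * nd F}"
    have F': "F \<in> Fs" "r * nd F \<le> N" using F by (auto simp: Ns_def)
    have "av N (arc_ind r N F j) \<le> 1 / q ^ j"
      unfolding q_def using F' j by (intro av_arc_ind_le) auto
    hence "q powr (p * real j) * av N (arc_ind r N F j) \<le> q powr (p * real j) * (1 / q ^ j)"
      by (intro mult_left_mono) auto
    also have "\<dots> = q powr (real j / real r)"
      using q by (simp add: powr_realpow[symmetric] powr_diff[symmetric] p_def algebra_simps)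
    also have "\<dots> \<le> q powr (real (N - r * nd F) / real r)"
      using q j by (intro powr_mono divide_right_mono) auto
    also have "real (N - r * nd F) / real r = real N / real r - real (nd F)"
      using F' r by (simp add: of_nat_diff field_simps)
    finally show "q powr (p * real j) * av N (arc_ind r N F j) \<le> q powr (real N / real r) * q powr (- real (nd F))"
      using q by (simp add: powr_diff powr_minus divide_inverse)
  qed (simp add: G_def)
  also have "\<dots> \<le> G * (\<Sum>F\<in>(Ns r (N div 2) :: 'a poly set set). (real N + 1) * q powr (real N / real r) * q powr (- real (nd F)))"
  proof (intro mult_left_mono sum_mono)
    fix F :: "'a poly set"
    have "real (card {N div 2..N - r * nd F}) \<le> real N + 1" by simp
    hence "real (card {N div 2..N - r * nd F}) * (q powr (real N / real r) * q powr (- real (nd F))) \<le>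
        (real N + 1) * (q powr (real N / real r) * q powr (- real (nd F)))"
      by (intro mult_right_mono) auto
    thus "(\<Sum>j\<in>{N div 2..N - r * nd F}. q powr (real N / real r) * q powr (- real (nd F))) \<le>
        (real N + 1) * q powr (real N / real r) * q powr (- real (nd F))" by (simp add: mult_ac)
  qed (simp add: G_def)
  also have "\<dots> = G * ((real N + 1) * q powr (real N / real r) * (\<Sum>F\<in>(Ns r (N div 2) :: 'a poly set set). q powr (- real (nd F))))"
    by (simp only: sum_distrib_left)
  also have "\<dots> \<le> G * ((real N + 1) * q powr (real N / real r) * (real N + 1))"
  proof (intro mult_left_mono)
    have "(\<Sum>F\<in>(Ns r (N div 2) :: 'a poly set set). q powr (- real (nd F))) \<le>
        (\<Sum>n\<in>{..N}. q ^ n * q powr (- real n))"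
      unfolding q_def
    proof (rule sum_Fs_le)
      show "nd F \<in> {..N}" if "F \<in> Ns r (N div 2)" for F :: "'a poly set"
        unfolding atMost_iff
        using Ns_nd_le_div[OF r that] div_le_dividend[of "N div 2" r] div_le_dividend[of N 2] by linarith
    qed (auto simp: Ns_def finite_Ns[OF r, unfolded Ns_def] r)
    also have "\<dots> = real N + 1" using q by (simp add: powr_minus powr_realpow)
    finally show "(\<Sum>F\<in>(Ns r (N div 2) :: 'a poly set set). q powr (- real (nd F))) \<le> real N + 1" .
  qed (auto simp: G_def)
  finally show ?thesis unfolding G_def q_def p_def by (simp add: power2_eq_square mult_ac)
qed

lemma powr_add_le:
  assumes "a \<ge> 0" "b \<ge> 0" "p \<ge> (0::real)"
  shows   "(a + b) powr p \<le> 2 powr p * (a powr p + b powr p)"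
proof -
  have "(a + b) powr p \<le> (2 * max a b) powr p" using assms by (intro powr_mono2) auto
  also have "\<dots> = 2 powr p * max a b powr p" using assms by (simp add: powr_mult)
  also have "max a b powr p \<le> a powr p + b powr p" by (simp add: max_def)
  finally show ?thesis by (simp add: mult_left_mono)
qed

text \<open>The triangle inequality suffices: at this order the sum and the model both have moments
  of size \<open>q^(N/r)\<close> up to a power of \<open>N\<close>.\<close>

lemma av_error_powr_le:
  assumes r: "r \<ge> 2"
  shows   "\<exists>C\<ge>0. \<forall>N. av N (\<lambda>\<alpha> :: 'a::finite_field fls. cmod (exp_sum r N \<alpha> - model r N \<alpha>) powr (1 + 1 / real r)) \<le>
     C * ((real N + 5) ^ 4 * real CARD('a) powr (real N / real r))"
proof -
  define p where "p = 1 + 1 / real r"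
  have p: "p \<ge> 0" by (simp add: p_def)
  define G where "G = (2 * geom_const (real CARD('a)) (1 - real r)) powr p"
  have "av N (\<lambda>\<alpha> :: 'a fls. cmod (exp_sum r N \<alpha> - model r N \<alpha>) powr p) \<le>
     2 powr p * (1 + G) * ((real N + 5) ^ 4 * real CARD('a) powr (real N / real r))" for N
  proof -
    define Q where "Q = real CARD('a) powr (real N / real r)"
    have "av N (\<lambda>\<alpha> :: 'a fls. cmod (exp_sum r N \<alpha> - model r N \<alpha>) powr p) \<le>
        av N (\<lambda>\<alpha> :: 'a fls. 2 powr p * (cmod (exp_sum r N \<alpha>) powr p + cmod (model r N \<alpha>) powr p))"
    proof (rule av_mono)
      fix \<alpha> :: "'a fls"
      have "cmod (exp_sum r N \<alpha> - model r N \<alpha>) powr p \<le> (cmod (exp_sum r N \<alpha>) + cmod (model r N \<alpha>)) powr p"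
        using p by (intro powr_mono2 norm_triangle_ineq4) auto
      also have "\<dots> \<le> 2 powr p * (cmod (exp_sum r N \<alpha>) powr p + cmod (model r N \<alpha>) powr p)"
        using p by (intro powr_add_le) auto
      finally show "cmod (exp_sum r N \<alpha> - model r N \<alpha>) powr p \<le>
          2 powr p * (cmod (exp_sum r N \<alpha>) powr p + cmod (model r N \<alpha>) powr p)" .
    qed
    also have "\<dots> = 2 powr p * (av N (\<lambda>\<alpha> :: 'a fls. cmod (exp_sum r N \<alpha>) powr p) +
        av N (\<lambda>\<alpha> :: 'a fls. cmod (model r N \<alpha>) powr p))"
      by (simp only: av_cmult av_add)
    also have "\<dots> \<le> 2 powr p * ((real N + 5) ^ 4 * Q + G * ((real N + 1) ^ 2 * Q))"
      unfolding p_def Q_def G_def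
      by (intro mult_left_mono add_mono av_exp_sum_powr_le[OF r] av_model_powr_le[OF r]) auto
    also have "\<dots> \<le> 2 powr p * ((real N + 5) ^ 4 * Q + G * ((real N + 5) ^ 4 * Q))"
    proof -
      have "(real N + 1) ^ 2 \<le> (real N + 5) ^ 2" by (intro power_mono) auto
      also have "\<dots> \<le> (real N + 5) ^ 4" by (intro power_increasing) auto
      finally show ?thesis by (intro mult_left_mono add_mono mult_right_mono) (auto simp: Q_def G_def)
    qed
    finally show ?thesis by (simp add: Q_def algebra_simps)
  qed
  thus ?thesis unfolding p_def[symmetric]
    by (intro exI[of _ "2 powr p * (1 + G)"]) (auto simp: G_def)
qed

text \<open>With \<open>p = 1 + 1/r\<close>, the factor \<open>|error|^(k - p)\<close> is bounded by
  the supremum and \<open>|error|^p\<close> by its moment. The exponent on the right equals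
  \<open>k - 1 - (1 - 1/r)(k - 1 - 1/r)/2\<close>.\<close>

lemma av_error_powr_k_le:
  assumes r: "r \<ge> 2" and k: "k > 1 + 1 / real r"
  shows   "\<exists>C\<ge>0. \<forall>N. av N (\<lambda>\<alpha> :: 'a::finite_field fls. cmod (exp_sum r N \<alpha> - model r N \<alpha>) powr k) \<le>
     C * ((real N + 5) ^ 4 *
       real CARD('a) powr (real N * ((1 + 1 / real r) / 2 * (k - 1 - 1 / real r) + 1 / real r)))"
proof -
  define p where "p = 1 + 1 / real r"
  define q where "q = real CARD('a)"
  have q: "q > 1" unfolding q_def by (rule CARD_real_gt_1)
  obtain C where C: "C \<ge> 0" "\<And>N. av N (\<lambda>\<alpha> :: 'a fls. cmod (exp_sum r N \<alpha> - model r N \<alpha>) powr p) \<le>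
     C * ((real N + 5) ^ 4 * q powr (real N / real r))"
    using av_error_powr_le[OF r, where 'a='a] unfolding p_def q_def by blast
  define D where "D = 4 + 2 * geom_const q (1 - real r) * (1 + q)"
  have D: "D \<ge> 0" unfolding D_def q_def using geom_const_r_ge_1[OF r, where 'a='a]
    by (intro add_nonneg_nonneg mult_nonneg_nonneg) auto
  have kp: "k - p > 0" using k by (simp add: p_def)
  have "av N (\<lambda>\<alpha> :: 'a fls. cmod (exp_sum r N \<alpha> - model r N \<alpha>) powr k) \<le>
     D powr (k - p) * C * ((real N + 5) ^ 4 * q powr (real N * (p / 2 * (k - p) + 1 / real r)))" for N
  proof -
    define Z where "Z = (D * q powr (real N * p / 2)) powr (k - p)"
    have "av N (\<lambda>\<alpha> :: 'a fls. cmod (exp_sum r N \<alpha> - model r N \<alpha>) powr k) \<le>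
        av N (\<lambda>\<alpha> :: 'a fls. Z * cmod (exp_sum r N \<alpha> - model r N \<alpha>) powr p)"
    proof (rule av_mono)
      fix \<alpha> :: "'a fls"
      have "cmod (exp_sum r N \<alpha> - model r N \<alpha>) powr k =
          cmod (exp_sum r N \<alpha> - model r N \<alpha>) powr (k - p) * cmod (exp_sum r N \<alpha> - model r N \<alpha>) powr p"
        by (simp add: powr_add[symmetric])
      also have "\<dots> \<le> Z * cmod (exp_sum r N \<alpha> - model r N \<alpha>) powr p"
        unfolding Z_def D_def q_def p_def using kp
        by (intro mult_right_mono powr_mono2 error_sup[OF r]) (auto simp: p_def)
      finally show "cmod (exp_sum r N \<alpha> - model r N \<alpha>) powr k \<le> Z * cmod (exp_sum r N \<alpha> - model r N \<alpha>) powr p" .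
    qed
    also have "\<dots> = Z * av N (\<lambda>\<alpha> :: 'a fls. cmod (exp_sum r N \<alpha> - model r N \<alpha>) powr p)"
      by (rule av_cmult)
    also have "\<dots> \<le> Z * (C * ((real N + 5) ^ 4 * q powr (real N / real r)))"
      by (intro mult_left_mono C) (simp add: Z_def)
    also have "Z = D powr (k - p) * q powr (real N * p / 2 * (k - p))"
      using D q by (simp add: Z_def powr_mult powr_powr)
    also have "\<dots> * (C * ((real N + 5) ^ 4 * q powr (real N / real r))) =
        D powr (k - p) * C * ((real N + 5) ^ 4 * (q powr (real N * p / 2 * (k - p)) * q powr (real N / real r)))"
      by (simp add: mult_ac)
    also have "q powr (real N * p / 2 * (k - p)) * q powr (real N / real r) =
        q powr (real N * (p / 2 * (k - p) + 1 / real r))"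
      by (simp add: powr_add[symmetric] algebra_simps)
    finally show ?thesis .
  qed
  moreover have "D powr (k - p) * C \<ge> 0" using C by simp
  ultimately show ?thesis unfolding p_def q_def
    by (intro exI[of _ "D powr (k - p) * C"]) (auto simp: p_def q_def algebra_simps)
qed

section \<open>The mixed moment of model and error\<close>

lemma arc_ind_misaligned_le:
  fixes \<alpha> :: "'a::finite_field fls"
  shows "arc_ind r N F j \<alpha> * (of_bool (misaligned r N \<alpha> G) * cmod (T_sum M (gm r G \<alpha>))) \<le>
    (\<Sum>m\<le>M. real CARD('a) ^ m * of_bool (centre r N \<alpha> F \<and> frac_zero j (gm r F \<alpha>) \<and>
       \<not> aligned r \<alpha> F G \<and> frac_zero m (gm r G \<alpha>)))"
proof (cases "centre r N \<alpha> F \<and> frac_zero j (gm r F \<alpha>) \<and> misaligned r N \<alpha> G")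
  case True
  hence "\<not> aligned r \<alpha> F G" by (auto simp: misaligned_def)
  thus ?thesis using True norm_T_sum_le[of M "gm r G \<alpha>"] by (simp add: arc_ind_def)
next
  case False
  hence "arc_ind r N F j \<alpha> * (of_bool (misaligned r N \<alpha> G) * cmod (T_sum M (gm r G \<alpha>))) = 0"
    by (auto simp: arc_ind_def)
  thus ?thesis by (simp only:) (intro sum_nonneg, simp)
qed

text \<open>Long complete sums belong to \<open>\<Prod>F\<close> of small degree, of which there are
  few, so their lengths cost a constant and not a factor \<open>N\<close>. This matters for k > 3 +
  1/r, where \<open>theta\<close> leaves no room.\<close>

lemma sum_Ns_length_le:
  assumes r: "r \<ge> 2"
  shows   "\<exists>C\<ge>0. \<forall>N. (\<Sum>G\<in>(Ns r N :: 'a::finite_field poly set set). real (N - r * nd G) + 1) \<le>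
             C * real CARD('a) powr (real N / real r)"
proof -
  define q where "q = real CARD('a)"
  have q: "q > 1" unfolding q_def by (rule CARD_real_gt_1)
  \<comment> \<open>Half of the critical value 1/r: the length \<open>N - rn + 1\<close> is paid for
    by \<open>q^((N - rn)/(2r))\<close>, and against the \<open>q^n\<close> sets of degree
    \<open>n\<close> an increasing geometric sum of \<open>q^(n/2)\<close> is left.\<close>
  define d where "d = 1 / (2 * real r)"
  have d: "d > 0" using r by (simp add: d_def)
  define c where "c = 1 + 1 / (d * ln q)"
  have c: "c \<ge> 0" using q d by (auto simp: c_def intro!: add_nonneg_nonneg)
  define g where "g = geom_const q (1 / 2)"
  have g: "g \<ge> 1" unfolding g_def using q by (intro geom_const_ge_1) auto
  have "(\<Sum>G\<in>(Ns r N :: 'a poly set set). real (N - r * nd G) + 1) \<le> c * g * q powr (real N / real r)" for N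
  proof -
    have "(\<Sum>G\<in>(Ns r N :: 'a poly set set). real (N - r * nd G) + 1) \<le>
        (\<Sum>n\<in>{..N div r}. q ^ n * (real (N - r * n) + 1))"
      unfolding q_def
      by (rule sum_Fs_le) (auto simp: finite_Ns[OF r] Ns_nd_le_div[OF r], auto simp: Ns_def)
    also have "\<dots> \<le> (\<Sum>n\<in>{..N div r}. c * q powr (real N / (2 * real r)) * q powr (1 / 2 * real n))"
    proof (rule sum_mono)
      fix n assume "n \<in> {..N div r}"
      hence n: "r * n \<le> N" using r by (simp add: less_eq_div_iff_mult_less_eq mult.commute)
      have "real (N - r * n) + 1 \<le> c * q powr (d * real (N - r * n))"
        using linear_le_exponential[OF q d, of "real (N - r * n)"] unfolding c_def by simp
      hence "q ^ n * (real (N - r * n) + 1) \<le> q powr real n * (c * q powr (d * real (N - r * n)))"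
        using q by (intro mult_mono) (auto simp: powr_realpow)
      also have "d * real (N - r * n) = real N / (2 * real r) - 1 / 2 * real n"
        using n r by (simp add: d_def of_nat_diff field_simps)
      also have "q powr real n * (c * q powr (real N / (2 * real r) - 1 / 2 * real n)) =
          c * q powr (real N / (2 * real r)) * q powr (1 / 2 * real n)"
        using q by (simp add: powr_add[symmetric] mult_ac)
      finally show "q ^ n * (real (N - r * n) + 1) \<le> c * q powr (real N / (2 * real r)) * q powr (1 / 2 * real n)" .
    qed
    also have "\<dots> = c * q powr (real N / (2 * real r)) * (\<Sum>n\<in>{..N div r}. q powr (1 / 2 * real n))"
      by (rule sum_distrib_left[symmetric])
    also have "\<dots> \<le> c * q powr (real N / (2 * real r)) * (g * q powr (1 / 2 * (real N / real r)))"
      unfolding g_def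
    proof (intro mult_left_mono geometric_sum_powr_le)
      fix n assume "n \<in> {..N div r}"
      hence "real n \<le> real (N div r)" by simp
      also have "\<dots> \<le> real N / real r" by (rule of_nat_div_le_of_nat)
      finally show "real n \<le> real N / real r" .
    qed (use q c in auto)
    also have "\<dots> = c * g * q powr (real N / real r)"
      by (simp add: powr_add[symmetric])
    finally show ?thesis .
  qed
  thus ?thesis using c g unfolding q_def by (intro exI[of _ "c * g"]) auto
qed

text \<open>Over an arc of order \<open>j\<close> a misaligned term contributes at most
  \<open>q^m * q^(-(j + m)) = q^(-j)\<close> for each \<open>m\<close>. So the misaligned part of
  the error acts on the arcs with its mean size \<open>q^(N/r)\<close>, which is far below its
  supremum.\<close>

lemma av_mixed_le:
  assumes r: "r \<ge> 2" and s: "s > 0"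
  shows   "\<exists>C\<ge>0. \<forall>N. av N (\<lambda>\<alpha> :: 'a::finite_field fls.
       cmod (model r N \<alpha>) powr s * cmod (exp_sum r N \<alpha> - model r N \<alpha>)) \<le>
     C * real CARD('a) powr (real N / real r) *
     (\<Sum>F\<in>(Ns r (N div 2) :: 'a poly set set). \<Sum>j\<in>{N div 2..N - r * nd F}. real CARD('a) powr ((s - 1) * real j))"
proof -
  define q where "q = real CARD('a)"
  have q: "q > 1" unfolding q_def by (rule CARD_real_gt_1)
  define K where "K = (2 * geom_const q (1 - real r)) powr s"
  define C1 where "C1 = 2 * geom_const q (1 - real r) + 2"
  have C1: "C1 \<ge> 0" unfolding C1_def q_def using geom_const_r_ge_1[OF r, where 'a='a] by simp
  obtain C2 where C2: "C2 \<ge> 0" "\<And>N. (\<Sum>G\<in>(Ns r N :: 'a poly set set). real (N - r * nd G) + 1) \<le>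
      C2 * q powr (real N / real r)"
    using sum_Ns_length_le[OF r, where 'a='a] unfolding q_def by blast
  have main: "av N (\<lambda>\<alpha> :: 'a fls. cmod (model r N \<alpha>) powr s * cmod (exp_sum r N \<alpha> - model r N \<alpha>)) \<le>
     K * (C1 + C2) * q powr (real N / real r) *
     (\<Sum>F\<in>(Ns r (N div 2) :: 'a poly set set). \<Sum>j\<in>{N div 2..N - r * nd F}. q powr ((s - 1) * real j))" for N
  proof -
    define Q where "Q = q powr (real N / real r)"
    define NH where "NH = (Ns r (N div 2) :: 'a poly set set)"
    define W where "W = (\<lambda>F j G m (\<alpha> :: 'a fls). of_bool (centre r N \<alpha> F \<and> frac_zero j (gm r F \<alpha>) \<and>
       \<not> aligned r \<alpha> F G \<and> frac_zero m (gm r G \<alpha>)) :: real)"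
    have pw: "cmod (model r N \<alpha>) powr s * cmod (exp_sum r N \<alpha> - model r N \<alpha>) \<le>
       K * (\<Sum>F\<in>NH. \<Sum>j\<in>{N div 2..N - r * nd F}. q powr (s * real j) * (C1 * Q * arc_ind r N F j \<alpha> +
         (\<Sum>G\<in>Ns r N. \<Sum>m\<le>N - r * nd G. q ^ m * W F j G m \<alpha>)))" for \<alpha> :: "'a fls"
    proof -
      define E where "E = C1 * Q + (\<Sum>G\<in>Ns r N. of_bool (misaligned r N \<alpha> G) * cmod (T_sum (N - r * nd G) (gm r G \<alpha>)))"
      have "cmod (model r N \<alpha>) powr s * cmod (exp_sum r N \<alpha> - model r N \<alpha>) \<le>
          (K * (\<Sum>F\<in>NH. \<Sum>j\<in>{N div 2..N - r * nd F}. q powr (s * real j) * arc_ind r N F j \<alpha>)) * E"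
      proof (rule mult_mono)
        show "cmod (model r N \<alpha>) powr s \<le>
            K * (\<Sum>F\<in>NH. \<Sum>j\<in>{N div 2..N - r * nd F}. q powr (s * real j) * arc_ind r N F j \<alpha>)"
          unfolding K_def NH_def q_def by (rule model_powr_le[OF r s])
        show "cmod (exp_sum r N \<alpha> - model r N \<alpha>) \<le> E"
          unfolding E_def C1_def Q_def q_def by (rule error_pointwise[OF r])
      qed (auto intro!: mult_nonneg_nonneg sum_nonneg simp: K_def arc_ind_def)
      also have "\<dots> = K * (\<Sum>F\<in>NH. \<Sum>j\<in>{N div 2..N - r * nd F}. q powr (s * real j) * (arc_ind r N F j \<alpha> * E))"
        by (simp add: sum_distrib_right sum_distrib_left mult.assoc)
      also have "\<dots> \<le> K * (\<Sum>F\<in>NH. \<Sum>j\<in>{N div 2..N - r * nd F}. q powr (s * real j) * (C1 * Q * arc_ind r N F j \<alpha> +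
         (\<Sum>G\<in>Ns r N. \<Sum>m\<le>N - r * nd G. q ^ m * W F j G m \<alpha>)))"
      proof (intro mult_left_mono sum_mono)
        fix F :: "'a poly set" and j
        have "arc_ind r N F j \<alpha> * E = C1 * Q * arc_ind r N F j \<alpha> + (\<Sum>G\<in>Ns r N. arc_ind r N F j \<alpha> *
            (of_bool (misaligned r N \<alpha> G) * cmod (T_sum (N - r * nd G) (gm r G \<alpha>))))"
          unfolding E_def by (simp add: ring_distribs sum_distrib_left mult.commute)
        also have "\<dots> \<le> C1 * Q * arc_ind r N F j \<alpha> + (\<Sum>G\<in>Ns r N. \<Sum>m\<le>N - r * nd G. q ^ m * W F j G m \<alpha>)"
          unfolding W_def q_def by (intro add_left_mono sum_mono arc_ind_misaligned_le)
        finally show "arc_ind r N F j \<alpha> * E \<le> C1 * Q * arc_ind r N F j \<alpha> +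
            (\<Sum>G\<in>Ns r N. \<Sum>m\<le>N - r * nd G. q ^ m * W F j G m \<alpha>)" .
      qed (auto simp: K_def)
      finally show ?thesis .
    qed
    have "av N (\<lambda>\<alpha> :: 'a fls. cmod (model r N \<alpha>) powr s * cmod (exp_sum r N \<alpha> - model r N \<alpha>)) \<le>
       av N (\<lambda>\<alpha>. K * (\<Sum>F\<in>NH. \<Sum>j\<in>{N div 2..N - r * nd F}. q powr (s * real j) * (C1 * Q * arc_ind r N F j \<alpha> +
         (\<Sum>G\<in>Ns r N. \<Sum>m\<le>N - r * nd G. q ^ m * W F j G m \<alpha>))))"
      by (intro av_mono pw)
    also have "\<dots> = K * (\<Sum>F\<in>NH. \<Sum>j\<in>{N div 2..N - r * nd F}. q powr (s * real j) * (C1 * Q * av N (arc_ind r N F j) +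
         (\<Sum>G\<in>Ns r N. \<Sum>m\<le>N - r * nd G. q ^ m * av N (W F j G m))))"
      by (simp only: av_cmult av_sum av_add)
    also have "\<dots> \<le> K * (\<Sum>F\<in>NH. \<Sum>j\<in>{N div 2..N - r * nd F}. (C1 + C2) * Q * q powr ((s - 1) * real j))"
    proof (intro mult_left_mono sum_mono)
      fix F :: "'a poly set" and j assume F: "F \<in> NH" and j: "j \<in> {N div 2..N - r * nd F}"
      have F': "F \<in> Fs" "r * nd F \<le> N" using F by (auto simp: Ns_def NH_def)
      have "(\<Sum>G\<in>Ns r N. \<Sum>m\<le>N - r * nd G. q ^ m * av N (W F j G m)) \<le>
          (\<Sum>G\<in>(Ns r N :: 'a poly set set). \<Sum>m\<le>N - r * nd G. 1 / q ^ j)"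
      proof (intro sum_mono)
        fix G :: "'a poly set" and m assume G: "G \<in> Ns r N" and m: "m \<in> {..N - r * nd G}"
        have "av N (W F j G m) \<le> 1 / q ^ (j + m)"
          unfolding W_def q_def using F' G j m by (intro av_not_aligned_le) (auto simp: Ns_def)
        hence "q ^ m * av N (W F j G m) \<le> q ^ m * (1 / q ^ (j + m))"
          using q by (intro mult_left_mono) auto
        thus "q ^ m * av N (W F j G m) \<le> 1 / q ^ j" using q by (simp add: power_add)
      qed
      also have "\<dots> = 1 / q ^ j * (\<Sum>G\<in>(Ns r N :: 'a poly set set). real (N - r * nd G) + 1)"
        by (simp add: sum_distrib_left mult.commute add.commute)
      also have "\<dots> \<le> 1 / q ^ j * (C2 * Q)"
        unfolding Q_def using q by (intro mult_left_mono C2) auto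
      finally have "(\<Sum>G\<in>Ns r N. \<Sum>m\<le>N - r * nd G. q ^ m * av N (W F j G m)) \<le> 1 / q ^ j * (C2 * Q)" .
      moreover have "C1 * Q * av N (arc_ind r N F j) \<le> C1 * Q * (1 / q ^ j)"
        unfolding q_def using F' j C1 by (intro mult_left_mono av_arc_ind_le) (auto simp: Q_def)
      ultimately have "C1 * Q * av N (arc_ind r N F j) +
          (\<Sum>G\<in>Ns r N. \<Sum>m\<le>N - r * nd G. q ^ m * av N (W F j G m)) \<le> (C1 + C2) * Q * (1 / q ^ j)"
        by (simp add: algebra_simps)
      hence "q powr (s * real j) * (C1 * Q * av N (arc_ind r N F j) +
          (\<Sum>G\<in>Ns r N. \<Sum>m\<le>N - r * nd G. q ^ m * av N (W F j G m))) \<le> q powr (s * real j) * ((C1 + C2) * Q * (1 / q ^ j))"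
        by (intro mult_left_mono) auto
      also have "\<dots> = (C1 + C2) * Q * (q powr (s * real j) / q powr real j)"
        using q by (simp add: powr_realpow)
      also have "q powr (s * real j) / q powr real j = q powr ((s - 1) * real j)"
        by (simp add: powr_diff[symmetric] algebra_simps)
      finally show "q powr (s * real j) * (C1 * Q * av N (arc_ind r N F j) +
          (\<Sum>G\<in>Ns r N. \<Sum>m\<le>N - r * nd G. q ^ m * av N (W F j G m))) \<le> (C1 + C2) * Q * q powr ((s - 1) * real j)" .
    qed (simp add: K_def)
    also have "\<dots> = K * (C1 + C2) * Q * (\<Sum>F\<in>NH. \<Sum>j\<in>{N div 2..N - r * nd F}. q powr ((s - 1) * real j))"
      by (simp add: sum_distrib_left mult.assoc)
    finally show ?thesis unfolding Q_def NH_def .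
  qed
  have "K * (C1 + C2) \<ge> 0" using C1 C2 by (simp add: K_def)
  thus ?thesis using main unfolding q_def by blast
qed

text \<open>Since \<open>r(k - 2) > 1\<close>, the sums over \<open>j\<close> and over
  \<open>F\<close> are both geometric, dominated by the largest \<open>j\<close> and the smallest
  degree, and no power of \<open>N\<close> is lost.\<close>

lemma sum_arcs_le_large:
  assumes r: "r \<ge> 2" and k: "k > 2 + 1 / real r"
  shows   "\<exists>C\<ge>0. \<forall>N. (\<Sum>F\<in>(Ns r (N div 2) :: 'a::finite_field poly set set).
       \<Sum>j\<in>{N div 2..N - r * nd F}. real CARD('a) powr ((k - 2) * real j)) \<le>
     C * real CARD('a) powr (real N * (k - 2))"
proof -
  define q where "q = real CARD('a)"
  have q: "q > 1" unfolding q_def by (rule CARD_real_gt_1)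
  have k2: "k - 2 > 0" using k by (smt (verit) divide_nonneg_nonneg of_nat_0_le_iff)
  define s where "s = real r * (k - 2)"
  have s: "s > 1" using k r by (simp add: s_def field_simps)
  define g where "g = geom_const q (k - 2)"
  have g: "g \<ge> 1" unfolding g_def using q k2 by (intro geom_const_ge_1) auto
  define g' where "g' = geom_const q (1 - s)"
  have g': "g' \<ge> 1" unfolding g'_def using q s by (intro geom_const_ge_1) auto
  have "(\<Sum>F\<in>(Ns r (N div 2) :: 'a poly set set). \<Sum>j\<in>{N div 2..N - r * nd F}. q powr ((k - 2) * real j)) \<le>
      g * g' * q powr (real N * (k - 2))" for N
  proof -
    have "(\<Sum>F\<in>(Ns r (N div 2) :: 'a poly set set). \<Sum>j\<in>{N div 2..N - r * nd F}. q powr ((k - 2) * real j)) \<le>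
        (\<Sum>F\<in>(Ns r (N div 2) :: 'a poly set set). g * q powr (real N * (k - 2)) * q powr (- (s * real (nd F))))"
    proof (rule sum_mono)
      fix F :: "'a poly set" assume "F \<in> Ns r (N div 2)"
      hence F: "r * nd F \<le> N" by (auto simp: Ns_def)
      have "(\<Sum>j\<in>{N div 2..N - r * nd F}. q powr ((k - 2) * real j)) \<le> g * q powr ((k - 2) * real (N - r * nd F))"
        unfolding g_def using q k2 by (intro geometric_sum_powr_le) auto
      also have "(k - 2) * real (N - r * nd F) = real N * (k - 2) + - (s * real (nd F))"
        using F by (simp add: s_def of_nat_diff algebra_simps)
      finally show "(\<Sum>j\<in>{N div 2..N - r * nd F}. q powr ((k - 2) * real j)) \<le>
          g * q powr (real N * (k - 2)) * q powr (- (s * real (nd F)))"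
        unfolding powr_add by (simp add: mult.assoc)
    qed
    also have "\<dots> = g * q powr (real N * (k - 2)) * (\<Sum>F\<in>(Ns r (N div 2) :: 'a poly set set). q powr (- (s * real (nd F))))"
      by (rule sum_distrib_left[symmetric])
    also have "\<dots> \<le> g * q powr (real N * (k - 2)) * (g' * q powr ((1 - s) * 0))"
      unfolding g'_def q_def using g
      by (intro mult_left_mono Fs_tail_bound[OF s]) (auto simp: finite_Ns[OF r], auto simp: Ns_def g_def q_def)
    finally show ?thesis using q by (simp add: mult_ac)
  qed
  moreover have "g * g' \<ge> 0" using g g' by simp
  ultimately show ?thesis unfolding q_def by blast
qed

text \<open>Linear optimisation of the exponent \<open>n + (k - 2) j\<close>, where \<open>n\<close>
  is the degree. Its bound is attained at \<open>n = N/(2r)\<close>, with \<open>j = N - rn\<close>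
  when \<open>k \<ge> 2\<close> and \<open>j = N/2\<close> otherwise; in both cases it is
  \<open>N(k - 2 + 1/r)/2\<close>. The extra factor \<open>q\<close> covers the rounding of
  \<open>N div 2\<close>.\<close>

lemma sum_arcs_le_small:
  assumes r: "r \<ge> 2" and k: "k \<le> 2 + 1 / real r" "k \<ge> 1"
  shows   "(\<Sum>F\<in>(Ns r (N div 2) :: 'a::finite_field poly set set).
       \<Sum>j\<in>{N div 2..N - r * nd F}. real CARD('a) powr ((k - 2) * real j)) \<le>
     (real N + 5) ^ 4 * (real CARD('a) * real CARD('a) powr (real N * ((k - 2 + 1 / real r) / 2)))"
proof -
  define q where "q = real CARD('a)"
  have q: "q > 1" unfolding q_def by (rule CARD_real_gt_1)
  define Z where "Z = q * q powr (real N * ((k - 2 + 1 / real r) / 2))"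
  have Z: "Z \<ge> 0" using q by (simp add: Z_def)
  have "(\<Sum>F\<in>(Ns r (N div 2) :: 'a poly set set). \<Sum>j\<in>{N div 2..N - r * nd F}. q powr ((k - 2) * real j)) \<le>
     (\<Sum>n\<in>{..(N div 2) div r}. q ^ n * (\<Sum>j\<in>{N div 2..N - r * n}. q powr ((k - 2) * real j)))"
    unfolding q_def
    by (rule sum_Fs_le) (auto simp: finite_Ns[OF r] Ns_nd_le_div[OF r] intro!: sum_nonneg, auto simp: Ns_def)
  also have "\<dots> \<le> (\<Sum>n\<in>{..(N div 2) div r}. (real N + 1) * Z)"
  proof (rule sum_mono)
    fix n assume "n \<in> {..(N div 2) div r}"
    hence n: "r * n \<le> N div 2" using r by (simp add: less_eq_div_iff_mult_less_eq mult.commute)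
    hence "2 * (r * n) \<le> N" by simp
    hence n': "2 * (real r * real n) \<le> real N" by (metis of_nat_le_iff of_nat_mult of_nat_numeral)
    have "q ^ n * (\<Sum>j\<in>{N div 2..N - r * n}. q powr ((k - 2) * real j)) \<le>
        (\<Sum>j\<in>{N div 2..N - r * n}. Z)"
      unfolding sum_distrib_left
    proof (rule sum_mono)
      fix j assume j: "j \<in> {N div 2..N - r * n}"
      have j': "real N - 1 \<le> 2 * real j" using j by auto
      have "r * n + j \<le> N" using j n by auto
      hence "real (r * n + j) \<le> real N" unfolding of_nat_le_iff .
      hence j'': "real j \<le> real N - real r * real n" by simp
      have r0: "real r > 0" using r by simp
      have "real n + (k - 2) * real j \<le> real N * ((k - 2 + 1 / real r) / 2) + 1"
      proof (cases "k \<ge> 2")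
        case True
        have "real n + (k - 2) * real j \<le> real n + (k - 2) * (real N - real r * real n)"
          using True j'' by (intro add_left_mono mult_left_mono) auto
        also have "\<dots> = (k - 2) * real N + real n * real r * (1 / real r - (k - 2))"
          using r0 by (simp add: field_simps)
        also have "\<dots> \<le> (k - 2) * real N + real N / 2 * (1 / real r - (k - 2))"
          using n' k by (intro add_left_mono mult_right_mono) (auto simp: mult.commute)
        also have "\<dots> = real N * ((k - 2 + 1 / real r) / 2)" by (simp add: field_simps)
        finally show ?thesis by linarith
      next
        case False
        have abstract: "A + B \<le> R + 1"
          if "A \<le> y" "B \<le> c" "c = w - d" "R = w + y" "- d \<le> 1" for A B R y c w d :: real
          using that by linarith
        show ?thesis
        proof (rule abstract)
          show "real n \<le> real N / 2 * (1 / real r)" using n' r0 by (simp add: field_simps)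
          show "(k - 2) * real j \<le> (k - 2) * (real N / 2 - 1 / 2)"
            using False j' by (intro mult_left_mono_neg) auto
          show "(k - 2) * (real N / 2 - 1 / 2) = (k - 2) * real N / 2 - (k - 2) / 2"
            by (simp add: field_simps)
          show "real N * ((k - 2 + 1 / real r) / 2) = (k - 2) * real N / 2 + real N / 2 * (1 / real r)"
            by (simp add: field_simps)
          show "- ((k - 2) / 2) \<le> 1" using k(2) by simp
        qed
      qed
      hence "q powr (real n + (k - 2) * real j) \<le> q powr (real N * ((k - 2 + 1 / real r) / 2) + 1)"
        using q by (intro powr_mono) auto
      thus "q ^ n * q powr ((k - 2) * real j) \<le> Z"
        using q by (simp add: Z_def powr_add powr_realpow mult.commute)
    qed
    also have "\<dots> = real (card {N div 2..N - r * n}) * Z" by simp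
    also have "\<dots> \<le> (real N + 1) * Z" using Z by (intro mult_right_mono) auto
    finally show "q ^ n * (\<Sum>j\<in>{N div 2..N - r * n}. q powr ((k - 2) * real j)) \<le> (real N + 1) * Z" .
  qed
  also have "\<dots> = real (N div 2 div r + 1) * ((real N + 1) * Z)" by simp
  also have "\<dots> \<le> (real N + 5) ^ 2 * ((real N + 5) ^ 2 * Z)"
  proof (intro mult_mono mult_right_mono)
    have "N div 2 div r + 1 \<le> N + 5"
      using div_le_dividend[of "N div 2" r] div_le_dividend[of N 2] by linarith
    hence "real (N div 2 div r + 1) \<le> real N + 5" by linarith
    also have "\<dots> \<le> (real N + 5) ^ 2" using self_le_power[of "real N + 5" 2] by simp
    finally show "real (N div 2 div r + 1) \<le> (real N + 5) ^ 2" .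
    have "real N + 1 \<le> real N + 5" by simp
    also have "\<dots> \<le> (real N + 5) ^ 2" using self_le_power[of "real N + 5" 2] by simp
    finally show "real N + 1 \<le> (real N + 5) ^ 2" .
  qed (use Z in auto)
  also have "\<dots> = (real N + 5) ^ 4 * Z" by (simp add: power4_eq_xxxx power2_eq_square)
  finally show ?thesis unfolding Z_def q_def .
qed

section \<open>The moment of the model\<close>

text \<open>By \<open>T_star_value\<close> the model is constant on the part of a leaf centred at
  \<open>F\<close>, provided that \<open>c \<noteq> 0\<close> or
  \<open>j = N - r * nd F\<close>.\<close>

definition leaf :: "nat \<Rightarrow> 'a::finite_field poly set \<Rightarrow> nat \<Rightarrow> 'a \<Rightarrow> 'a fls \<Rightarrow> bool" where
  "leaf r F j c \<alpha> \<longleftrightarrow> frac_zero j (gm r F \<alpha>) \<and> fls_nth (gm r F \<alpha>) (int j + 1) = c"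

lemma leaf_centre_iff:
  assumes F: "F \<in> Ns r (N div 2)" and G: "G \<subseteq> F" "centre r N \<alpha> G"
  shows   "leaf r G (j + r * nd (F - G)) c \<alpha> \<longleftrightarrow> leaf r F j c (\<alpha> :: 'a::finite_field fls)"
proof -
  define u where "u = \<Prod>(F - G) ^ r"
  define p where "p = r * nd (F - G)"
  have FFs: "F \<in> Fs" "r * nd F \<le> N div 2" using F by (auto simp: Ns_def)
  have u: "u \<in> monics" "degree u = p"
    unfolding u_def p_def using FFs Fs_Diff by (auto intro!: prod_Fs_power_monics degree_prod_Fs_power)
  have "nd (F - G) \<le> nd F" using FFs by (intro nd_mono Fs_finite) auto
  hence "p \<le> N div 2" using FFs(2) mult_le_mono2[of "nd (F - G)" "nd F" r] unfolding p_def by linarith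
  hence fz: "frac_zero p (gm r G \<alpha>)" using centreD(3)[OF G(2)] by (rule frac_zero_mono[rotated])
  have gm: "gm r F \<alpha> = poly_to_laurent u * gm r G \<alpha>" unfolding u_def by (rule gm_split[OF FFs(1) G(1)])
  have 1: "frac_zero j (gm r F \<alpha>) \<longleftrightarrow> frac_zero (j + p) (gm r G \<alpha>)"
    unfolding gm by (rule frac_zero_monic_times[OF u fz])
  have 2: "fls_nth (gm r F \<alpha>) (int j + 1) = fls_nth (gm r G \<alpha>) (int (j + p) + 1)"
    if "frac_zero (j + p) (gm r G \<alpha>)"
    unfolding gm by (rule fls_nth_monic_times[OF u that])
  show ?thesis unfolding leaf_def p_def[symmetric] using 1 2 by auto
qed

text \<open>The condition \<open>N div 2 \<le> j\<close> puts \<open>F\<close> into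
  \<open>Maj\<close>, so each point of the leaf has exactly one centre, and that centre is a subset
  of \<open>F\<close>.\<close>

lemma leaf_eq_sum_centres:
  fixes \<alpha> :: "'a::finite_field fls"
  assumes F: "F \<in> Ns r (N div 2)" and j: "N div 2 \<le> j"
  shows   "of_bool (leaf r F j c \<alpha>) =
             (\<Sum>G\<in>Pow F. of_bool (centre r N \<alpha> G \<and> leaf r G (j + r * nd (F - G)) c \<alpha>) :: real)"
proof (cases "leaf r F j c \<alpha>")
  case True
  have FFs: "F \<in> Fs" using F by (auto simp: Ns_def)
  have "F \<in> Maj r N \<alpha>" using F True j by (auto simp: Maj_def Ns_def leaf_def intro: frac_zero_mono)
  then obtain G0 where G0: "centre r N \<alpha> G0" "G0 \<subseteq> F" using ex_centre[of r N \<alpha>] unfolding centre_def by blast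
  have "of_bool (centre r N \<alpha> G \<and> leaf r G (j + r * nd (F - G)) c \<alpha>) = (if G = G0 then 1 else 0 :: real)"
    if "G \<in> Pow F" for G
  proof (cases "G = G0")
    case True
    thus ?thesis using G0 \<open>leaf r F j c \<alpha>\<close> leaf_centre_iff[OF F G0(2,1), of j c] by simp
  next
    case False
    hence "\<not> centre r N \<alpha> G" using centre_unique[OF _ G0(1)] by blast
    thus ?thesis using False by simp
  qed
  hence "(\<Sum>G\<in>Pow F. of_bool (centre r N \<alpha> G \<and> leaf r G (j + r * nd (F - G)) c \<alpha>)) =
      (\<Sum>G\<in>Pow F. if G = G0 then 1 else 0 :: real)" by (intro sum.cong refl)
  also have "\<dots> = 1" using G0(2) Fs_finite[OF FFs] by simp
  finally show ?thesis using True by simp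
next
  case False
  have "of_bool (centre r N \<alpha> G \<and> leaf r G (j + r * nd (F - G)) c \<alpha>) = (0 :: real)" if "G \<in> Pow F" for G
    using leaf_centre_iff[OF F, of G \<alpha> j c] that False by auto
  hence "(\<Sum>G\<in>Pow F. of_bool (centre r N \<alpha> G \<and> leaf r G (j + r * nd (F - G)) c \<alpha>)) = (0 :: real)"
    by (intro sum.neutral) blast
  thus ?thesis using False by simp
qed

lemma av_leaf:
  fixes F :: "'a::finite_field poly set"
  assumes "F \<in> Fs" "j + r * nd F \<le> N"
  shows   "av N (\<lambda>\<alpha>. of_bool (leaf r F j c \<alpha>)) = 1 / real CARD('a) ^ (j + 1)"
  unfolding leaf_def gm_def
  using assms monics_nonzero[OF prod_Fs_power_monics[OF assms(1), of r]]
  by (intro av_frac_zero_nth) (simp_all only: degree_prod_Fs_power not_False_eq_True)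

text \<open>Inversion over the subsets of \<open>F\<close> by induction. The full leaf has measure
  \<open>1/q^(j + 1)\<close>; the part centred at a proper subset \<open>G\<close> has measure
  \<open>jordan r G\<close> over the common denominator \<open>q^(r nd F + j + 1)\<close>. By
  \<open>sum_jordan\<close> exactly \<open>jordan r F\<close> is left over.\<close>

lemma av_centre_leaf:
  fixes F :: "'a::finite_field poly set"
  assumes "F \<in> Ns r (N div 2)" "N div 2 \<le> j" "j + r * nd F \<le> N"
  shows   "av N (\<lambda>\<alpha>. of_bool (centre r N \<alpha> F \<and> leaf r F j c \<alpha>)) =
             jordan r F / real CARD('a) ^ (r * nd F + j + 1)"
proof -
  define q where "q = real CARD('a)"
  have q: "q > 1" unfolding q_def by (rule CARD_real_gt_1)
  have "finite F" using assms(1) by (auto simp: Ns_def intro: Fs_finite)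
  thus ?thesis using assms unfolding q_def[symmetric]
  proof (induction F arbitrary: j rule: finite_psubset_induct)
    case (psubset F)
    have F: "F \<in> Fs" using psubset.prems by (auto simp: Ns_def)
    have fin: "finite F" by fact
    have summand: "av N (\<lambda>\<alpha>. of_bool (centre r N \<alpha> G \<and> leaf r G (j + r * nd (F - G)) c \<alpha>)) =
        jordan r G / q ^ (r * nd F + j + 1)" if G: "G \<in> Pow F - {F}" for G
    proof -
      have nd: "r * nd F = r * nd G + r * nd (F - G)"
        using nd_Diff[OF fin, of G] G by (simp add: ring_distribs)
      have "av N (\<lambda>\<alpha>. of_bool (centre r N \<alpha> G \<and> leaf r G (j + r * nd (F - G)) c \<alpha>)) =
          jordan r G / q ^ (r * nd G + (j + r * nd (F - G)) + 1)"
        using G psubset.prems nd Fs_subset[OF F, of G] by (intro psubset.IH) (auto simp: Ns_def)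
      thus ?thesis using nd by (simp add: add_ac)
    qed
    have "1 / q ^ (j + 1) = av N (\<lambda>\<alpha>. of_bool (leaf r F j c \<alpha>))"
      using av_leaf[OF F psubset.prems(3)] by (simp add: q_def)
    also have "\<dots> = (\<Sum>G\<in>Pow F. av N (\<lambda>\<alpha>. of_bool (centre r N \<alpha> G \<and> leaf r G (j + r * nd (F - G)) c \<alpha>)))"
      unfolding leaf_eq_sum_centres[OF psubset.prems(1,2)] av_sum ..
    also have "\<dots> = av N (\<lambda>\<alpha>. of_bool (centre r N \<alpha> F \<and> leaf r F j c \<alpha>)) +
        (\<Sum>G\<in>Pow F - {F}. jordan r G / q ^ (r * nd F + j + 1))"
      using fin by (subst sum.remove[of _ F]) (simp_all add: summand)
    also have "(\<Sum>G\<in>Pow F - {F}. jordan r G / q ^ (r * nd F + j + 1)) =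
        (\<Sum>G\<in>Pow F - {F}. jordan r G) / q ^ (r * nd F + j + 1)"
      by (rule sum_divide_distrib[symmetric])
    also have "(\<Sum>G\<in>Pow F - {F}. jordan r G) = q ^ (r * nd F) - jordan r F"
      using sum_jordan[OF F, of r] fin by (simp add: sum_diff1 q_def)
    finally show ?case using q by (simp add: power_add field_simps)
  qed
qed

section \<open>Summation over the leaves and the constant B(k)\<close>

definition leaf_weight :: "real \<Rightarrow> 'a::finite_field \<Rightarrow> real" where
  "leaf_weight k c = cmod (ff_char c + 1 / (of_nat CARD('a) - 1)) powr k"

lemma T_star_powr_eq:
  fixes \<gamma> :: "'a::finite_field fls"
  assumes fz: "frac_zero H \<gamma>" "H \<le> M"
  shows   "cmod (T_star M \<gamma>) powr k = (\<Sum>j\<in>{H..M}. \<Sum>c\<in>(UNIV :: 'a set).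
     of_bool (j = M \<or> c \<noteq> 0) * real CARD('a) powr (k * real j) * leaf_weight k c *
     of_bool (frac_zero j \<gamma> \<and> fls_nth \<gamma> (int j + 1) = c))"
proof -
  define q where "q = real CARD('a)"
  have q: "q > 1" unfolding q_def by (rule CARD_real_gt_1)
  obtain j where j: "H \<le> j" "j \<le> M" "frac_zero j \<gamma>" "j = M \<or> fls_nth \<gamma> (int j + 1) \<noteq> 0"
    using T_star_cases[OF fz] .
  let ?c = "\<lambda>i. fls_nth \<gamma> (int i + 1)"
  have inner: "(\<Sum>c\<in>(UNIV :: 'a set). of_bool (i = M \<or> c \<noteq> 0) * q powr (k * real i) * leaf_weight k c *
     of_bool (frac_zero i \<gamma> \<and> ?c i = c)) = (if i = j then q powr (k * real j) * leaf_weight k (?c j) else 0)"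
    if i: "i \<in> {H..M}" for i
  proof -
    have "(\<Sum>c\<in>(UNIV :: 'a set). of_bool (i = M \<or> c \<noteq> 0) * q powr (k * real i) * leaf_weight k c *
        of_bool (frac_zero i \<gamma> \<and> ?c i = c)) =
      (\<Sum>c\<in>(UNIV :: 'a set). if ?c i = c then of_bool (i = M \<or> c \<noteq> 0) * q powr (k * real i) * leaf_weight k c *
        of_bool (frac_zero i \<gamma>) else 0)"
      by (intro sum.cong refl) auto
    also have "\<dots> = of_bool (i = M \<or> ?c i \<noteq> 0) * q powr (k * real i) * leaf_weight k (?c i) * of_bool (frac_zero i \<gamma>)"
      by (subst sum.delta') auto
    also have "\<dots> = (if i = j then q powr (k * real j) * leaf_weight k (?c j) else 0)"
    proof (cases "i < j")
      case True
      hence "frac_zero (Suc i) \<gamma>" using frac_zero_mono[OF j(3)] by simp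
      hence "?c i = 0" by (simp add: frac_zero_Suc)
      thus ?thesis using True j by simp
    next
      case False
      show ?thesis
      proof (cases "i = j")
        case True
        thus ?thesis using j by auto
      next
        case neq: False
        hence "Suc j \<le> i" "j \<noteq> M" using False i by auto
        hence "\<not> frac_zero (Suc j) \<gamma>" using j by (simp add: frac_zero_Suc)
        hence "\<not> frac_zero i \<gamma>" using frac_zero_mono \<open>Suc j \<le> i\<close> by blast
        thus ?thesis using neq by simp
      qed
    qed
    finally show ?thesis .
  qed
  have "cmod (T_star M \<gamma>) powr k = q powr (k * real j) * leaf_weight k (?c j)"
    using q unfolding T_star_value[OF j(3,2,4)] leaf_weight_def
    by (simp add: norm_mult norm_power powr_mult q_def powr_powr mult.commute flip: powr_realpow)
  also have "\<dots> = (\<Sum>i\<in>{H..M}. if i = j then q powr (k * real j) * leaf_weight k (?c j) else 0)"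
    using j by simp
  finally show ?thesis using inner unfolding q_def by simp
qed

lemma model_powr_eq:
  fixes \<alpha> :: "'a::finite_field fls"
  assumes r: "r \<ge> 2" and k: "k > 0"
  shows   "cmod (model r N \<alpha>) powr k = (\<Sum>F\<in>Ns r (N div 2).
     (\<bar>cF r F\<bar> * real CARD('a) ^ (r * nd F)) powr k *
     (\<Sum>j\<in>{N div 2..N - r * nd F}. \<Sum>c\<in>(UNIV :: 'a set).
        of_bool (j = N - r * nd F \<or> c \<noteq> 0) * real CARD('a) powr (k * real j) * leaf_weight k c *
        of_bool (centre r N \<alpha> F \<and> leaf r F j c \<alpha>)))" (is "_ = (\<Sum>F\<in>_. ?\<kappa> F * ?t F)")
proof (cases "\<exists>F. centre r N \<alpha> F")
  case True
  then obtain F where F: "centre r N \<alpha> F" by blast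
  have FN: "F \<in> Ns r (N div 2)" using centreD[OF F] by (simp add: Ns_def)
  have zero: "?t G = 0" if "G \<noteq> F" for G
  proof -
    have "\<not> centre r N \<alpha> G" using centre_unique[OF F] that by blast
    thus ?thesis by simp
  qed
  have "(\<Sum>G\<in>Ns r (N div 2). ?\<kappa> G * ?t G) = (\<Sum>G\<in>Ns r (N div 2). if G = F then ?\<kappa> F * ?t F else 0)"
  proof (rule sum.cong[OF refl])
    fix G show "?\<kappa> G * ?t G = (if G = F then ?\<kappa> F * ?t F else 0)"
      by (cases "G = F") (simp_all only: zero mult_zero_right if_True if_False not_False_eq_True simp_thms)
  qed
  also have "\<dots> = ?\<kappa> F * ?t F"
    by (subst sum.delta[OF finite_Ns[OF r]]) (simp only: FN if_True)
  also have "?t F = cmod (T_star (N - r * nd F) (gm r F \<alpha>)) powr k"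
    using T_star_powr_eq[OF centreD(3,4)[OF F], of k] F by (simp add: leaf_def)
  also have "?\<kappa> F * \<dots> = cmod (model r N \<alpha>) powr k"
    unfolding model_centre[OF r F] by (simp add: norm_mult norm_power powr_mult)
  finally show ?thesis ..
next
  case False
  hence "model r N \<alpha> = 0" by (intro model_no_centre) blast
  moreover have "?t F = 0" for F using False by simp
  ultimately show ?thesis using k by simp
qed

text \<open>A geometric series in \<open>Q = q^(k - 1)\<close>: its upper end and the separate term
  for \<open>c = 0\<close> at \<open>j = M\<close> combine to \<open>B(k)\<close>, and its lower end
  is the subtracted term.\<close>

lemma sum_leaf_weights:
  fixes q Q k :: real
  assumes k: "k > 1" and HM: "H \<le> M"
  defines "q \<equiv> real CARD('a::finite_field)"
  defines "Q \<equiv> q powr (k - 1)"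
  shows   "(\<Sum>j\<in>{H..M}. \<Sum>c\<in>(UNIV :: 'a set). of_bool (j = M \<or> c \<noteq> 0) * q powr (k * real j) * leaf_weight k c / q ^ (j + 1)) =
     B_const TYPE('a) k * Q ^ M - (\<Sum>c\<in>UNIV - {0 :: 'a}. leaf_weight k c) / q * Q ^ H / (Q - 1)"
proof -
  have q: "q > 1" unfolding q_def by (rule CARD_real_gt_1)
  have "q powr 0 < Q" unfolding Q_def using q k by (intro powr_less_mono) auto
  hence Q: "Q > 1" using q by simp
  define W where "W = (\<Sum>c\<in>UNIV - {0 :: 'a}. leaf_weight k c)"
  define w0 where "w0 = leaf_weight k (0 :: 'a)"
  have un: "(UNIV :: 'a set) = insert 0 (UNIV - {0})" by auto
  have qj: "q powr (k * real j) / q ^ (j + 1) = Q ^ j / q" for j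
  proof -
    have "Q ^ j = q powr ((k - 1) * real j)" unfolding Q_def using q by (simp add: powr_power mult.commute)
    also have "\<dots> = q powr (k * real j) / q ^ j"
      using q by (simp add: powr_realpow[symmetric] powr_diff[symmetric] algebra_simps)
    finally show ?thesis by simp
  qed
  have "(\<Sum>c\<in>(UNIV :: 'a set). of_bool (j = M \<or> c \<noteq> 0) * q powr (k * real j) * leaf_weight k c / q ^ (j + 1)) =
      Q ^ j / q * W + (if j = M then Q ^ M / q * w0 else 0)" for j
  proof -
    have "(\<Sum>c\<in>(UNIV :: 'a set). of_bool (j = M \<or> c \<noteq> 0) * q powr (k * real j) * leaf_weight k c / q ^ (j + 1)) =
        (\<Sum>c\<in>(UNIV :: 'a set). (q powr (k * real j) / q ^ (j + 1)) * (of_bool (j = M \<or> c \<noteq> 0) * leaf_weight k c))"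
      by (intro sum.cong refl) simp
    also have "\<dots> = Q ^ j / q * (\<Sum>c\<in>(UNIV :: 'a set). of_bool (j = M \<or> c \<noteq> 0) * leaf_weight k c)"
      unfolding qj sum_distrib_left ..
    also have "(\<Sum>c\<in>(UNIV :: 'a set). of_bool (j = M \<or> c \<noteq> 0) * leaf_weight k c) = of_bool (j = M) * w0 + W"
      by (subst un, subst sum.insert) (auto simp: w0_def W_def intro!: sum.cong)
    finally show ?thesis by (simp add: algebra_simps)
  qed
  hence "(\<Sum>j\<in>{H..M}. \<Sum>c\<in>(UNIV :: 'a set). of_bool (j = M \<or> c \<noteq> 0) * q powr (k * real j) * leaf_weight k c / q ^ (j + 1)) =
      (\<Sum>j\<in>{H..M}. Q ^ j) / q * W + Q ^ M / q * w0"
    using HM by (simp add: sum.distrib sum_distrib_right sum_divide_distrib)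
  also have "(\<Sum>j\<in>{H..M}. Q ^ j) = (Q ^ Suc M - Q ^ H) / (Q - 1)"
    using sum_gp[of Q H M] HM Q by (simp add: divide_simps) (simp add: algebra_simps)
  finally have lhs: "(\<Sum>j\<in>{H..M}. \<Sum>c\<in>(UNIV :: 'a set). of_bool (j = M \<or> c \<noteq> 0) * q powr (k * real j) * leaf_weight k c / q ^ (j + 1)) =
      (Q ^ Suc M - Q ^ H) / (Q - 1) / q * W + Q ^ M / q * w0" .
  have sumW: "(\<Sum>c\<in>(UNIV :: 'a set). cmod (ff_char c + 1 / (of_real q - 1)) powr k) = w0 + W"
    by (subst un, subst sum.insert) (auto simp: w0_def W_def leaf_weight_def q_def)
  \<comment> \<open>As \<open>q^k = q * Q\<close>, the subtracted \<open>1/(q - 1)^k\<close> in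
    \<open>B(k)\<close> is \<open>w0/(q * Q)\<close>: it corrects for the residue 0, which occurs
    only at the last level.\<close>
  have "w0 = (q / (q - 1)) powr k"
  proof -
    have "ff_char (0 :: 'a) + 1 / (of_nat CARD('a) - 1) = complex_of_real (q / (q - 1))"
      using q by (simp add: q_def field_simps)
    hence "w0 = cmod (complex_of_real (q / (q - 1))) powr k" unfolding w0_def leaf_weight_def by (simp only:)
    thus ?thesis unfolding norm_of_real using q by simp
  qed
  also have "\<dots> = q * Q / (q - 1) powr k" using q by (simp add: powr_divide Q_def powr_diff)
  finally have w0: "1 / (q - 1) powr k = w0 / (q * Q)" using q Q by simp
  have "B_const TYPE('a) k = Q / (Q - 1) * (1 / q * (w0 + W) - w0 / (q * Q))"
    unfolding B_const_def Let_def q_def[symmetric] Q_def[symmetric] sumW w0 ..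
  also have "\<dots> = Q / (Q - 1) * (W / q) + w0 / q"
    using q Q by (simp add: field_simps)
  finally have B: "B_const TYPE('a) k = Q / (Q - 1) * (W / q) + w0 / q" .
  have alg: "(Q * R - S) / d / q * W + R / q * w0 = (Q / d * (W / q) + w0 / q) * R - W / q * S / d"
    for R S d :: real
    by (simp add: diff_divide_distrib ring_distribs mult_ac)
  show ?thesis unfolding lhs B W_def[symmetric] power_Suc by (rule alg)
qed

lemma av_model_powr_eq:
  assumes r: "r \<ge> 2" and k: "k > 1"
  defines "q \<equiv> real CARD('a::finite_field)"
  shows   "av N (\<lambda>\<alpha> :: 'a fls. cmod (model r N \<alpha>) powr k) =
     (\<Sum>F\<in>(Ns r (N div 2) :: 'a poly set set). (\<bar>cF r F\<bar> * q ^ (r * nd F)) powr k * (jordan r F / q ^ (r * nd F)) *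
        (B_const TYPE('a) k * (q powr (k - 1)) ^ (N - r * nd F) -
         (\<Sum>c\<in>UNIV - {0 :: 'a}. leaf_weight k c) / q * (q powr (k - 1)) ^ (N div 2) / (q powr (k - 1) - 1)))"
proof -
  have "av N (\<lambda>\<alpha> :: 'a fls. cmod (model r N \<alpha>) powr k) = (\<Sum>F\<in>(Ns r (N div 2) :: 'a poly set set).
     (\<bar>cF r F\<bar> * q ^ (r * nd F)) powr k *
     (\<Sum>j\<in>{N div 2..N - r * nd F}. \<Sum>c\<in>(UNIV :: 'a set).
        of_bool (j = N - r * nd F \<or> c \<noteq> 0) * q powr (k * real j) * leaf_weight k c *
        av N (\<lambda>\<alpha>. of_bool (centre r N \<alpha> F \<and> leaf r F j c \<alpha>))))"
    using k unfolding q_def by (simp only: model_powr_eq[OF r] av_sum av_cmult)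
  also have "\<dots> = (\<Sum>F\<in>(Ns r (N div 2) :: 'a poly set set). (\<bar>cF r F\<bar> * q ^ (r * nd F)) powr k * (jordan r F / q ^ (r * nd F)) *
        (\<Sum>j\<in>{N div 2..N - r * nd F}. \<Sum>c\<in>(UNIV :: 'a set).
        of_bool (j = N - r * nd F \<or> c \<noteq> 0) * q powr (k * real j) * leaf_weight k c / q ^ (j + 1)))"
  proof (rule sum.cong[OF refl])
    fix F :: "'a poly set" assume F: "F \<in> Ns r (N div 2)"
    have "(\<Sum>j\<in>{N div 2..N - r * nd F}. \<Sum>c\<in>(UNIV :: 'a set).
        of_bool (j = N - r * nd F \<or> c \<noteq> 0) * q powr (k * real j) * leaf_weight k c *
        av N (\<lambda>\<alpha>. of_bool (centre r N \<alpha> F \<and> leaf r F j c \<alpha>))) =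
      (\<Sum>j\<in>{N div 2..N - r * nd F}. \<Sum>c\<in>(UNIV :: 'a set). (jordan r F / q ^ (r * nd F)) *
        (of_bool (j = N - r * nd F \<or> c \<noteq> 0) * q powr (k * real j) * leaf_weight k c / q ^ (j + 1)))"
    proof (rule sum.cong[OF refl], rule sum.cong[OF refl])
      fix j and c :: 'a assume j: "j \<in> {N div 2..N - r * nd F}"
      have "r * nd F \<le> N" using F by (auto simp: Ns_def)
      hence "av N (\<lambda>\<alpha>. of_bool (centre r N \<alpha> F \<and> leaf r F j c \<alpha>)) = jordan r F / q ^ (r * nd F + j + 1)"
        unfolding q_def using F j by (intro av_centre_leaf) auto
      also have "\<dots> = jordan r F / q ^ (r * nd F) / q ^ (j + 1)" by (simp add: power_add)
      finally have *: "av N (\<lambda>\<alpha>. of_bool (centre r N \<alpha> F \<and> leaf r F j c \<alpha>)) = jordan r F / q ^ (r * nd F) / q ^ (j + 1)" .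
      show "of_bool (j = N - r * nd F \<or> c \<noteq> 0) * q powr (k * real j) * leaf_weight k c *
          av N (\<lambda>\<alpha>. of_bool (centre r N \<alpha> F \<and> leaf r F j c \<alpha>)) =
        jordan r F / q ^ (r * nd F) *
          (of_bool (j = N - r * nd F \<or> c \<noteq> 0) * q powr (k * real j) * leaf_weight k c / q ^ (j + 1))"
        unfolding * by simp
    qed
    also have "\<dots> = (jordan r F / q ^ (r * nd F)) * (\<Sum>j\<in>{N div 2..N - r * nd F}. \<Sum>c\<in>(UNIV :: 'a set).
        of_bool (j = N - r * nd F \<or> c \<noteq> 0) * q powr (k * real j) * leaf_weight k c / q ^ (j + 1))"
      by (simp only: sum_distrib_left)
    finally show "(\<bar>cF r F\<bar> * q ^ (r * nd F)) powr k * (\<Sum>j\<in>{N div 2..N - r * nd F}. \<Sum>c\<in>(UNIV :: 'a set).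
        of_bool (j = N - r * nd F \<or> c \<noteq> 0) * q powr (k * real j) * leaf_weight k c *
        av N (\<lambda>\<alpha>. of_bool (centre r N \<alpha> F \<and> leaf r F j c \<alpha>))) =
      (\<bar>cF r F\<bar> * q ^ (r * nd F)) powr k * (jordan r F / q ^ (r * nd F)) * (\<Sum>j\<in>{N div 2..N - r * nd F}. \<Sum>c\<in>(UNIV :: 'a set).
        of_bool (j = N - r * nd F \<or> c \<noteq> 0) * q powr (k * real j) * leaf_weight k c / q ^ (j + 1))"
      by (simp only: mult.assoc)
  qed
  also have "\<dots> = (\<Sum>F\<in>(Ns r (N div 2) :: 'a poly set set). (\<bar>cF r F\<bar> * q ^ (r * nd F)) powr k * (jordan r F / q ^ (r * nd F)) *
        (B_const TYPE('a) k * (q powr (k - 1)) ^ (N - r * nd F) -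
         (\<Sum>c\<in>UNIV - {0 :: 'a}. leaf_weight k c) / q * (q powr (k - 1)) ^ (N div 2) / (q powr (k - 1) - 1)))"
  proof (rule sum.cong[OF refl])
    fix F :: "'a poly set" assume "F \<in> Ns r (N div 2)"
    hence "N div 2 \<le> N - r * nd F" by (auto simp: Ns_def)
    from sum_leaf_weights[OF k this, where 'a='a]
    show "(\<bar>cF r F\<bar> * q ^ (r * nd F)) powr k * (jordan r F / q ^ (r * nd F)) *
        (\<Sum>j\<in>{N div 2..N - r * nd F}. \<Sum>c\<in>(UNIV :: 'a set).
        of_bool (j = N - r * nd F \<or> c \<noteq> 0) * q powr (k * real j) * leaf_weight k c / q ^ (j + 1)) =
      (\<bar>cF r F\<bar> * q ^ (r * nd F)) powr k * (jordan r F / q ^ (r * nd F)) *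
        (B_const TYPE('a) k * (q powr (k - 1)) ^ (N - r * nd F) -
         (\<Sum>c\<in>UNIV - {0 :: 'a}. leaf_weight k c) / q * (q powr (k - 1)) ^ (N div 2) / (q powr (k - 1) - 1))"
      unfolding q_def by (simp only:)
  qed
  finally show ?thesis .
qed

text \<open>Let \<open>x = k - 1 - 1/r\<close> and \<open>H = N div 2\<close>. Cutting the sum over
  \<open>F\<close> at \<open>nd F = H/r\<close> costs a relative \<open>q^(-x H)\<close>. The lower
  ends of the geometric series cost \<open>Q^H\<close> for each of O(q^(H/r)) sets. Both errors are
  O(q^(N(k - 1 - x/2))).\<close>

lemma av_model_powr_approx:
  assumes r: "r \<ge> 2" and k: "k > 1 + 1 / real r"
  shows   "\<exists>C\<ge>0. \<forall>N. \<bar>av N (\<lambda>\<alpha> :: 'a::finite_field fls. cmod (model r N \<alpha>) powr k) -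
       main_const TYPE('a) r k * real CARD('a) powr (real N * (k - 1))\<bar> \<le>
     C * real CARD('a) powr (real N * (k - 1 - (k - 1 - 1 / real r) / 2))"
proof -
  define q where "q = real CARD('a)"
  have q: "q > 1" unfolding q_def by (rule CARD_real_gt_1)
  define x where "x = k - 1 - 1 / real r"
  have x: "x > 0" using k by (simp add: x_def)
  have r0: "real r > 0" using r by simp
  have k1: "k > 1" using k by (smt (verit) divide_nonneg_nonneg of_nat_0_le_iff)
  define Q where "Q = q powr (k - 1)"
  have "q powr 0 < Q" unfolding Q_def using q k1 by (intro powr_less_mono) auto
  hence Q: "Q > 1" using q by simp
  define B where "B = B_const TYPE('a) k"
  define D where "D = (\<Sum>c\<in>UNIV - {0 :: 'a}. leaf_weight k c) / q / (Q - 1)"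
  have D: "D \<ge> 0" unfolding D_def using q Q by (intro divide_nonneg_nonneg sum_nonneg) (auto simp: leaf_weight_def)
  define z where "z = (1 / zeta_ff TYPE('a) (real r)) powr k * singular_series TYPE('a) r k"
  define g where "g = geom_const q (1 - real r)"
  have g: "g \<ge> 1" unfolding g_def q_def by (rule geom_const_r_ge_1[OF r])
  have rk: "real r * (k - 1) > 1" using x r0 by (simp add: x_def field_simps)
  define C1 where "C1 = g powr k * geom_const q (1 - real r * (k - 1))"
  have C1: "C1 \<ge> 0" unfolding C1_def using geom_const_ge_1[OF q, of "1 - real r * (k - 1)"] rk by simp
  have Qpow: "Q ^ n = q powr (real n * (k - 1))" for n
    unfolding Q_def using q by (simp add: powr_power)
  have main: "\<bar>av N (\<lambda>\<alpha> :: 'a fls. cmod (model r N \<alpha>) powr k) - z * B * q powr (real N * (k - 1))\<bar> \<le>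
      (\<bar>B\<bar> * C1 * q powr x + 2 * D * g powr k) * q powr (real N * (k - 1 - x / 2))" for N
  proof -
    define H where "H = N div 2"
    have H: "real H \<le> real N / 2" "real N / 2 - 1 / 2 \<le> real H" unfolding H_def by linarith+
    define NH where "NH = (Ns r H :: 'a poly set set)"
    have NH: "finite NH" "NH \<subseteq> Fs" by (auto simp: NH_def finite_Ns[OF r], auto simp: Ns_def)
    define \<kappa> where "\<kappa> F = (\<bar>cF r F\<bar> * q ^ (r * nd F)) powr k * (jordan r F / q ^ (r * nd F))" for F :: "'a poly set"
    define \<omega> where "\<omega> F = jordan r F * \<bar>cF r F\<bar> powr k" for F :: "'a poly set"
    \<comment> \<open>The powers of \<open>q^(r nd F)\<close> from the height, the measure and the
      shortened range of \<open>j\<close> cancel, so \<open>F\<close> enters the main term only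
      through its weight \<open>\<omega> F\<close>.\<close>
    have \<kappa>\<omega>: "\<kappa> F * Q ^ (N - r * nd F) = \<omega> F * Q ^ N" if F: "F \<in> NH" for F
    proof -
      have "r * nd F \<le> N" using F by (auto simp: NH_def Ns_def H_def)
      hence "Q ^ N = Q ^ (N - r * nd F) * Q ^ (r * nd F)" by (simp add: power_add[symmetric])
      moreover have "(q ^ (r * nd F)) powr k / q ^ (r * nd F) = Q ^ (r * nd F)"
        unfolding Qpow using q by (simp add: powr_realpow[symmetric] powr_powr powr_diff[symmetric] algebra_simps)
      moreover have "\<kappa> F = \<omega> F * ((q ^ (r * nd F)) powr k / q ^ (r * nd F))"
        using q by (simp add: \<kappa>_def \<omega>_def powr_mult)
      ultimately show ?thesis by simp
    qed
    have \<kappa>le: "0 \<le> \<kappa> F" "\<kappa> F \<le> g powr k" if F: "F \<in> NH" for F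
    proof -
      have F': "F \<in> Fs" using F NH by blast
      have "jordan r F / q ^ (r * nd F) \<le> 1"
        using jordan_le[OF r F'] q by (simp add: q_def)
      moreover have "(\<bar>cF r F\<bar> * q ^ (r * nd F)) powr k \<le> g powr k"
        using norm_cF_le[OF r F'] k1 q unfolding q_def g_def by (intro powr_mono2) auto
      moreover have "jordan r F / q ^ (r * nd F) \<ge> 0" using jordan_pos[OF r F'] q by simp
      ultimately show "\<kappa> F \<le> g powr k"
        unfolding \<kappa>_def using mult_mono[of "(\<bar>cF r F\<bar> * q ^ (r * nd F)) powr k" "g powr k" "jordan r F / q ^ (r * nd F)" 1]
        by auto
      show "0 \<le> \<kappa> F"
        unfolding \<kappa>_def using jordan_pos[OF r F'] q by (intro mult_nonneg_nonneg) auto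
    qed
    have "av N (\<lambda>\<alpha> :: 'a fls. cmod (model r N \<alpha>) powr k) = (\<Sum>F\<in>NH. \<kappa> F * (B * Q ^ (N - r * nd F) - D * Q ^ H))"
      unfolding av_model_powr_eq[OF r k1] \<kappa>_def NH_def H_def B_def Q_def D_def q_def by simp
    also have "\<dots> = B * Q ^ N * (\<Sum>F\<in>NH. \<omega> F) - D * Q ^ H * (\<Sum>F\<in>NH. \<kappa> F)"
    proof -
      have "\<kappa> F * (B * Q ^ (N - r * nd F) - D * Q ^ H) = B * Q ^ N * \<omega> F - D * Q ^ H * \<kappa> F" if "F \<in> NH" for F
        using \<kappa>\<omega>[OF that] by (simp add: algebra_simps)
      thus ?thesis by (simp add: sum_subtractf sum_distrib_left)
    qed
    finally have eq: "av N (\<lambda>\<alpha> :: 'a fls. cmod (model r N \<alpha>) powr k) - z * B * q powr (real N * (k - 1)) =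
        B * Q ^ N * ((\<Sum>F\<in>NH. \<omega> F) - z) - D * Q ^ H * (\<Sum>F\<in>NH. \<kappa> F)"
      by (simp add: Qpow algebra_simps)
    have w: "\<bar>(\<Sum>F\<in>NH. \<omega> F) - z\<bar> \<le> C1 * q powr ((1 - real r * (k - 1)) * (real H / real r))"
      unfolding \<omega>_def z_def C1_def g_def q_def
    proof (rule main_weight_approx[OF r rk NH(2,1)])
      fix F :: "'a poly set" assume "F \<in> Fs" "F \<notin> NH"
      hence "H \<le> r * nd F" by (auto simp: NH_def Ns_def)
      hence "real H \<le> real r * real (nd F)" by (metis of_nat_le_iff of_nat_mult)
      thus "real H / real r \<le> real (nd F)" using r0 by (simp add: field_simps)
    qed
    also have "(1 - real r * (k - 1)) * (real H / real r) = - x * real H"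
      using r0 by (simp add: x_def field_simps)
    also have "C1 * q powr (- x * real H) \<le> C1 * q powr (x + - x / 2 * real N)"
    proof (intro mult_left_mono powr_mono)
      have "x * (real N / 2 - 1 / 2) \<le> x * real H" using H x by (intro mult_left_mono) auto
      thus "- x * real H \<le> x + - x / 2 * real N" using x by (simp add: algebra_simps)
    qed (use C1 q in auto)
    finally have w': "\<bar>(\<Sum>F\<in>NH. \<omega> F) - z\<bar> \<le> C1 * q powr (x + - x / 2 * real N)" .
    have "\<bar>B * Q ^ N * ((\<Sum>F\<in>NH. \<omega> F) - z)\<bar> \<le> \<bar>B\<bar> * Q ^ N * (C1 * q powr (x + - x / 2 * real N))"
      unfolding abs_mult using w' Q by (intro mult_mono) auto
    also have "\<dots> = \<bar>B\<bar> * C1 * q powr x * q powr (real N * (k - 1 - x / 2))"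
    proof -
      have "Q ^ N * q powr (x + - x / 2 * real N) = q powr x * q powr (real N * (k - 1 - x / 2))"
        unfolding Qpow powr_add[symmetric] by (simp add: algebra_simps)
      thus ?thesis by (simp add: mult_ac)
    qed
    finally have 1: "\<bar>B * Q ^ N * ((\<Sum>F\<in>NH. \<omega> F) - z)\<bar> \<le> \<bar>B\<bar> * C1 * q powr x * q powr (real N * (k - 1 - x / 2))" .
    have "(\<Sum>F\<in>NH. \<kappa> F) \<le> real (card NH) * g powr k"
      using sum_bounded_above[of NH \<kappa> "g powr k"] \<kappa>le by simp
    also have "\<dots> \<le> 2 * q powr (real H / real r) * g powr k"
      unfolding q_def NH_def by (intro mult_right_mono card_Ns_le[OF r]) auto
    finally have "D * Q ^ H * (\<Sum>F\<in>NH. \<kappa> F) \<le> D * Q ^ H * (2 * q powr (real H / real r) * g powr k)"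
      using D Q by (intro mult_left_mono) auto
    also have "\<dots> = 2 * D * g powr k * (Q ^ H * q powr (real H / real r))" by simp
    also have "Q ^ H * q powr (real H / real r) = q powr (real H * (k - 1 + 1 / real r))"
      unfolding Qpow powr_add[symmetric] by (simp add: algebra_simps)
    also have "2 * D * g powr k * q powr (real H * (k - 1 + 1 / real r)) \<le>
        2 * D * g powr k * q powr (real N * (k - 1 - x / 2))"
    proof (intro mult_left_mono powr_mono)
      have "real H * (k - 1 + 1 / real r) \<le> real N / 2 * (k - 1 + 1 / real r)"
        using H k1 by (intro mult_right_mono) auto
      also have "\<dots> = real N * (k - 1 - x / 2)" by (simp add: x_def field_simps)
      finally show "real H * (k - 1 + 1 / real r) \<le> real N * (k - 1 - x / 2)" .
    qed (use D q in auto)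
    finally have 2: "D * Q ^ H * (\<Sum>F\<in>NH. \<kappa> F) \<le> 2 * D * g powr k * q powr (real N * (k - 1 - x / 2))" .
    have "D * Q ^ H * (\<Sum>F\<in>NH. \<kappa> F) \<ge> 0"
      using D Q \<kappa>le by (intro mult_nonneg_nonneg sum_nonneg) auto
    with 1 2 show ?thesis unfolding eq distrib_right by linarith
  qed
  have "\<bar>B\<bar> * C1 * q powr x + 2 * D * g powr k \<ge> 0" using C1 D by simp
  moreover have "main_const TYPE('a) r k = z * B" by (simp add: main_const_def z_def B_def)
  ultimately show ?thesis using main unfolding q_def[symmetric] x_def[symmetric] by metis
qed

section \<open>The asymptotic formula\<close>

text \<open>Mean value theorem, with the derivative taken at most at \<open>m + e\<close>. The term
  linear in \<open>e\<close> leads to the mixed moment, the other one to the moment of the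
  error.\<close>

lemma abs_powr_diff_le:
  fixes s m e k :: real
  assumes k: "k \<ge> 1" and "s \<ge> 0" "m \<ge> 0" "\<bar>s - m\<bar> \<le> e"
  shows   "\<bar>s powr k - m powr k\<bar> \<le> k * 2 powr (k - 1) * (m powr (k - 1) * e + e powr k)"
proof -
  have key: "b powr k - a powr k \<le> k * (b powr (k - 1) * (b - a))" if ab: "0 \<le> a" "a \<le> b" for a b
  proof (cases "a = b \<or> a = 0")
    case True
    show ?thesis
    proof (cases "a = b")
      case False
      hence "a = 0" "b > 0" using True ab by auto
      moreover have "b powr k = b powr (k - 1) * b" using \<open>b > 0\<close> by (simp add: powr_diff)
      ultimately show ?thesis using k by (simp add: mult_right_mono)
    qed simp
  next
    case False
    hence ab': "0 < a" "a < b" using ab by auto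
    obtain z where z: "a < z" "z < b" "b powr k - a powr k = (b - a) * (k * z powr (k - 1))"
      using MVT2[of a b "\<lambda>x. x powr k" "\<lambda>x. k * x powr (k - 1)"] ab'
      by (metis has_real_derivative_powr less_le_trans)
    have "z powr (k - 1) \<le> b powr (k - 1)" using z ab' k by (intro powr_mono2) auto
    hence "(b - a) * (k * z powr (k - 1)) \<le> (b - a) * (k * b powr (k - 1))"
      using ab' k by (intro mult_left_mono) auto
    thus ?thesis using z(3) by (simp add: mult_ac)
  qed
  have e: "e \<ge> 0" using assms by linarith
  have "\<bar>s powr k - m powr k\<bar> \<le> k * (max s m powr (k - 1) * \<bar>s - m\<bar>)"
    using key[of s m] key[of m s] assms powr_mono2[of k s m] powr_mono2[of k m s]
    by (cases "s \<le> m") (auto simp: max_def abs_if)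
  also have "\<dots> \<le> k * ((m + e) powr (k - 1) * e)"
    using assms by (intro mult_left_mono mult_mono powr_mono2) auto
  also have "\<dots> \<le> k * (2 powr (k - 1) * (m powr (k - 1) + e powr (k - 1)) * e)"
    using assms e by (intro mult_left_mono mult_right_mono powr_add_le) auto
  also have "\<dots> = k * 2 powr (k - 1) * (m powr (k - 1) * e + e powr (k - 1) * e)"
    by (simp add: algebra_simps)
  also have "e powr (k - 1) * e = e powr k"
    using e by (cases "e = 0") (auto simp: powr_diff)
  finally show ?thesis .
qed

lemma set_integral_exp_sum:
  "(LINT \<alpha>:torus|(haar :: 'a::finite_field fls measure). cmod (exp_sum r N \<alpha>) powr k) =
     av N (\<lambda>\<alpha> :: 'a fls. cmod (exp_sum r N \<alpha>) powr k)"
proof (rule set_integral_torus_eq_av)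
  fix \<alpha> \<beta> :: "'a fls"
  assume eq: "\<And>i. 1 \<le> i \<Longrightarrow> i \<le> int N + 1 \<Longrightarrow> fls_nth \<alpha> i = fls_nth \<beta> i"
  have "laurent_char (poly_to_laurent f * \<alpha>) = laurent_char (poly_to_laurent f * \<beta>)"
    if "f \<in> monics_le N" for f
  proof -
    have f: "f \<in> Pol (Suc N)" using that by (simp add: monics_le_def Pol_degree_le)
    show ?thesis unfolding laurent_char_times_nth[OF f] using eq
      by (intro arg_cong[where f = ff_char] sum.cong refl) auto
  qed
  hence "exp_sum r N \<alpha> = exp_sum r N \<beta>"
    unfolding exp_sum_eq_monics_le by (intro sum.cong refl) simp
  thus "cmod (exp_sum r N \<alpha>) powr k = cmod (exp_sum r N \<beta>) powr k" by simp
qed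

text \<open>The first bound is strict, which leaves room for a power of \<open>N\<close> in the
  moment of the error. The second becomes an equality for k > 3 + 1/r and is matched only with
  estimates free of such losses. The third follows from the first because
  \<open>\<rho> \<le> 1/2\<close>, and serves the mixed moment for small \<open>k\<close>.\<close>

lemma theta_bounds:
  fixes r :: nat and k \<epsilon> :: real
  assumes r: "r \<ge> 2" and k: "k > 1 + 1 / real r" and \<epsilon>: "\<epsilon> > 0"
  defines "\<rho> \<equiv> 1 / real r"
  shows   "theta r k \<epsilon> < (1 - \<rho>) * (k - 1 - \<rho>) / 2"
    and   "k > 2 + \<rho> \<Longrightarrow> theta r k \<epsilon> \<le> 1 - \<rho>"
    and   "theta r k \<epsilon> < (k - 3 * \<rho>) / 2"
proof -
  define x where "x = k - 1 - \<rho>"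
  have \<rho>: "0 < \<rho>" "\<rho> \<le> 1 / 2" using r by (auto simp: \<rho>_def field_simps)
  have x: "x > 0" using k by (simp add: x_def \<rho>_def)
  have th: "theta r k \<epsilon> = (if x > 2 then 1 - \<rho> else if x > 1 then (1 - \<rho>) * x / 2 - \<epsilon>
      else (1 - \<rho>)\<^sup>2 * x / ((1 - \<rho>) * x + (2 - \<rho> - x)) - \<epsilon>)"
    unfolding theta_def Let_def \<rho>_def[symmetric] x_def by auto
  show 1: "theta r k \<epsilon> < (1 - \<rho>) * (k - 1 - \<rho>) / 2"
    unfolding x_def[symmetric]
  proof (cases "x > 1")
    case True
    have "(1 - \<rho>) * 2 < (1 - \<rho>) * x" if "x > 2" using that \<rho> by (intro mult_strict_left_mono) auto
    thus "theta r k \<epsilon> < (1 - \<rho>) * x / 2" using True \<epsilon> by (auto simp: th)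
  next
    case False
    \<comment> \<open>Here \<open>3 - k = 2 - \<rho> - x\<close>, so the denominator is
      \<open>2 - \<rho> - \<rho> x\<close>, at least \<open>2 (1 - \<rho>)\<close> for
      \<open>x \<le> 1\<close>. The third expression for the exponent is thus at most
      \<open>(1 - \<rho>) x / 2 - \<epsilon>\<close>.\<close>
    have "\<rho> * x \<le> \<rho> * 1" using False \<rho> by (intro mult_left_mono) auto
    hence den: "(1 - \<rho>) * x + (2 - \<rho> - x) \<ge> 2 * (1 - \<rho>)" by (simp add: algebra_simps)
    have le: "(1 - \<rho>)\<^sup>2 * x / ((1 - \<rho>) * x + (2 - \<rho> - x)) \<le> (1 - \<rho>)\<^sup>2 * x / (2 * (1 - \<rho>))"
      using den \<rho> x by (intro divide_left_mono) auto
    have "d\<^sup>2 * x / (2 * d) = d * x / 2" if "d \<noteq> 0" for d :: real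
      using that by (simp add: power2_eq_square)
    from this[of "1 - \<rho>"] have eq: "(1 - \<rho>)\<^sup>2 * x / (2 * (1 - \<rho>)) = (1 - \<rho>) * x / 2"
      using \<rho> by linarith
    have "theta r k \<epsilon> = (1 - \<rho>)\<^sup>2 * x / ((1 - \<rho>) * x + (2 - \<rho> - x)) - \<epsilon>"
      using False unfolding th by auto
    thus "theta r k \<epsilon> < (1 - \<rho>) * x / 2" using le[unfolded eq] \<epsilon> by linarith
  qed
  show "theta r k \<epsilon> \<le> 1 - \<rho>" if "k > 2 + \<rho>"
  proof (cases "x > 2")
    case False
    have "(1 - \<rho>) * x \<le> (1 - \<rho>) * 2" using False \<rho> by (intro mult_left_mono) auto
    hence "(1 - \<rho>) * x / 2 \<le> 1 - \<rho>" by simp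
    thus ?thesis using 1 unfolding x_def[symmetric] by linarith
  qed (simp add: th)
  have "\<rho> * (1 + \<rho>) \<le> \<rho> * k" using k \<rho> by (intro mult_left_mono) (auto simp: \<rho>_def)
  hence "(1 - \<rho>) * (k - 1 - \<rho>) \<le> k - 3 * \<rho>" using \<rho> by (simp add: algebra_simps)
  hence "(1 - \<rho>) * (k - 1 - \<rho>) / 2 \<le> (k - 3 * \<rho>) / 2" by (rule divide_right_mono) simp
  with 1 show "theta r k \<epsilon> < (k - 3 * \<rho>) / 2" by (rule less_le_trans)
qed

lemma absorb_polynomial:
  assumes q: "q > (1::real)" and ab: "a < b"
  shows   "\<exists>C\<ge>0. \<forall>N :: nat. (real N + 5) ^ 4 * q powr (real N * a) \<le> C * q powr (real N * b)"
proof -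
  obtain C where C: "C \<ge> 0" "\<And>N :: nat. (real N + 5) ^ 4 \<le> C * q powr ((b - a) * real N)"
    using polynomial_le_exponential[OF q, of "b - a"] ab by auto
  have "(real N + 5) ^ 4 * q powr (real N * a) \<le> C * q powr (real N * b)" for N :: nat
  proof -
    have "(real N + 5) ^ 4 * q powr (real N * a) \<le> C * q powr ((b - a) * real N) * q powr (real N * a)"
      by (intro mult_right_mono C) auto
    also have "\<dots> = C * q powr (real N * b)"
      by (simp add: powr_add[symmetric] mult.assoc algebra_simps)
    finally show ?thesis .
  qed
  thus ?thesis using C(1) by blast
qed

text \<open>Above 2 + 1/r the sum over the arcs is sharp, and \<open>theta \<le> 1 - 1/r\<close> is
  enough even with equality. Below, a power of \<open>N\<close> is lost and a strict inequality
  between exponents absorbs it.\<close>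

lemma av_mixed_bound:
  fixes r :: nat and k \<epsilon> :: real
  assumes r: "r \<ge> 2" and k: "k > 1 + 1 / real r" and \<epsilon>: "\<epsilon> > 0"
  shows   "\<exists>C\<ge>0. \<forall>N. av N (\<lambda>\<alpha> :: 'a::finite_field fls.
       cmod (model r N \<alpha>) powr (k - 1) * cmod (exp_sum r N \<alpha> - model r N \<alpha>)) \<le>
     C * real CARD('a) powr (real N * (k - 1 - theta r k \<epsilon>))"
proof -
  define q where "q = real CARD('a)"
  have q: "q > 1" unfolding q_def by (rule CARD_real_gt_1)
  define \<rho> where "\<rho> = 1 / real r"
  have k1: "k - 1 > 0" using k by (smt (verit) divide_nonneg_nonneg of_nat_0_le_iff)
  define T where "T = k - 1 - theta r k \<epsilon>"
  define \<Sigma> where "\<Sigma> N = (\<Sum>F\<in>(Ns r (N div 2) :: 'a poly set set).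
       \<Sum>j\<in>{N div 2..N - r * nd F}. q powr ((k - 2) * real j))" for N
  have "k - 1 - 1 = k - 2" by simp
  then obtain C where C: "C \<ge> 0" "\<And>N. av N (\<lambda>\<alpha> :: 'a fls.
       cmod (model r N \<alpha>) powr (k - 1) * cmod (exp_sum r N \<alpha> - model r N \<alpha>)) \<le>
     C * q powr (real N / real r) * \<Sigma> N"
    using av_mixed_le[OF r k1, where 'a='a] unfolding q_def \<Sigma>_def by auto
  have "\<exists>D\<ge>0. \<forall>N. q powr (real N / real r) * \<Sigma> N \<le> D * q powr (real N * T)"
  proof (cases "k > 2 + \<rho>")
    case True
    then obtain D where D: "D \<ge> 0" "\<And>N. \<Sigma> N \<le> D * q powr (real N * (k - 2))"
      using sum_arcs_le_large[OF r, where 'a='a, of k] unfolding \<rho>_def q_def \<Sigma>_def by blast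
    have "q powr (real N / real r) * \<Sigma> N \<le> D * q powr (real N * T)" for N
    proof -
      have "q powr (real N / real r) * \<Sigma> N \<le> q powr (real N / real r) * (D * q powr (real N * (k - 2)))"
        by (intro mult_left_mono D) auto
      also have "\<dots> = D * q powr (real N * (\<rho> + (k - 2)))"
        by (simp add: powr_add ring_distribs \<rho>_def)
      also have "\<dots> \<le> D * q powr (real N * T)"
        using theta_bounds(2)[OF r k \<epsilon>] True q D(1) unfolding T_def \<rho>_def
        by (intro mult_left_mono powr_mono) auto
      finally show ?thesis .
    qed
    thus ?thesis using D(1) by blast
  next
    case False
    define a where "a = \<rho> + (k - 2 + \<rho>) / 2"
    have "a < T" using theta_bounds(3)[OF r k \<epsilon>] unfolding a_def T_def \<rho>_def[symmetric] by (simp add: field_simps)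
    then obtain D where D: "D \<ge> 0" "\<And>N :: nat. (real N + 5) ^ 4 * q powr (real N * a) \<le> D * q powr (real N * T)"
      using absorb_polynomial[OF q] by blast
    have "q powr (real N / real r) * \<Sigma> N \<le> q * D * q powr (real N * T)" for N
    proof -
      have "\<Sigma> N \<le> (real N + 5) ^ 4 * (q * q powr (real N * ((k - 2 + \<rho>) / 2)))"
        unfolding \<Sigma>_def q_def \<rho>_def using False k1 by (intro sum_arcs_le_small[OF r]) (auto simp: \<rho>_def)
      hence "q powr (real N / real r) * \<Sigma> N \<le>
          q powr (real N / real r) * ((real N + 5) ^ 4 * (q * q powr (real N * ((k - 2 + \<rho>) / 2))))"
        by (intro mult_left_mono) auto
      also have "\<dots> = q * ((real N + 5) ^ 4 * q powr (real N * a))"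
        by (simp add: a_def powr_add ring_distribs \<rho>_def)
      also have "\<dots> \<le> q * (D * q powr (real N * T))" using q by (intro mult_left_mono D) auto
      finally show ?thesis by simp
    qed
    moreover have "q * D \<ge> 0" using q D by simp
    ultimately show ?thesis by blast
  qed
  then obtain D where D: "D \<ge> 0" "\<And>N. q powr (real N / real r) * \<Sigma> N \<le> D * q powr (real N * T)" by blast
  have "av N (\<lambda>\<alpha> :: 'a fls. cmod (model r N \<alpha>) powr (k - 1) * cmod (exp_sum r N \<alpha> - model r N \<alpha>)) \<le>
      C * D * q powr (real N * T)" for N
  proof -
    have "C * (q powr (real N / real r) * \<Sigma> N) \<le> C * (D * q powr (real N * T))"
      using C(1) by (intro mult_left_mono D)
    thus ?thesis using C(2)[of N] by (simp add: mult.assoc)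
  qed
  moreover have "C * D \<ge> 0" using C D by simp
  ultimately show ?thesis unfolding T_def q_def by blast
qed

theorem theorem1p2:
  fixes r :: nat and k \<epsilon> :: real
  assumes "r \<ge> 2" and "k > 1 + 1 / real r" and "\<epsilon> > 0"
  shows "\<exists>K. \<forall>N\<ge>1.
    \<bar>(LINT \<alpha>:torus|(haar :: 'a::finite_field fls measure). cmod (exp_sum r N \<alpha>) powr k)
        - main_const TYPE('a) r k * real CARD('a) powr (real N * (k - 1))\<bar>
      \<le> K * real CARD('a) powr (real N * (k - 1 - theta r k \<epsilon>))"
proof -
  define q where "q = real CARD('a)"
  have q: "q > 1" unfolding q_def by (rule CARD_real_gt_1)
  define \<rho> where "\<rho> = 1 / real r"
  have \<rho>: "\<rho> \<ge> 0" by (simp add: \<rho>_def)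
  define x where "x = k - 1 - \<rho>"
  have x: "x > 0" using assms by (simp add: x_def \<rho>_def)
  have k1: "k \<ge> 1" using x \<rho> by (simp add: x_def)
  define T where "T = k - 1 - theta r k \<epsilon>"
  have th: "theta r k \<epsilon> < (1 - \<rho>) * x / 2"
    using theta_bounds(1)[OF assms] unfolding x_def \<rho>_def .
  define A where "A N = main_const TYPE('a) r k * q powr (real N * (k - 1))" for N
  define E where "E N \<alpha> = cmod (exp_sum r N \<alpha> - model r N \<alpha>)" for N and \<alpha> :: "'a fls"
  obtain C1 where C1: "C1 \<ge> 0" "\<And>N. \<bar>av N (\<lambda>\<alpha> :: 'a fls. cmod (model r N \<alpha>) powr k) - A N\<bar> \<le>
      C1 * q powr (real N * (k - 1 - x / 2))"
    using av_model_powr_approx[OF assms(1,2), where 'a='a] unfolding A_def q_def x_def \<rho>_def by blast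
  obtain C2 where C2: "C2 \<ge> 0" "\<And>N. av N (\<lambda>\<alpha> :: 'a fls. E N \<alpha> powr k) \<le>
      C2 * ((real N + 5) ^ 4 * q powr (real N * ((1 + \<rho>) / 2 * x + \<rho>)))"
    using av_error_powr_k_le[OF assms(1,2), where 'a='a] unfolding E_def q_def x_def \<rho>_def by blast
  obtain C3 where C3: "C3 \<ge> 0" "\<And>N. av N (\<lambda>\<alpha> :: 'a fls. cmod (model r N \<alpha>) powr (k - 1) * E N \<alpha>) \<le>
      C3 * q powr (real N * T)"
    using av_mixed_bound[OF assms, where 'a='a] unfolding E_def q_def T_def by blast
  \<comment> \<open>As \<open>x + \<rho> = k - 1\<close>, the left side is
    \<open>k - 1 - (1 - \<rho>) x / 2\<close>, so this is the first bound on
    \<open>theta\<close>.\<close>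
  have "(1 + \<rho>) / 2 * x + \<rho> < T"
    using th by (simp add: T_def x_def field_simps)
  then obtain C4 where C4: "C4 \<ge> 0" "\<And>N :: nat. (real N + 5) ^ 4 * q powr (real N * ((1 + \<rho>) / 2 * x + \<rho>)) \<le>
      C4 * q powr (real N * T)"
    using absorb_polynomial[OF q] by blast
  \<comment> \<open>The approximation of the moment of the model saves \<open>x / 2\<close>, at
    least as much as the moment of the error does.\<close>
  have "(1 - \<rho>) * x / 2 \<le> x / 2" using \<rho> x by (simp add: mult_left_le_one_le)
  hence xT: "k - 1 - x / 2 \<le> T" using th by (simp add: T_def)
  define L where "L = k * 2 powr (k - 1)"
  have L: "L \<ge> 0" using k1 by (simp add: L_def)
  have "\<bar>av N (\<lambda>\<alpha> :: 'a fls. cmod (exp_sum r N \<alpha>) powr k) - A N\<bar> \<le>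
      (C1 + L * (C3 + C2 * C4)) * q powr (real N * T)" for N
  proof -
    have "\<bar>av N (\<lambda>\<alpha> :: 'a fls. cmod (exp_sum r N \<alpha>) powr k) - av N (\<lambda>\<alpha> :: 'a fls. cmod (model r N \<alpha>) powr k)\<bar> \<le>
        av N (\<lambda>\<alpha> :: 'a fls. \<bar>cmod (exp_sum r N \<alpha>) powr k - cmod (model r N \<alpha>) powr k\<bar>)"
      unfolding av_diff[symmetric] by (rule av_abs)
    also have "\<dots> \<le> av N (\<lambda>\<alpha> :: 'a fls. L * (cmod (model r N \<alpha>) powr (k - 1) * E N \<alpha> + E N \<alpha> powr k))"
      unfolding L_def E_def by (intro av_mono abs_powr_diff_le k1 norm_triangle_ineq3) auto
    also have "\<dots> = L * (av N (\<lambda>\<alpha> :: 'a fls. cmod (model r N \<alpha>) powr (k - 1) * E N \<alpha>) +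
        av N (\<lambda>\<alpha> :: 'a fls. E N \<alpha> powr k))"
      by (simp only: av_cmult av_add)
    also have "\<dots> \<le> L * (C3 * q powr (real N * T) + C2 * (C4 * q powr (real N * T)))"
    proof -
      have "av N (\<lambda>\<alpha> :: 'a fls. E N \<alpha> powr k) \<le> C2 * (C4 * q powr (real N * T))"
        using C2(2)[of N] mult_left_mono[OF C4(2)[of N] C2(1)] by linarith
      thus ?thesis using L C3(2)[of N] by (intro mult_left_mono add_mono)
    qed
    finally have 1: "\<bar>av N (\<lambda>\<alpha> :: 'a fls. cmod (exp_sum r N \<alpha>) powr k) - av N (\<lambda>\<alpha> :: 'a fls. cmod (model r N \<alpha>) powr k)\<bar>
        \<le> L * (C3 * q powr (real N * T) + C2 * (C4 * q powr (real N * T)))" .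
    have "C1 * q powr (real N * (k - 1 - x / 2)) \<le> C1 * q powr (real N * T)"
      using q C1(1) xT by (intro mult_left_mono powr_mono) auto
    hence 2: "\<bar>av N (\<lambda>\<alpha> :: 'a fls. cmod (model r N \<alpha>) powr k) - A N\<bar> \<le> C1 * q powr (real N * T)"
      using C1(2)[of N] by linarith
    have "(C1 + L * (C3 + C2 * C4)) * q powr (real N * T) =
        C1 * q powr (real N * T) + L * (C3 * q powr (real N * T) + C2 * (C4 * q powr (real N * T)))"
      by (simp add: algebra_simps)
    thus ?thesis using 1 2 by linarith
  qed
  thus ?thesis unfolding set_integral_exp_sum A_def T_def q_def by blast
qed

end
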